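(* Let $p>3$ be an odd prime with $p\equiv 3 \pmod 4$. Then $$\sum_{m=1}^{p-1}\sum_{n=1}^{p-1}\left|C(m,n,5,1;p)\right|^4\cdot S^2(m\overline{n},p) = \frac{5}{48}p^5+O\!\left(p^4\exp\!\left(\frac{3\ln p}{\ln\ln p}\right)\right).$$
   Context: For a positive integer $q\ge 3$, integers $m,n$ and positive integers $k,h$, the two-term exponential sum is $C(m,n,k,h;q)=\sum_{a=0}^{q-1} e\!\left(\frac{ma^k+na^h}{q}\right)$, where $e(y)=e^{2\pi i y}$. For a positive integer $q$ and an integer $h$ coprime to $q$, the Dedekind sum is $S(h,q)=\sum_{a=0}^{q-1}\left(\left(\frac{a}{q}\right)\right)\left(\left(\frac{ah}{q}\right)\right)$, where $((x))=x-[x]-\frac12$ if $x$ is not an integer and $((x))=0$ if $x$ is an integer ($[x]$ the greatest integer $\le x$). For $n$ coprime to $p$, $\overline{n}$ denotes the inverse of $n$ modulo $p$. The implied constant in $O(\cdot)$ is absolute. *)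

theory Defs
  imports "HOL-Analysis.Analysis" "HOL-Number_Theory.Number_Theory"
begin

definition e_fun :: "real \<Rightarrow> complex" where
  "e_fun y = exp (2 * of_real pi * \<i> * of_real y)"

definition two_term_sum :: "int \<Rightarrow> int \<Rightarrow> nat \<Rightarrow> nat \<Rightarrow> nat \<Rightarrow> complex" where
  "two_term_sum m n k h q =
     (\<Sum>a<q. e_fun (real_of_int (m * int a ^ k + n * int a ^ h) / real q))"

definition sawtooth :: "real \<Rightarrow> real" where
  "sawtooth x = (if x \<in> \<int> then 0 else x - real_of_int \<lfloor>x\<rfloor> - 1/2)"

definition dedekind_sum :: "int \<Rightarrow> nat \<Rightarrow> real" where
  "dedekind_sum h q =
     (\<Sum>a<q. sawtooth (real a / real q) * sawtooth (real_of_int (int a * h) / real q))"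

end

theory Submission
  imports Defs "HOL-Real_Asymp.Real_Asymp"
begin

text \<open>
  Write \<open>W(m, n) = |C(m, n, 5, 1; p)|\<^sup>4\<close> and \<open>u = m/n\<close>. Replacing the summation variable \<open>a\<close> by
  \<open>t a\<close> shows that \<open>F(u) = \<Sum>\<^sub>n W(u n, n)\<close> depends only on the class of \<open>u\<close> modulo fourth
  powers. For \<open>p \<equiv> 3 (mod 4)\<close> every nonzero class is plus or minus a fourth power, while
  \<open>S\<^sup>2(u, p)\<close> is even in \<open>u\<close>, so the double sum factors exactly:
  \<open>(p - 1) \<Sum> W(m, n) S\<^sup>2(m/n, p) = (\<Sum> W(m, n)) (\<Sum> S\<^sup>2(u, p))\<close>.

  The first factor counts solutions of \<open>a + b = c + d\<close>, \<open>a\<^sup>5 + b\<^sup>5 = c\<^sup>5 + d\<^sup>5\<close>, which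
  split into three planes and a quadric cone of \<open>p\<^sup>2\<close> points each; it is \<open>3 p\<^sup>4 + O(p\<^sup>3)\<close>.

  For the second, \<open>S(u, p) = 1/(4p) \<Sum> cot(\<pi>k/p) cot(\<pi>uk/p)\<close> turns \<open>\<Sum> S\<^sup>2\<close> into a sum over
  quadruples with \<open>k l' \<equiv> l k' (mod p)\<close>, where \<open>cot(\<pi>k/p) = p/(\<pi>k) + O(1)\<close>. The quadruples with
  \<open>k l' = l k'\<close> give \<open>5/144 p\<^sup>2\<close> through \<open>\<zeta>(2)\<^sup>4/\<zeta>(4)\<close>; the remaining ones are controlled by
  the maximal order of the divisor function, which is the source of the error term.
\<close>

section \<open>Truncated zeta sums\<close>

text \<open>The mass of \<open>W\<close> over all residue pairs is about 4 p^4, one p^4 for each of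
  the four components; removing the single term \<open>W 0 0\<close> = p^4 leaves 3 p^4, and 3 *
  5/144 = 5/48. The condition p = 3 mod 4 acts in three places. Signed fourth powers exhaust the
  nonzero classes; quadratic Gauss sums are odd, so the cone has exactly p^2 points; and a sum of
  two squares vanishes mod p only trivially, so the cone meets each plane in the origin alone. The
  delicate part is the set of quadruples with k l' - l k' a nonzero multiple p j. Trading one of the
  products k l', l k' for p j gains a factor 1/p, and the price is the number of factorizations of
  the other product, an integer below p^2. With small primes cut off at sqrt (ln p), this number is
  about exp (4 ln 2 * ln p / ln ln p) at most. Since 4 ln 2 < 3, the exponent 3 of the theorem also
  absorbs the cube of ln p produced by harmonic sums.\<close>

definition zsum :: "nat \<Rightarrow> nat \<Rightarrow> real" where
  "zsum j n = (\<Sum>g=1..n. 1 / real g ^ j)"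

lemma zsum_nonneg: "zsum j n \<ge> 0"
  by (simp add: zsum_def sum_nonneg)

lemma inverse_square_le_diff:
  assumes "n > 0"
  shows "1 / real (Suc n) ^ 2 \<le> 1 / real n - 1 / real (Suc n)"
proof -
  have "1 / real (Suc n) ^ 2 \<le> 1 / (real n * real (Suc n))"
    using assms by (intro divide_left_mono) (auto simp: power2_eq_square)
  also have "\<dots> = 1 / real n - 1 / real (Suc n)"
    using assms by (simp add: field_simps)
  finally show ?thesis .
qed

text \<open>The partial sums increase to the Basel limit, while adding 1/n makes them decrease to
  the same limit, because 1/(n+1)^2 is at most 1/n - 1/(n+1).\<close>

lemma zsum_2_bounds:
  assumes "n > 0"
  shows "zsum 2 n \<le> pi\<^sup>2 / 6" "pi\<^sup>2 / 6 \<le> zsum 2 n + 1 / real n"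
proof -
  have eq: "(\<Sum>k<n. 1 / (1 + real k)\<^sup>2) = zsum 2 n" for n
    unfolding zsum_def by (induction n) (simp_all add: add.commute)
  have lim: "(\<lambda>n. zsum 2 n) \<longlonglongrightarrow> pi\<^sup>2 / 6"
    using inverse_squares_sums unfolding sums_def by (simp add: eq)
  have "incseq (zsum 2)"
    by (rule incseq_SucI) (simp add: zsum_def)
  then show "zsum 2 n \<le> pi\<^sup>2 / 6"
    using lim by (rule incseq_le)
  have "decseq (\<lambda>n. zsum 2 (Suc n) + 1 / real (Suc n))"
  proof (rule decseq_SucI)
    fix n
    have "1 / real (Suc (Suc n)) ^ 2 + 1 / real (Suc (Suc n)) \<le> 1 / real (Suc n)"
      using inverse_square_le_diff[of "Suc n"] by simp
    then show "zsum 2 (Suc (Suc n)) + 1 / real (Suc (Suc n)) \<le> zsum 2 (Suc n) + 1 / real (Suc n)"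
      by (simp add: zsum_def)
  qed
  moreover have "(\<lambda>n. zsum 2 (Suc n) + 1 / real (Suc n)) \<longlonglongrightarrow> pi\<^sup>2 / 6 + 0"
    by (intro tendsto_add LIMSEQ_Suc[OF lim]) real_asymp
  ultimately have "pi\<^sup>2 / 6 + 0 \<le> zsum 2 (Suc (n - 1)) + 1 / real (Suc (n - 1))"
    by (rule decseq_ge)
  then show "pi\<^sup>2 / 6 \<le> zsum 2 n + 1 / real n" using assms by simp
qed

lemma zsum_2_le_2: "zsum 2 n \<le> 2"
proof (cases "n = 0")
  case False
  have "zsum 2 n \<le> 2 - 1 / real n" if "n > 0" for n
    using that
  proof (induction n rule: nat_induct_non_zero)
    case (Suc n)
    have "1 / real (Suc n) ^ 2 \<le> 1 / real n - 1 / real (Suc n)"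
      using Suc.hyps by (rule inverse_square_le_diff)
    with Suc.IH show ?case by (simp add: zsum_def)
  qed (simp add: zsum_def)
  with False have "zsum 2 n \<le> 2 - 1 / real n" by simp
  also have "\<dots> \<le> 2" by simp
  finally show ?thesis .
qed (simp add: zsum_def)

lemma sum_inverse_shift: "(\<Sum>k=1..j. 1 / (real m + real k)) = harm (m + j) - (harm m :: real)"
  by (induction j) (simp_all add: harm_Suc inverse_eq_divide add_ac)

lemma sum_inverse_reflect:
  assumes "j < m"
  shows "(\<Sum>k=1..j. 1 / (real m - real k)) = harm (m - 1) - (harm (m - 1 - j) :: real)"
  using assms
proof (induction j)
  case (Suc j)
  have "harm (m - 1 - j) = (harm (m - 1 - Suc j) :: real) + 1 / (real m - real (Suc j))"
    using Suc.prems harm_Suc[of "m - 1 - Suc j", where ?'a = real]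
    by (simp add: Suc_diff_Suc of_nat_diff field_simps)
  with Suc show ?case by simp
qed simp

text \<open>The partial fractions (1/(k - m) - 1/(k + m)) / (2m) telescope into harmonic numbers.
  The term 3/(4 m^2) is (1/m + 1/(2m)) / (2m); it arises when the base case rewrites
  \<open>harm (m - 1)\<close> and \<open>harm (m + (m - 1))\<close> as \<open>harm m\<close> and
  \<open>harm (m + m)\<close>.\<close>

lemma sum_inverse_square_diff:
  assumes "0 < m" "m \<le> M"
  shows "(\<Sum>k\<in>{1..M} - {m}. 1 / (real k ^ 2 - real m ^ 2))
    = 3 / (4 * real m ^ 2) - (harm (M + m) - harm (M - m)) / (2 * real m)"
  using assms(2)
proof (induction M rule: dec_induct)
  case base
  have "(\<Sum>k\<in>{1..m} - {m}. 1 / (real k ^ 2 - real m ^ 2))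
     = (\<Sum>k=1..m-1. 1 / (real k ^ 2 - real m ^ 2))"
    using assms(1) by (intro sum.cong) auto
  also have "\<dots> = (\<Sum>k=1..m-1. - (1 / (real m - real k) + 1 / (real m + real k)) / (2 * real m))"
  proof (intro sum.cong refl)
    fix k assume "k \<in> {1..m-1}"
    then have "real k < real m" using assms by auto
    then have "real m - real k \<noteq> 0" "real m + real k \<noteq> 0" "real k - real m \<noteq> 0" by linarith+
    moreover have "real k ^ 2 - real m ^ 2 = (real k - real m) * (real m + real k)"
      by (simp add: power2_eq_square algebra_simps)
    ultimately show "1 / (real k ^ 2 - real m ^ 2) = - (1 / (real m - real k) + 1 / (real m + real k)) / (2 * real m)"
      using assms by (simp add: divide_simps)
  qed
  also have "\<dots> = - ((\<Sum>k=1..m-1. 1 / (real m - real k)) + (\<Sum>k=1..m-1. 1 / (real m + real k))) / (2 * real m)"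
    by (simp add: sum_divide_distrib sum.distrib sum_negf add_divide_distrib diff_divide_distrib sum_subtractf)
  also have "(\<Sum>k=1..m-1. 1 / (real m - real k)) = harm (m - 1)"
    using sum_inverse_reflect[of "m - 1" m] assms by (simp add: harm_def)
  also have "(\<Sum>k=1..m-1. 1 / (real m + real k)) = harm (m + (m - 1)) - harm m"
    by (rule sum_inverse_shift)
  also have "harm (m - 1) = harm m - 1 / real m"
    using harm_Suc[of "m - 1", where ?'a = real] assms by (simp add: field_simps)
  also have "harm (m + (m - 1)) = harm (m + m) - 1 / (2 * real m)"
    using harm_Suc[of "m + (m - 1)", where ?'a = real] assms by (simp add: field_simps)
  finally show ?case using assms by (simp add: harm_expand(1) add_divide_distrib diff_divide_distrib power2_eq_square)
next
  case (step M)
  have "{1..Suc M} - {m} = insert (Suc M) ({1..M} - {m})" using step.hyps by auto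
  then have "(\<Sum>k\<in>{1..Suc M} - {m}. 1 / (real k ^ 2 - real m ^ 2))
     = 1 / (real (Suc M) ^ 2 - real m ^ 2) + (\<Sum>k\<in>{1..M} - {m}. 1 / (real k ^ 2 - real m ^ 2))"
    by simp
  also have "1 / (real (Suc M) ^ 2 - real m ^ 2) = (1 / (real (Suc M) - real m) - 1 / (real (Suc M) + real m)) / (2 * real m)"
  proof -
    have "real (Suc M) - real m \<noteq> 0" "real (Suc M) + real m \<noteq> 0" using step.hyps by auto
    moreover have "real (Suc M) ^ 2 - real m ^ 2 = (real (Suc M) - real m) * (real (Suc M) + real m)"
      by (simp add: power2_eq_square algebra_simps)
    ultimately show ?thesis using assms
      by (simp add: divide_simps del: of_nat_Suc)
  qed
  also note step.IH
  also have "harm (M + m) = (harm (Suc M + m) :: real) - 1 / (real (Suc M) + real m)"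
    using harm_Suc[of "M + m", where ?'a = real] by (simp add: field_simps)
  also have "harm (M - m) = (harm (Suc M - m) :: real) - 1 / (real (Suc M) - real m)"
    using harm_Suc[of "M - m", where ?'a = real] step.hyps
    by (simp add: Suc_diff_le of_nat_diff field_simps)
  finally show ?case by (simp add: add_divide_distrib diff_divide_distrib)
qed

lemma harm_diff_bounds:
  assumes "m \<le> M"
  shows "0 \<le> harm (M + m) - (harm (M - m) :: real)"
    and "harm (M + m) - (harm (M - m) :: real) \<le> 2 * real m / (real M - real m + 1)"
proof -
  show "0 \<le> harm (M + m) - (harm (M - m) :: real)"
    using harm_mono[of "M - m" "M + m", where ?'a = real] by simp
  have "harm (M + m) - (harm (M - m) :: real) = (\<Sum>k=1..2*m. 1 / (real (M - m) + real k))"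
    using sum_inverse_shift[of "M - m" "2 * m"] assms by (simp add: add.commute)
  also have "\<dots> \<le> (\<Sum>k=1..2*m. 1 / (real M - real m + 1))"
    using assms by (intro sum_mono divide_left_mono) (auto simp: of_nat_diff)
  finally show "harm (M + m) - (harm (M - m) :: real) \<le> 2 * real m / (real M - real m + 1)" by simp
qed

text \<open>A quantitative form of \<open>\<zeta>(2)\<^sup>2 = 5/2 \<zeta>(4)\<close>, following G. T. Williams: write
  \<open>1/(m\<^sup>2k\<^sup>2)\<close> as \<open>(1/m\<^sup>2 - 1/k\<^sup>2)/(k\<^sup>2 - m\<^sup>2)\<close> and sum over \<open>k \<noteq> m\<close> first.\<close>

lemma zsum_2_square:
  shows "\<bar>(zsum 2 M)\<^sup>2 - 5/2 * zsum 4 M\<bar> \<le> 6 / (real M + 1)"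
proof -
  define f :: "nat \<Rightarrow> nat \<Rightarrow> real" where "f m k = (if k = m then 0 else 1 / (real m ^ 2 * (real k ^ 2 - real m ^ 2)))" for m k
  define \<epsilon> where "\<epsilon> m = (harm (M + m) - harm (M - m)) / (2 * real m ^ 3)" for m
  have sq: "real k ^ 2 - real m ^ 2 \<noteq> 0" if "k \<noteq> m" for k m :: nat
    using that by simp
  have split: "1 / real m ^ 2 * (1 / real k ^ 2) = (if k = m then 1 / real m ^ 4 else 0) + (f m k + f k m)"
    if "m \<in> {1..M}" "k \<in> {1..M}" for m k
  proof (cases "k = m")
    case False
    have "real m ^ 2 \<noteq> 0" "real k ^ 2 \<noteq> 0" using that by auto
    moreover have "1 / (x * (y - x)) + 1 / (y * (x - y)) = 1 / x * (1 / y)"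
      if "x \<noteq> 0" "y \<noteq> 0" "y - x \<noteq> 0" for x y :: real
    proof -
      have "x - y = - (y - x)" by simp
      then show ?thesis using that by (simp add: divide_simps) (simp add: algebra_simps)
    qed
    ultimately show ?thesis using False sq[OF False] by (simp add: f_def)
  qed (simp add: f_def)
  have "(zsum 2 M)\<^sup>2 = (\<Sum>m=1..M. \<Sum>k=1..M. 1 / real m ^ 2 * (1 / real k ^ 2))"
    by (simp add: zsum_def power2_eq_square[of "sum _ _"] sum_product)
  also have "\<dots> = (\<Sum>m=1..M. \<Sum>k=1..M. (if k = m then 1 / real m ^ 4 else 0) + (f m k + f k m))"
    using split by (intro sum.cong refl) auto
  also have "\<dots> = zsum 4 M + ((\<Sum>m=1..M. \<Sum>k=1..M. f m k) + (\<Sum>m=1..M. \<Sum>k=1..M. f k m))"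
    by (simp add: sum.distrib zsum_def)
  also have "(\<Sum>m=1..M. \<Sum>k=1..M. f k m) = (\<Sum>m=1..M. \<Sum>k=1..M. f m k)"
    by (rule sum.swap)
  also have "(\<Sum>m=1..M. \<Sum>k=1..M. f m k) = (\<Sum>m=1..M. 3 / (4 * real m ^ 4) - \<epsilon> m)"
  proof (intro sum.cong refl)
    fix m assume m: "m \<in> {1..M}"
    have "(\<Sum>k=1..M. f m k) = (\<Sum>k\<in>{1..M} - {m}. 1 / real m ^ 2 * (1 / (real k ^ 2 - real m ^ 2)))"
      by (rule sum.mono_neutral_cong_right) (auto simp: f_def)
    also have "\<dots> = 1 / real m ^ 2 * (\<Sum>k\<in>{1..M} - {m}. 1 / (real k ^ 2 - real m ^ 2))"
      by (simp add: sum_distrib_left)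
    also have "\<dots> = 1 / real m ^ 2 * (3 / (4 * real m ^ 2) - (harm (M + m) - harm (M - m)) / (2 * real m))"
      using m by (subst sum_inverse_square_diff) auto
    also have "\<dots> = 3 / (4 * real m ^ 4) - \<epsilon> m"
      using m by (simp add: \<epsilon>_def field_simps eval_nat_numeral)
    finally show "(\<Sum>k=1..M. f m k) = 3 / (4 * real m ^ 4) - \<epsilon> m" .
  qed
  also have "\<dots> = 3/4 * zsum 4 M - (\<Sum>m=1..M. \<epsilon> m)"
    by (simp add: sum_subtractf zsum_def sum_distrib_left)
  \<comment> \<open>The diagonal contributes \<open>zsum 4 M\<close> once and each of the two equal
    off-diagonal sums contributes 3/4 of it: 1 + 3/4 + 3/4 = 5/2.\<close>
  finally have eq: "(zsum 2 M)\<^sup>2 - 5/2 * zsum 4 M = - 2 * (\<Sum>m=1..M. \<epsilon> m)" by simp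
  have lo: "\<epsilon> m \<ge> 0" if "m \<in> {1..M}" for m
    using harm_diff_bounds(1)[of m M] that by (simp add: \<epsilon>_def)
  have up: "\<epsilon> m \<le> (1 / real m ^ 2 + 1 / real M) / (real M + 1)" if m: "m \<in> {1..M}" for m
  proof -
    have pos: "real m \<ge> 1" "real M - real m \<ge> 0" using m by auto
    have "\<epsilon> m \<le> 2 * real m / (real M - real m + 1) / (2 * real m ^ 3)"
      unfolding \<epsilon>_def using harm_diff_bounds(2)[of m M] m by (intro divide_right_mono) auto
    also have "\<dots> = 1 / (real m ^ 2 * (real M - real m + 1))"
      using pos by (simp add: power3_eq_cube power2_eq_square)
    also have "\<dots> = (1 / real m ^ 2 + 1 / (real m * (real M - real m + 1))) / (real M + 1)"
    proof -
      define x where "x = real m"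
      define y where "y = real M - real m + 1"
      have xy: "x > 0" "y > 0" using pos by (auto simp: x_def y_def)
      \<comment> \<open>Here x + y = M + 1, so this partial fraction extracts the decay 1/(M +
        1).\<close>
      have "1 / (x ^ 2 * y) = (1 / x ^ 2 + 1 / (x * y)) / (x + y)"
        using xy by (simp add: divide_simps power2_eq_square)
      then show ?thesis by (simp add: x_def y_def)
    qed
    also have "\<dots> \<le> (1 / real m ^ 2 + 1 / real M) / (real M + 1)"
    proof -
      \<comment> \<open>The product m (M - m + 1) is concave in m, so its minimum on 1..M is the
        value M taken at both ends.\<close>
      have "(real m - 1) * (real M - real m) \<ge> 0" using pos by simp
      then have "real M \<le> real m * (real M - real m + 1)" by (simp add: algebra_simps)
      then have "1 / (real m * (real M - real m + 1)) \<le> 1 / real M"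
        using pos by (intro divide_left_mono mult_pos_pos) auto
      then show ?thesis by (intro divide_right_mono add_left_mono) auto
    qed
    finally show ?thesis .
  qed
  have "(\<Sum>m=1..M. \<epsilon> m) \<le> (\<Sum>m=1..M. (1 / real m ^ 2 + 1 / real M) / (real M + 1))"
    using up by (intro sum_mono)
  also have "\<dots> = (zsum 2 M + (\<Sum>m=1..M. 1 / real M)) / (real M + 1)"
    by (simp add: sum_divide_distrib[symmetric] sum.distrib zsum_def)
  also have "\<dots> \<le> (2 + 1) / (real M + 1)"
    using zsum_2_le_2 by (intro divide_right_mono add_mono) auto
  finally have "(\<Sum>m=1..M. \<epsilon> m) \<le> 3 / (real M + 1)" by simp
  moreover have "(\<Sum>m=1..M. \<epsilon> m) \<ge> 0" using lo by (intro sum_nonneg) auto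
  ultimately show ?thesis unfolding eq by (simp add: abs_le_iff)
qed

text \<open>Each pair is uniquely g (r, s) with r, s coprime, and the box condition becomes g \<le>
  P div max r s.\<close>

lemma sum_pairs_by_gcd:
  fixes F :: "nat \<Rightarrow> nat \<Rightarrow> 'a :: comm_monoid_add"
  shows "(\<Sum>a=1..P. \<Sum>b=1..P. F a b) =
    (\<Sum>(r, s)\<in>{(r, s). r \<in> {1..P} \<and> s \<in> {1..P} \<and> coprime r s}. \<Sum>g=1..P div max r s. F (g * r) (g * s))"
proof -
  let ?C = "{(r, s). r \<in> {1..P} \<and> s \<in> {1..P} \<and> coprime r s}"
  have "finite ({1..P} \<times> {1..P})" by simp
  then have fin: "finite ?C" by (rule finite_subset[rotated]) auto
  have bound: "g * x \<le> P" if "g \<le> P div max r s" "x \<le> max r s" for g x r s :: nat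
  proof -
    have "g * x \<le> (P div max r s) * max r s" using that by (rule mult_le_mono)
    also have "\<dots> \<le> P" by simp
    finally show ?thesis .
  qed
  have "(\<Sum>a=1..P. \<Sum>b=1..P. F a b) = (\<Sum>(a, b)\<in>{1..P} \<times> {1..P}. F a b)"
    by (simp add: sum.cartesian_product)
  also have "\<dots> = (\<Sum>(x, g)\<in>Sigma ?C (\<lambda>(r, s). {1..P div max r s}). F (g * fst x) (g * snd x))"
  proof (rule sum.reindex_bij_witness[of _ "\<lambda>(x, g). (g * fst x, g * snd x)"
        "\<lambda>(a, b). ((a div gcd a b, b div gcd a b), gcd a b)"], goal_cases)
    case (2 ab)
    then obtain a b where ab: "ab = (a, b)" "a \<in> {1..P}" "b \<in> {1..P}" by auto
    have g: "gcd a b > 0" using ab by simp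
    have "a div gcd a b > 0" "b div gcd a b > 0"
      using ab by (auto simp: div_greater_zero_iff intro: gcd_le1_nat gcd_le2_nat)
    moreover have "a div gcd a b \<le> P" "b div gcd a b \<le> P"
      using ab by (auto intro: order_trans[OF div_le_dividend])
    moreover have "coprime (a div gcd a b) (b div gcd a b)"
      using ab by (intro div_gcd_coprime) auto
    moreover have "gcd a b \<le> P div max (a div gcd a b) (b div gcd a b)"
    proof -
      have "gcd a b * max (a div gcd a b) (b div gcd a b) = max a b"
        by (simp add: nat_mult_max_right)
      also have "\<dots> \<le> P" using ab by simp
      finally show ?thesis
        using \<open>a div gcd a b > 0\<close> by (subst less_eq_div_iff_mult_less_eq) auto
    qed
    ultimately show ?case using ab g by (auto simp: Suc_le_eq)
  next
    case (4 xg)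
    then obtain r s g where x: "xg = ((r, s), g)" "r \<in> {1..P}" "s \<in> {1..P}" "coprime r s" "g \<in> {1..P div max r s}"
      by (cases xg) auto
    then show ?case using bound[of g r s r] bound[of g r s s] by auto
  next
    case (3 xg)
    then obtain r s g where x: "xg = ((r, s), g)" "r \<in> {1..P}" "s \<in> {1..P}" "coprime r s" "g \<in> {1..P div max r s}"
      by (cases xg) auto
    then show ?case by (simp add: gcd_mult_distrib_nat[symmetric])
  qed auto
  also have "\<dots> = (\<Sum>x\<in>?C. \<Sum>g\<in>(case x of (r, s) \<Rightarrow> {1..P div max r s}). F (g * fst x) (g * snd x))"
    using fin by (subst sum.Sigma) auto
  also have "\<dots> = (\<Sum>(r, s)\<in>?C. \<Sum>g=1..P div max r s. F (g * r) (g * s))"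
    by (intro sum.cong) auto
  finally show ?thesis .
qed


section \<open>The truncated diagonal sum and its limit 5 pi^4 / 72\<close>

definition ratio_sum :: "nat \<Rightarrow> real" where
  "ratio_sum P = (\<Sum>k=1..P. \<Sum>k'=1..P. \<Sum>l=1..P. \<Sum>l'=1..P.
     if k * l' = l * k' then 1 / (real k * real l * real k' * real l') else 0)"

text \<open>The condition k l' = l k' says that k/k' and l/l' have the same reduced form r/s. The
  two multipliers then run independently over the same range, which produces the square.\<close>

lemma ratio_sum_by_gcd:
  "ratio_sum P = (\<Sum>(r, s)\<in>{(r, s). r \<in> {1..P} \<and> s \<in> {1..P} \<and> coprime r s}.
     (zsum 2 (P div max r s))\<^sup>2 / (real r ^ 2 * real s ^ 2))"
proof -
  let ?C = "{(r, s). r \<in> {1..P} \<and> s \<in> {1..P} \<and> coprime r s}"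
  have "finite ({1..P} \<times> {1..P})" by simp
  then have fin: "finite ?C" by (rule finite_subset[rotated]) auto
  have inner: "(\<Sum>l=1..P. \<Sum>l'=1..P. if (g * r) * l' = l * (g * s)
        then 1 / (real (g * r) * real l * real (g * s) * real l') else 0)
      = (\<Sum>g'=1..P div max r s. 1 / real g ^ 2 * (1 / real g' ^ 2) / (real r ^ 2 * real s ^ 2))"
    if rs: "(r, s) \<in> ?C" and g: "g > 0" for r s g
  proof -
    have "(\<Sum>l=1..P. \<Sum>l'=1..P. if (g * r) * l' = l * (g * s)
        then 1 / (real (g * r) * real l * real (g * s) * real l') else 0)
      = (\<Sum>(r', s')\<in>?C. \<Sum>g'=1..P div max r' s'. if (g * r) * (g' * s') = (g' * r') * (g * s)
        then 1 / (real (g * r) * real (g' * r') * real (g * s) * real (g' * s')) else 0)"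
      by (rule sum_pairs_by_gcd)
    also have "\<dots> = (\<Sum>x\<in>?C. if x = (r, s) then
        (\<Sum>g'=1..P div max r s. 1 / real g ^ 2 * (1 / real g' ^ 2) / (real r ^ 2 * real s ^ 2)) else 0)"
    proof (intro sum.cong refl)
      fix x assume "x \<in> ?C"
      then obtain r' s' where x: "x = (r', s')" "coprime r' s'" by auto
      have eq_iff: "(g * r) * (g' * s') = (g' * r') * (g * s) \<longleftrightarrow> (r', s') = (r, s)" if "g' > 0" for g'
      proof -
        have "(g * r) * (g' * s') = (g' * r') * (g * s) \<longleftrightarrow> (g * g') * (r * s') = (g * g') * (r' * s)"
          by (simp add: mult_ac)
        also have "\<dots> \<longleftrightarrow> r * s' = r' * s" using g that by simp
        also have "\<dots> \<longleftrightarrow> r = r' \<and> s' = s"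
          using rs x by (intro coprime_crossproduct_nat) auto
        finally show ?thesis by auto
      qed
      show "(case x of (r', s') \<Rightarrow> \<Sum>g'=1..P div max r' s'. if (g * r) * (g' * s') = (g' * r') * (g * s)
        then 1 / (real (g * r) * real (g' * r') * real (g * s) * real (g' * s')) else 0)
        = (if x = (r, s) then
        (\<Sum>g'=1..P div max r s. 1 / real g ^ 2 * (1 / real g' ^ 2) / (real r ^ 2 * real s ^ 2)) else 0)"
      proof (cases "(r', s') = (r, s)")
        case True
        then show ?thesis unfolding x(1)
          by (simp, intro sum.cong refl) (simp add: power2_eq_square mult_ac)
      next
        case False
        then show ?thesis unfolding x(1) prod.case
          by (simp only: if_False, intro sum.neutral ballI) (subst eq_iff, auto)
      qed
    qed
    also have "\<dots> = (\<Sum>g'=1..P div max r s. 1 / real g ^ 2 * (1 / real g' ^ 2) / (real r ^ 2 * real s ^ 2))"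
      using fin rs by simp
    finally show ?thesis .
  qed
  have "ratio_sum P = (\<Sum>(r, s)\<in>?C. \<Sum>g=1..P div max r s. \<Sum>l=1..P. \<Sum>l'=1..P. if (g * r) * l' = l * (g * s)
        then 1 / (real (g * r) * real l * real (g * s) * real l') else 0)"
    unfolding ratio_sum_def by (rule sum_pairs_by_gcd)
  also have "\<dots> = (\<Sum>(r, s)\<in>?C. \<Sum>g=1..P div max r s. \<Sum>g'=1..P div max r s.
      1 / real g ^ 2 * (1 / real g' ^ 2) / (real r ^ 2 * real s ^ 2))"
  proof (rule sum.cong[OF refl])
    fix x assume x: "x \<in> ?C"
    obtain r s where rs: "x = (r, s)" by (cases x)
    show "(case x of (r, s) \<Rightarrow> \<Sum>g=1..P div max r s. \<Sum>l=1..P. \<Sum>l'=1..P. if (g * r) * l' = l * (g * s)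
        then 1 / (real (g * r) * real l * real (g * s) * real l') else 0)
      = (case x of (r, s) \<Rightarrow> \<Sum>g=1..P div max r s. \<Sum>g'=1..P div max r s.
      1 / real g ^ 2 * (1 / real g' ^ 2) / (real r ^ 2 * real s ^ 2))"
      unfolding rs prod.case
      by (rule sum.cong[OF refl], rule inner) (use x rs in auto)
  qed
  also have "\<dots> = (\<Sum>(r, s)\<in>?C. (zsum 2 (P div max r s))\<^sup>2 / (real r ^ 2 * real s ^ 2))"
    by (simp add: zsum_def power2_eq_square[of "sum _ _"] sum_product sum_divide_distrib)
  finally show ?thesis .
qed

text \<open>This has the same coprime pairs and the same weights as \<open>ratio_sum_by_gcd\<close>,
  so the two expressions can be compared pair by pair.\<close>

lemma zsum_2_square_by_gcd:
  "(zsum 2 P)\<^sup>2 = (\<Sum>(r, s)\<in>{(r, s). r \<in> {1..P} \<and> s \<in> {1..P} \<and> coprime r s}.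
     zsum 4 (P div max r s) / (real r ^ 2 * real s ^ 2))"
proof -
  have "(zsum 2 P)\<^sup>2 = (\<Sum>a=1..P. \<Sum>b=1..P. 1 / (real a ^ 2 * real b ^ 2))"
    by (simp add: zsum_def power2_eq_square[of "sum _ _"] sum_product)
  also have "\<dots> = (\<Sum>(r, s)\<in>{(r, s). r \<in> {1..P} \<and> s \<in> {1..P} \<and> coprime r s}.
     \<Sum>g=1..P div max r s. 1 / (real (g * r) ^ 2 * real (g * s) ^ 2))"
    by (rule sum_pairs_by_gcd)
  also have "\<dots> = (\<Sum>(r, s)\<in>{(r, s). r \<in> {1..P} \<and> s \<in> {1..P} \<and> coprime r s}.
     zsum 4 (P div max r s) / (real r ^ 2 * real s ^ 2))"
    by (simp add: zsum_def sum_divide_distrib power_mult_distrib mult_ac flip: power_add)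
  finally show ?thesis .
qed

text \<open>For every coprime pair, \<open>zsum_2_square\<close> replaces the square of
  \<open>zsum 2\<close> by 5/2 \<open>zsum 4\<close>; reassembling gives 5/2 times the square of
  \<open>zsum 2 P\<close>, with limit 5/2 (pi^2/6)^2. The constant 34 is 24 for this comparison plus
  10 for truncating zeta(2).\<close>

lemma ratio_sum_asymp:
  assumes P: "P > 0"
  shows "\<bar>ratio_sum P - 5 * pi ^ 4 / 72\<bar> \<le> 34 * (1 + harm P) / real P"
proof -
  let ?C = "{(r, s). r \<in> {1..P} \<and> s \<in> {1..P} \<and> coprime r s}"
  have sub: "?C \<subseteq> {1..P} \<times> {1..P}" by auto
  have "ratio_sum P - 5/2 * (zsum 2 P)\<^sup>2
     = (\<Sum>(r, s)\<in>?C. ((zsum 2 (P div max r s))\<^sup>2 - 5/2 * zsum 4 (P div max r s)) / (real r ^ 2 * real s ^ 2))"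
    unfolding ratio_sum_by_gcd zsum_2_square_by_gcd
    by (simp add: sum_distrib_left case_prod_unfold diff_divide_distrib sum_subtractf)
  then have "\<bar>ratio_sum P - 5/2 * (zsum 2 P)\<^sup>2\<bar>
     \<le> (\<Sum>(r, s)\<in>?C. \<bar>((zsum 2 (P div max r s))\<^sup>2 - 5/2 * zsum 4 (P div max r s)) / (real r ^ 2 * real s ^ 2)\<bar>)"
    by (simp only: case_prod_unfold sum_abs)
  also have "\<dots> \<le> (\<Sum>(r, s)\<in>?C. 6 / real P * (1 / real r * (1 / real s ^ 2) + 1 / real r ^ 2 * (1 / real s)))"
  proof (intro sum_mono, clarify)
    fix r s assume rs: "r \<in> {1..P}" "s \<in> {1..P}"
    define M where "M = P div max r s"
    have "0 < max r s" using rs by auto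
    \<comment> \<open>This converts the error 6/(M + 1) into 6 (r + s)/P. The weight 1/(r^2 s^2)
      then weakens to 1/(r s^2) + 1/(r^2 s), at the cost of a single harmonic number.\<close>
    then have "P < (M + 1) * max r s"
      unfolding M_def using dividend_less_div_times[of "max r s" P] by simp
    then have "real P \<le> (real M + 1) * real (max r s)"
      by (metis less_imp_le of_nat_1 of_nat_add of_nat_le_iff of_nat_mult)
    then have "6 / (real M + 1) \<le> 6 / real P * real (max r s)"
      using P by (simp add: field_simps)
    also have "\<dots> \<le> 6 / real P * (real r + real s)"
      by (intro mult_left_mono) auto
    finally have "\<bar>(zsum 2 M)\<^sup>2 - 5/2 * zsum 4 M\<bar> \<le> 6 / real P * (real r + real s)"
      using zsum_2_square[of M] by linarith
    then have "\<bar>((zsum 2 M)\<^sup>2 - 5/2 * zsum 4 M) / (real r ^ 2 * real s ^ 2)\<bar>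
       \<le> 6 / real P * (real r + real s) / (real r ^ 2 * real s ^ 2)"
      by (simp only: abs_divide abs_mult abs_power2) (intro divide_right_mono, auto)
    also have "\<dots> = 6 / real P * (1 / real r * (1 / real s ^ 2) + 1 / real r ^ 2 * (1 / real s))"
      using rs P by (simp add: field_simps power2_eq_square)
    finally show "\<bar>((zsum 2 (P div max r s))\<^sup>2 - 5/2 * zsum 4 (P div max r s)) / (real r ^ 2 * real s ^ 2)\<bar>
      \<le> 6 / real P * (1 / real r * (1 / real s ^ 2) + 1 / real r ^ 2 * (1 / real s))"
      unfolding M_def .
  qed
  also have "\<dots> \<le> (\<Sum>(r, s)\<in>{1..P} \<times> {1..P}. 6 / real P * (1 / real r * (1 / real s ^ 2) + 1 / real r ^ 2 * (1 / real s)))"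
    using sub by (intro sum_mono2) auto
  also have "\<dots> = 6 / real P * (harm P * zsum 2 P + zsum 2 P * harm P)"
    by (simp only: sum.cartesian_product[symmetric] sum_distrib_left[symmetric] sum.distrib sum_distrib_right[symmetric]
        harm_def zsum_def inverse_eq_divide)
  also have "\<dots> \<le> 6 / real P * (harm P * 2 + 2 * harm P)"
    using zsum_2_le_2 harm_nonneg by (intro mult_left_mono add_mono mult_right_mono) auto
  finally have 1: "\<bar>ratio_sum P - 5/2 * (zsum 2 P)\<^sup>2\<bar> \<le> 24 * harm P / real P" by simp
  define z where "z = pi\<^sup>2 / 6"
  have z: "zsum 2 P \<le> z" "z \<le> zsum 2 P + 1 / real P" "z \<le> 2"
    using zsum_2_bounds[OF P] zsum_2_bounds(2)[of 1] by (simp_all add: z_def zsum_def)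
  have "z\<^sup>2 - (zsum 2 P)\<^sup>2 = (z - zsum 2 P) * (z + zsum 2 P)"
    by (simp add: power2_eq_square algebra_simps)
  also have "\<dots> \<le> 1 / real P * 4"
    using z zsum_2_le_2[of P] zsum_nonneg[of 2 P] by (intro mult_mono) auto
  finally have "z\<^sup>2 - (zsum 2 P)\<^sup>2 \<le> 4 / real P" by simp
  moreover have "(zsum 2 P)\<^sup>2 \<le> z\<^sup>2" using z zsum_nonneg by (intro power_mono) auto
  moreover have "5 * pi ^ 4 / 72 = 5/2 * z\<^sup>2"
    by (simp add: z_def power_divide flip: power_mult)
  ultimately have "\<bar>5/2 * (zsum 2 P)\<^sup>2 - 5 * pi ^ 4 / 72\<bar> \<le> 10 / real P" by (simp add: abs_le_iff)
  with 1 have "\<bar>ratio_sum P - 5 * pi ^ 4 / 72\<bar> \<le> 24 * harm P / real P + 10 / real P" by linarith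
  also have "\<dots> \<le> 34 * (1 + harm P) / real P"
    using P harm_nonneg[of P, where ?'a = real] by (simp add: field_simps)
  finally show ?thesis .
qed

section \<open>The divisor function\<close>

lemma card_divisors_mult_le:
  fixes m n :: nat
  assumes "m > 0" "n > 0"
  shows "card {d. d dvd m * n} \<le> card {d. d dvd m} * card {d. d dvd n}"
proof -
  have fin: "finite {d. d dvd m}" "finite {d. d dvd n}" using assms by auto
  have "{d. d dvd m * n} \<subseteq> (\<lambda>(a, b). a * b) ` ({d. d dvd m} \<times> {d. d dvd n})"
  proof
    fix d assume "d \<in> {d. d dvd m * n}"
    then obtain b c where "d = b * c" "b dvd m" "c dvd n"
      using division_decomp[of d m n] by auto
    then show "d \<in> (\<lambda>(a, b). a * b) ` ({d. d dvd m} \<times> {d. d dvd n})"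
      by (intro image_eqI[of _ _ "(b, c)"]) auto
  qed
  then have "card {d. d dvd m * n} \<le> card ({d. d dvd m} \<times> {d. d dvd n})"
    using fin by (intro surj_card_le) auto
  then show ?thesis by (simp add: card_cartesian_product)
qed

lemma card_divisors_prod_le:
  fixes f :: "'a \<Rightarrow> nat"
  assumes "finite A" "\<And>x. x \<in> A \<Longrightarrow> f x > 0"
  shows "card {d. d dvd (\<Prod>x\<in>A. f x)} \<le> (\<Prod>x\<in>A. card {d. d dvd f x})"
  using assms
proof (induction A rule: finite_induct)
  case (insert x A)
  have "card {d. d dvd (\<Prod>x\<in>insert x A. f x)} \<le> card {d. d dvd f x} * card {d. d dvd (\<Prod>x\<in>A. f x)}"
    using insert card_divisors_mult_le[of "f x" "\<Prod>x\<in>A. f x"] by simp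
  also have "\<dots> \<le> card {d. d dvd f x} * (\<Prod>x\<in>A. card {d. d dvd f x})"
    using insert by (intro mult_left_mono) auto
  finally show ?case using insert by simp
qed simp

lemma card_divisors_prime_power_le:
  fixes q :: nat
  assumes "prime q"
  shows "card {d. d dvd q ^ a} \<le> a + 1"
proof -
  have "{d. d dvd q ^ a} \<subseteq> (\<lambda>i. q ^ i) ` {..a}"
    using divides_primepow_nat[OF assms] by auto
  then have "card {d. d dvd q ^ a} \<le> card {..a}" by (intro surj_card_le) auto
  then show ?thesis by simp
qed

text \<open>Primes up to \<open>T\<close> contribute at most \<open>1 + log 2 n\<close> each; for larger primes \<open>q\<close> use
  \<open>a + 1 \<le> 2 ^ a \<le> (q ^ a) powr (ln 2 / ln T)\<close>.\<close>

lemma card_divisors_le: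
  fixes n :: nat and x T :: real
  assumes n: "n > 0" "real n \<le> x" and T: "T \<ge> 2"
  shows "real (card {d. d dvd n}) \<le> (1 + log 2 x) powr T * 2 powr (ln x / ln T)"
proof -
  define A where "A = prime_factors n"
  define a where "a q = multiplicity q n" for q
  define S where "S = {q \<in> A. real q \<le> T}"
  define L where "L = {q \<in> A. \<not> real q \<le> T}"
  have fin: "finite A" "finite S" "finite L" by (simp_all add: A_def S_def L_def)
  have AU: "A = S \<union> L" "S \<inter> L = {}" by (auto simp: S_def L_def)
  have x: "x \<ge> 1" using n by linarith
  have prime: "prime q" if "q \<in> A" for q using that by (auto simp: A_def in_prime_factors_iff)
  have fact: "n = (\<Prod>q\<in>A. q ^ a q)"
    unfolding A_def a_def by (rule prime_factorization_nat[OF n(1)])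
  have lnT: "ln T > 0" using T by simp
  have "card {d. d dvd n} \<le> (\<Prod>q\<in>A. card {d. d dvd q ^ a q})"
    by (subst fact) (rule card_divisors_prod_le, use fin prime prime_gt_0_nat in auto)
  also have "\<dots> \<le> (\<Prod>q\<in>A. a q + 1)"
    using prime by (intro prod_mono conjI card_divisors_prime_power_le) auto
  finally have "real (card {d. d dvd n}) \<le> (\<Prod>q\<in>A. real (a q) + 1)"
    by (subst (asm) of_nat_le_iff[symmetric, where ?'a = real]) (simp add: add.commute)
  also have "\<dots> = (\<Prod>q\<in>S. real (a q) + 1) * (\<Prod>q\<in>L. real (a q) + 1)"
    using AU fin by (simp add: prod.union_disjoint)
  also have "\<dots> \<le> (1 + log 2 x) powr T * 2 powr (ln x / ln T)"
  proof (intro mult_mono prod_nonneg)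
    have le: "real (a q) + 1 \<le> 1 + log 2 x" if "q \<in> A" for q
    proof -
      have "q ^ a q dvd n" unfolding a_def by (rule multiplicity_dvd)
      then have "q ^ a q \<le> n" using n by (intro dvd_imp_le)
      moreover have "2 ^ a q \<le> q ^ a q" using prime_ge_2_nat[OF prime[OF that]] by (rule power_mono) simp
      ultimately have "(2 :: nat) ^ a q \<le> n" by linarith
      then have "2 ^ a q \<le> real n" by (metis of_nat_le_iff of_nat_numeral of_nat_power)
      then have "2 ^ a q \<le> x" using n by linarith
      then have "2 powr real (a q) \<le> x" by (simp add: powr_realpow)
      then have "real (a q) \<le> log 2 x" using x by (subst le_log_iff) auto
      then show ?thesis by simp
    qed
    have log0: "log 2 x \<ge> 0" using x by simp
    have "(\<Prod>q\<in>S. real (a q) + 1) \<le> (\<Prod>q\<in>S. 1 + log 2 x)"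
      using le by (intro prod_mono) (auto simp: S_def)
    also have "\<dots> = (1 + log 2 x) powr real (card S)"
      using log0 by (simp add: powr_realpow)
    also have "\<dots> \<le> (1 + log 2 x) powr T"
    proof (intro powr_mono)
      have "S \<subseteq> {1..nat \<lfloor>T\<rfloor>}"
        using prime prime_gt_0_nat by (auto simp: S_def le_nat_floor Suc_le_eq)
      then have "card S \<le> nat \<lfloor>T\<rfloor>" using card_mono[of "{1..nat \<lfloor>T\<rfloor>}" S] by simp
      then show "real (card S) \<le> T" using T by linarith
    qed (use log0 in auto)
    finally show "(\<Prod>q\<in>S. real (a q) + 1) \<le> (1 + log 2 x) powr T" .
    have "(\<Prod>q\<in>L. real (a q) + 1) \<le> (\<Prod>q\<in>L. real (q ^ a q) powr (ln 2 / ln T))"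
    proof (intro prod_mono conjI)
      fix q assume q: "q \<in> L"
      then have qT: "real q > T" by (auto simp: L_def)
      have "real (a q) + 1 \<le> 2 ^ a q"
        using Bernoulli_inequality[of 1 "a q"] by (simp add: add.commute)
      also have "\<dots> = (2 :: real) powr real (a q)" by (simp add: powr_realpow)
      \<comment> \<open>The exponent is chosen so that \<open>T powr (ln 2 / ln T)\<close> is 2; the
        cutoff q > T then allows q in place of T.\<close>
      also have "\<dots> = T powr (real (a q) * (ln 2 / ln T))"
        using lnT T by (simp add: powr_def)
      also have "\<dots> = (T ^ a q) powr (ln 2 / ln T)"
        using T by (simp only: powr_powr[symmetric]) (simp add: powr_realpow)
      also have "\<dots> \<le> real (q ^ a q) powr (ln 2 / ln T)"
        using T qT lnT by (intro powr_mono2) (auto intro!: power_mono)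
      finally show "real (a q) + 1 \<le> real (q ^ a q) powr (ln 2 / ln T)" .
    qed auto
    also have "\<dots> = real (\<Prod>q\<in>L. q ^ a q) powr (ln 2 / ln T)"
      by (simp add: prod_powr_distrib)
    also have "\<dots> \<le> x powr (ln 2 / ln T)"
    proof (intro powr_mono2)
      have "(\<Prod>q\<in>L. q ^ a q) dvd (\<Prod>q\<in>A. q ^ a q)"
        using fin AU by (intro prod_dvd_prod_subset) auto
      then have "(\<Prod>q\<in>L. q ^ a q) \<le> n" using fact n by (metis dvd_imp_le)
      then show "real (\<Prod>q\<in>L. q ^ a q) \<le> x" using n by linarith
    qed (use lnT in \<open>auto intro: prod_nonneg\<close>)
    also have "\<dots> = 2 powr (ln x / ln T)"
      using x by (simp add: powr_def)
    finally show "(\<Prod>q\<in>L. real (a q) + 1) \<le> 2 powr (ln x / ln T)" .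
  qed auto
  finally show ?thesis .
qed

text \<open>The bound of \<open>card_divisors_le\<close> at x^2 with cutoff T = sqrt (ln x). Since
  ln T is half of ln (ln x), the large primes give exp (4 ln 2 * ln x / ln (ln x)); the small primes
  give an exponent of lower order. The factor \<open>(1 + ln x) ^ 3\<close> reserves room for three
  harmonic sums.\<close>

lemma eventually_divisor_bound:
  "eventually (\<lambda>x::real. (1 + log 2 (x\<^sup>2)) powr sqrt (ln x) * 2 powr (ln (x\<^sup>2) / ln (sqrt (ln x))) * (1 + ln x) ^ 3
     \<le> exp (3 * ln x / ln (ln x))) at_top"
proof -
  have "eventually (\<lambda>L::real. sqrt L * ln (1 + 2 * L / ln 2) + 3 * ln (1 + L) \<le> 1/5 * L / ln L) at_top"
    by real_asymp
  then have "eventually (\<lambda>x::real. sqrt (ln x) * ln (1 + 2 * ln x / ln 2) + 3 * ln (1 + ln x) \<le> 1/5 * ln x / ln (ln x)) at_top"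
    by (rule eventually_compose_filterlim) (rule ln_at_top)
  moreover have "eventually (\<lambda>x::real. ln (ln x) > 0 \<and> ln x > 1 \<and> x > 1) at_top"
    by (intro eventually_conj) real_asymp+
  ultimately show ?thesis
  proof eventually_elim
    case (elim x)
    define L where "L = ln x"
    have L: "L > 1" "ln L > 0" "x > 1" using elim by (auto simp: L_def)
    have lg: "log 2 (x\<^sup>2) = 2 * L / ln 2" using L by (simp add: log_def L_def ln_realpow)
    have pos: "1 + 2 * L / ln 2 > 0" using L by (simp add: add_pos_nonneg)
    have "(1 + log 2 (x\<^sup>2)) powr sqrt (ln x) = exp (sqrt L * ln (1 + 2 * L / ln 2))"
      using pos by (simp add: lg L_def[symmetric] powr_def)
    moreover have "2 powr (ln (x\<^sup>2) / ln (sqrt (ln x))) = exp (4 * ln 2 * L / ln L)"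
      using L by (simp add: powr_def ln_realpow L_def[symmetric] ln_sqrt)
    moreover have "(1 + ln x) ^ 3 = exp (3 * ln (1 + L))"
    proof -
      have "exp (3 * ln (1 + L)) = exp (ln (1 + L)) ^ 3"
        using exp_of_nat_mult[of 3 "ln (1 + L)"] by simp
      then show ?thesis using L by (simp add: L_def)
    qed
    ultimately have "(1 + log 2 (x\<^sup>2)) powr sqrt (ln x) * 2 powr (ln (x\<^sup>2) / ln (sqrt (ln x))) * (1 + ln x) ^ 3
      = exp (sqrt L * ln (1 + 2 * L / ln 2) + 4 * ln 2 * L / ln L + 3 * ln (1 + L))"
      by (simp only: exp_add)
    also have "\<dots> \<le> exp (3 * L / ln L)"
    proof -
      \<comment> \<open>4 * 25/36 is below 14/5, and the remaining 1/5 of the exponent covers all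
        lower-order terms.\<close>
      have "4 * ln 2 \<le> (14/5 :: real)" using ln2_le_25_over_36 by simp
      then have "4 * ln 2 * L / ln L \<le> 14/5 * L / ln L"
        using L by (intro divide_right_mono mult_right_mono) auto
      moreover have "14/5 * L / ln L + 1/5 * L / ln L = 3 * L / ln L" by (simp add: field_simps)
      moreover have "sqrt L * ln (1 + 2 * L / ln 2) + 3 * ln (1 + L) \<le> 1/5 * L / ln L"
        using elim by (simp add: L_def)
      ultimately show ?thesis by simp
    qed
    finally show ?case by (simp add: L_def)
  qed
qed

lemma ln_ln_pos: "p \<ge> 7 \<Longrightarrow> ln (ln (real p)) > 0"
proof -
  assume "p \<ge> 7"
  then have "exp 1 < real p" using exp_le by linarith
  then have "1 < ln (real p)" by (metis exp_less_cancel_iff exp_ln exp_gt_zero order_less_trans)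
  then show ?thesis by simp
qed

text \<open>The range n \<le> p^2 contains the products of residues that are factored in
  \<open>sum_off_diagonal_half\<close>. For p \<ge> 7 the exponential is at least 1, so the primes
  below the asymptotic threshold can be absorbed into the constant.\<close>

lemma divisor_bound:
  "\<exists>K. \<forall>p n :: nat. p \<ge> 7 \<and> 0 < n \<and> n \<le> p\<^sup>2 \<longrightarrow>
     real (card {d. d dvd n}) * (1 + ln (real p)) ^ 3 \<le> K * exp (3 * ln (real p) / ln (ln (real p)))"
proof -
  have "eventually (\<lambda>x::real. sqrt (ln x) \<ge> 2 \<and> x \<ge> 7) at_top"
    by (intro eventually_conj) real_asymp+
  with eventually_divisor_bound
  have "eventually (\<lambda>x::real. (1 + log 2 (x\<^sup>2)) powr sqrt (ln x) * 2 powr (ln (x\<^sup>2) / ln (sqrt (ln x))) * (1 + ln x) ^ 3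
     \<le> exp (3 * ln x / ln (ln x)) \<and> sqrt (ln x) \<ge> 2 \<and> x \<ge> 7) at_top"
    by (rule eventually_conj)
  then obtain x0 where x0: "\<And>x::real. x \<ge> x0 \<Longrightarrow>
     (1 + log 2 (x\<^sup>2)) powr sqrt (ln x) * 2 powr (ln (x\<^sup>2) / ln (sqrt (ln x))) * (1 + ln x) ^ 3
     \<le> exp (3 * ln x / ln (ln x)) \<and> sqrt (ln x) \<ge> 2 \<and> x \<ge> 7"
    by (auto simp: eventually_at_top_linorder)
  define y where "y = max x0 7"
  \<comment> \<open>The entry 1 serves above the threshold; below it, d(n) \<le> n \<le> y^2 gives
    the other entry.\<close>
  define K where "K = max 1 (y\<^sup>2 * (1 + ln y) ^ 3)"
  show ?thesis
  proof (intro exI[of _ K] allI impI, elim conjE)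
    fix p n :: nat assume p: "p \<ge> 7" and n: "0 < n" "n \<le> p\<^sup>2"
    have np: "real n \<le> (real p)\<^sup>2" using n by (metis of_nat_le_iff of_nat_power)
    have lnp: "ln (real p) \<ge> 0" using p by simp
    have e: "exp (3 * ln (real p) / ln (ln (real p))) \<ge> 1"
      using ln_ln_pos[OF p] lnp by simp
    show "real (card {d. d dvd n}) * (1 + ln (real p)) ^ 3 \<le> K * exp (3 * ln (real p) / ln (ln (real p)))"
    proof (cases "real p \<ge> x0")
      case True
      have "real (card {d. d dvd n}) * (1 + ln (real p)) ^ 3
        \<le> ((1 + log 2 ((real p)\<^sup>2)) powr sqrt (ln (real p)) * 2 powr (ln ((real p)\<^sup>2) / ln (sqrt (ln (real p))))) * (1 + ln (real p)) ^ 3"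
        using x0[OF True] n np lnp by (intro mult_right_mono card_divisors_le) auto
      also have "\<dots> \<le> 1 * exp (3 * ln (real p) / ln (ln (real p)))" using x0[OF True] by simp
      also have "\<dots> \<le> K * exp (3 * ln (real p) / ln (ln (real p)))"
        by (intro mult_right_mono) (auto simp: K_def)
      finally show ?thesis .
    next
      case False
      then have py: "real p \<le> y" by (simp add: y_def)
      have "{d. d dvd n} \<subseteq> {1..n}" using n by (auto simp: Suc_le_eq dvd_imp_le intro: Nat.gr0I)
      then have "card {d. d dvd n} \<le> n" using card_mono[of "{1..n}"] by simp
      then have "real (card {d. d dvd n}) \<le> (real p)\<^sup>2" using np by linarith
      also have "\<dots> \<le> y\<^sup>2" using py by (intro power_mono) auto
      finally have "real (card {d. d dvd n}) * (1 + ln (real p)) ^ 3 \<le> y\<^sup>2 * (1 + ln y) ^ 3"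
        using py p lnp by (intro mult_mono power_mono) auto
      also have "\<dots> \<le> K" by (simp add: K_def)
      also have "\<dots> \<le> K * exp (3 * ln (real p) / ln (ln (real p)))"
        using mult_left_mono[OF e, of K] by (simp add: K_def)
      finally show ?thesis .
    qed
  qed
qed

section \<open>Additive characters\<close>

definition add_char :: "nat \<Rightarrow> int \<Rightarrow> complex" where
  "add_char p k = e_fun (real_of_int k / real p)"

lemma add_char_eq_cis: "add_char p k = cis (2 * pi * real_of_int k / real p)"
  by (simp add: add_char_def e_fun_def cis_conv_exp mult_ac)

lemma add_char_0 [simp]: "add_char p 0 = 1"
  by (simp add: add_char_eq_cis)

lemma add_char_add: "add_char p (j + k) = add_char p j * add_char p k"
  by (simp add: add_char_eq_cis cis_mult add_divide_distrib ring_distribs)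

lemma add_char_minus: "add_char p (- k) = cnj (add_char p k)"
  by (simp add: add_char_eq_cis cis_cnj)

lemma add_char_diff: "add_char p (j - k) = add_char p j * cnj (add_char p k)"
  using add_char_add[of p j "-k"] by (simp add: add_char_minus)

lemma norm_add_char [simp]: "cmod (add_char p k) = 1"
  by (simp add: add_char_eq_cis)

lemma add_char_mult_nat: "add_char p (int n * k) = add_char p k ^ n"
  by (simp add: add_char_eq_cis Complex.DeMoivre mult_ac)

lemma add_char_eq_1_iff:
  assumes "p > 0"
  shows "add_char p k = 1 \<longleftrightarrow> int p dvd k"
proof
  assume "add_char p k = 1"
  then have "cos (2 * pi * real_of_int k / real p) = 1"
    by (metis Re_complex_of_real cis.sel(1) add_char_eq_cis of_real_1)
  then obtain n :: int where "2 * pi * real_of_int k / real p = n * 2 * pi"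
    by (auto simp: cos_one_2pi_int)
  then have "real_of_int k = real_of_int (n * int p)"
    using assms by (simp add: field_simps)
  then have "k = n * int p"
    by linarith
  then show "int p dvd k" by simp
next
  assume "int p dvd k"
  then obtain n where n: "k = int p * n" by blast
  have "2 * pi * real_of_int k / real p = 2 * pi * real_of_int n"
    using assms n by simp
  then show "add_char p k = 1"
    unfolding add_char_eq_cis by (metis Ints_of_int cis_multiple_2pi)
qed

lemma add_char_cong:
  assumes "[j = k] (mod int p)" "p > 0"
  shows "add_char p j = add_char p k"
proof -
  have "add_char p (j - k) = 1"
    using assms by (simp add: add_char_eq_1_iff cong_iff_dvd_diff)
  then show ?thesis
    using add_char_add[of p "j - k" k] by simp
qed

lemma sum_int_eq_sum_nat: "(\<Sum>a\<in>{0..<int p}. f a) = (\<Sum>a<p. f (int a))"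
  by (rule sum.reindex_bij_witness[of _ int nat]) auto

lemma sum_add_char_mult:
  assumes "p > 0"
  shows "(\<Sum>a\<in>{0..<int p}. add_char p (a * k)) = (if int p dvd k then of_nat p else 0)"
proof (cases "int p dvd k")
  case True
  then have "add_char p (a * k) = 1" for a
    using assms by (simp add: add_char_eq_1_iff)
  with True show ?thesis by simp
next
  case False
  then have "add_char p k \<noteq> 1" using assms by (simp add: add_char_eq_1_iff)
  then have "(\<Sum>a<p. add_char p k ^ a) = (add_char p k ^ p - 1) / (add_char p k - 1)"
    by (rule geometric_sum)
  also have "add_char p k ^ p = 1"
    using add_char_mult_nat[of p p k] add_char_eq_1_iff[OF assms, of "int p * k"] by simp
  finally show ?thesis
    using False by (simp add: sum_int_eq_sum_nat add_char_mult_nat)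
qed

text \<open>Functions on Z/p are modelled by functions on the integers that are constant on classes,
  so a sum can pass from one system of representatives to another.\<close>

definition residue_periodic :: "nat \<Rightarrow> (int \<Rightarrow> 'a) \<Rightarrow> bool" where
  "residue_periodic p f \<longleftrightarrow> (\<forall>x y. [x = y] (mod int p) \<longrightarrow> f x = f y)"

lemma residue_periodicI [intro?]:
  "(\<And>x y. [x = y] (mod int p) \<Longrightarrow> f x = f y) \<Longrightarrow> residue_periodic p f"
  by (simp add: residue_periodic_def)

lemma residue_periodicD: "residue_periodic p f \<Longrightarrow> [x = y] (mod int p) \<Longrightarrow> f x = f y"
  by (simp add: residue_periodic_def)

lemma sum_residues_affine:
  fixes f :: "int \<Rightarrow> 'a :: comm_monoid_add"
  assumes f: "residue_periodic p f" and p: "p > 0" and t: "coprime t (int p)"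
  shows "(\<Sum>x\<in>{0..<int p}. f (t * x + c)) = (\<Sum>x\<in>{0..<int p}. f x)"
proof -
  obtain t' where t': "[t * t' = 1] (mod int p)"
    using cong_solve_coprime_int[OF t] by auto
  have t'': "[t' * t = 1] (mod int p)" using t' by (simp add: mult.commute)
  show ?thesis
  proof (rule sum.reindex_bij_witness
      [of _ "\<lambda>y. (t' * (y - c)) mod int p" "\<lambda>x. (t * x + c) mod int p"])
    fix x assume x: "x \<in> {0..<int p}"
    have "[t' * ((t * x + c) mod int p - c) = t' * (t * x + c - c)] (mod int p)"
      by (intro cong_mult cong_diff) auto
    also have "t' * (t * x + c - c) = (t' * t) * x" by simp
    also have "[(t' * t) * x = 1 * x] (mod int p)" by (intro cong_mult t'') auto
    finally show "(t' * ((t * x + c) mod int p - c)) mod int p = x"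
      using x by (simp add: cong_def)
    show "f ((t * x + c) mod int p) = f (t * x + c)"
      by (rule residue_periodicD[OF f]) auto
  next
    fix y assume y: "y \<in> {0..<int p}"
    have "[t * ((t' * (y - c)) mod int p) + c = t * (t' * (y - c)) + c] (mod int p)"
      by (intro cong_add cong_mult) auto
    also have "t * (t' * (y - c)) + c = (t * t') * (y - c) + c" by simp
    also have "[(t * t') * (y - c) + c = 1 * (y - c) + c] (mod int p)"
      by (intro cong_mult cong_add t') auto
    finally show "(t * ((t' * (y - c)) mod int p) + c) mod int p = y"
      using y by (simp add: cong_def)
  qed (use p in auto)
qed

lemma sum_residues_split0:
  fixes f :: "int \<Rightarrow> 'a :: comm_monoid_add"
  assumes "p > 0"
  shows "(\<Sum>x\<in>{0..<int p}. f x) = f 0 + (\<Sum>x\<in>{1..<int p}. f x)"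
proof -
  have "{0..<int p} = insert 0 {1..<int p}" using assms by auto
  then show ?thesis by simp
qed

lemma sum_nonzero_residues_mult:
  fixes f :: "int \<Rightarrow> 'a :: ab_group_add"
  assumes f: "residue_periodic p f" and p: "p > 0" and t: "coprime t (int p)"
  shows "(\<Sum>x\<in>{1..<int p}. f (t * x)) = (\<Sum>x\<in>{1..<int p}. f x)"
  using sum_residues_affine[OF assms, of 0]
  by (simp add: sum_residues_split0[OF p])

text \<open>Expanding the squared modulus and summing over m and n detects both congruences by
  orthogonality. The index set is left general: pairs of residues give the fourth moment, single
  residues with G = 0 the second moment of fifth-power sums.\<close>

lemma sum_norm_sq_add_char:
  fixes F G :: "'a \<Rightarrow> int"
  assumes p: "p > 0" and X: "finite X"
  shows "(\<Sum>m\<in>{0..<int p}. \<Sum>n\<in>{0..<int p}. (cmod (\<Sum>x\<in>X. add_char p (m * F x + n * G x)))\<^sup>2)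
    = real p ^ 2 * real (card {(x, y). x \<in> X \<and> y \<in> X \<and> [F x = F y] (mod int p) \<and> [G x = G y] (mod int p)})"
    (is "?L = _ * real (card ?S)")
proof -
  let ?R = "{0..<int p}"
  have "complex_of_real ?L = (\<Sum>m\<in>?R. \<Sum>n\<in>?R. \<Sum>x\<in>X. \<Sum>y\<in>X.
      add_char p (m * (F x - F y)) * add_char p (n * (G x - G y)))"
  proof (simp only: of_real_sum, intro sum.cong refl)
    fix m n
    have "complex_of_real ((cmod (\<Sum>x\<in>X. add_char p (m * F x + n * G x)))\<^sup>2)
       = (\<Sum>x\<in>X. add_char p (m * F x + n * G x)) * cnj (\<Sum>x\<in>X. add_char p (m * F x + n * G x))"
      by (rule complex_norm_square)
    also have "\<dots> = (\<Sum>x\<in>X. \<Sum>y\<in>X. add_char p (m * F x + n * G x) * cnj (add_char p (m * F y + n * G y)))"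
      by (simp add: sum_product)
    also have "\<dots> = (\<Sum>x\<in>X. \<Sum>y\<in>X. add_char p (m * (F x - F y)) * add_char p (n * (G x - G y)))"
      by (simp only: add_char_diff[symmetric] add_char_add[symmetric]) (simp add: algebra_simps)
    finally show "complex_of_real ((cmod (\<Sum>x\<in>X. add_char p (m * F x + n * G x)))\<^sup>2) = \<dots>" .
  qed
  also have "\<dots> = (\<Sum>m\<in>?R. \<Sum>x\<in>X. \<Sum>n\<in>?R. \<Sum>y\<in>X.
      add_char p (m * (F x - F y)) * add_char p (n * (G x - G y)))"
    by (rule sum.cong[OF refl], rule sum.swap)
  also have "\<dots> = (\<Sum>x\<in>X. \<Sum>m\<in>?R. \<Sum>n\<in>?R. \<Sum>y\<in>X.
      add_char p (m * (F x - F y)) * add_char p (n * (G x - G y)))"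
    by (rule sum.swap)
  also have "\<dots> = (\<Sum>x\<in>X. \<Sum>m\<in>?R. \<Sum>y\<in>X. \<Sum>n\<in>?R.
      add_char p (m * (F x - F y)) * add_char p (n * (G x - G y)))"
    by (rule sum.cong[OF refl], rule sum.cong[OF refl], rule sum.swap)
  also have "\<dots> = (\<Sum>x\<in>X. \<Sum>y\<in>X. \<Sum>m\<in>?R. \<Sum>n\<in>?R.
      add_char p (m * (F x - F y)) * add_char p (n * (G x - G y)))"
    by (rule sum.cong[OF refl], rule sum.swap)
  also have "\<dots> = (\<Sum>x\<in>X. \<Sum>y\<in>X. if [F x = F y] (mod int p) \<and> [G x = G y] (mod int p)
      then of_nat p ^ 2 else 0)"
    by (intro sum.cong refl)
      (simp add: sum_product[symmetric] sum_add_char_mult[OF p] cong_iff_dvd_diff power2_eq_square)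
  also have "\<dots> = (\<Sum>(x, y)\<in>X \<times> X. if [F x = F y] (mod int p) \<and> [G x = G y] (mod int p)
      then of_nat p ^ 2 else 0)"
    by (simp add: sum.cartesian_product)
  also have "\<dots> = (\<Sum>z\<in>?S. of_nat p ^ 2)"
    using X by (intro sum.mono_neutral_cong_right) (auto split: if_splits)
  also have "\<dots> = complex_of_real (real p ^ 2 * real (card ?S))"
    by simp
  finally show ?thesis
    using of_real_eq_iff by blast
qed

section \<open>Invariance under fourth powers\<close>

locale prime_3_mod_4 =
  fixes p :: nat
  assumes prime_p: "prime p" and p_mod_4: "p mod 4 = 3" and p_gt_3: "p > 3"
begin

abbreviation R0 :: "int set" where "R0 \<equiv> {0..<int p}"
abbreviation R1 :: "int set" where "R1 \<equiv> {1..<int p}"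

lemma p_pos: "p > 0" using p_gt_3 by simp

lemma p_ge_7: "p \<ge> 7"
proof -
  have "p \<noteq> 4" "p \<noteq> 5" "p \<noteq> 6" using p_mod_4 by auto
  then show ?thesis using p_gt_3 by linarith
qed

lemma prime_int_p: "prime (int p)" using prime_p by simp

lemma coprime_iff: "coprime x (int p) \<longleftrightarrow> \<not> int p dvd x"
  by (metis coprime_commute coprime_absorb_left not_prime_unit prime_imp_coprime prime_int_p)

lemma not_dvd_R1: "x \<in> R1 \<Longrightarrow> \<not> int p dvd x"
  using zdvd_not_zless by auto

lemma coprime_R1: "x \<in> R1 \<Longrightarrow> coprime x (int p)"
  using not_dvd_R1 coprime_iff by blast

lemma not_dvd_small: "0 < k \<Longrightarrow> k < int p \<Longrightarrow> \<not> int p dvd k"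
  using zdvd_not_zless by auto

lemma dvd_mult_iff: "int p dvd a * b \<longleftrightarrow> int p dvd a \<or> int p dvd b"
  using prime_int_p by (rule prime_dvd_mult_iff)

lemma dvd_power_iff: "n > 0 \<Longrightarrow> int p dvd a ^ n \<longleftrightarrow> int p dvd a"
  using prime_int_p by (rule prime_dvd_power_iff)

lemma fermat_int:
  assumes "\<not> int p dvd u"
  shows "[u ^ (p - 1) = 1] (mod int p)"
proof -
  define a where "a = nat (u mod int p)"
  have a: "int a = u mod int p" using p_pos by (simp add: a_def)
  have "\<not> p dvd a"
    using assms a by (metis dvd_mod_iff dvd_refl int_dvd_int_iff)
  then have "[a ^ (p - 1) = 1] (mod p)"
    using fermat_theorem[OF prime_p] by simp
  then have "[int a ^ (p - 1) = 1] (mod int p)"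
    by (metis cong_int_iff of_nat_1 of_nat_power)
  moreover have "[u ^ (p - 1) = int a ^ (p - 1)] (mod int p)"
    by (intro cong_pow) (simp add: a cong_def)
  ultimately show ?thesis using cong_trans by blast
qed

lemma half_power_cases:
  assumes "\<not> int p dvd u"
  shows "[u ^ ((p - 1) div 2) = 1] (mod int p) \<or> [u ^ ((p - 1) div 2) = -1] (mod int p)"
proof -
  let ?v = "u ^ ((p - 1) div 2)"
  have "even (p - 1)" using p_mod_4 by presburger
  then have "u ^ (p - 1) = ?v\<^sup>2"
    by (simp add: power_mult[symmetric])
  then have "int p dvd ?v\<^sup>2 - 1"
    using fermat_int[OF assms] by (simp add: cong_iff_dvd_diff)
  also have "?v\<^sup>2 - 1 = (?v - 1) * (?v + 1)"
    by (simp add: power2_eq_square algebra_simps)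
  finally show ?thesis
    by (auto simp: dvd_mult_iff cong_iff_dvd_diff)
qed

text \<open>With p = 4q + 3 the half exponent (p - 1)/2 is 2q + 1, and (2q + 2)^2 = (2q + 1)(2q + 3)
  + 1. Hence t = u^((q+1)^2) satisfies t^4 = (u^((p-1)/2))^(2q+3) * u, where the first factor is 1
  or -1.\<close>

lemma eq_pm_fourth_power:
  assumes "\<not> int p dvd u"
  obtains t where "\<not> int p dvd t" "[u = t ^ 4] (mod int p) \<or> [- u = t ^ 4] (mod int p)"
proof -
  define q where "q = p div 4"
  have q: "p = 4 * q + 3" using p_mod_4 unfolding q_def by presburger
  define t where "t = u ^ ((q + 1)\<^sup>2)"
  have half: "(p - 1) div 2 = 2 * q + 1" using q by simp
  have "t ^ 4 = u ^ (4 * (q + 1)\<^sup>2)"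
    by (simp add: t_def power_mult[symmetric] mult.commute)
  also have "4 * (q + 1)\<^sup>2 = (2 * q + 1) * (2 * q + 3) + 1"
    by (simp add: power2_eq_square algebra_simps)
  also have "u ^ \<dots> = (u ^ (2 * q + 1)) ^ (2 * q + 3) * u"
    by (simp only: power_add power_mult power_one_right)
  finally have t4: "t ^ 4 = (u ^ (2 * q + 1)) ^ (2 * q + 3) * u" .
  have "\<not> int p dvd t"
    using assms unfolding t_def by (subst dvd_power_iff) auto
  moreover from half_power_cases[OF assms, unfolded half]
  have "[u = t ^ 4] (mod int p) \<or> [- u = t ^ 4] (mod int p)"
  proof
    assume "[u ^ (2 * q + 1) = 1] (mod int p)"
    then have "[t ^ 4 = 1 ^ (2 * q + 3) * u] (mod int p)"
      unfolding t4 by (intro cong_mult cong_pow) auto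
    then show ?thesis by (auto simp: cong_sym_eq)
  next
    assume "[u ^ (2 * q + 1) = -1] (mod int p)"
    then have "[t ^ 4 = (-1) ^ (2 * q + 3) * u] (mod int p)"
      unfolding t4 by (intro cong_mult cong_pow) auto
    moreover have "(-1 :: int) ^ (2 * q + 3) = -1" by simp
    ultimately show ?thesis by (auto simp: cong_sym_eq)
  qed
  ultimately show thesis by (rule that)
qed

text \<open>-1 is a nonresidue: raising x^2 = -y^2 to the odd power (p - 1)/2 and applying Fermat
  would give 1 = -1.\<close>

lemma dvd_sum_squares:
  assumes "int p dvd x\<^sup>2 + y\<^sup>2"
  shows "int p dvd x \<and> int p dvd y"
proof -
  define e where "e = (p - 1) div 2"
  have e: "2 * e = p - 1" "odd e" using p_mod_4 unfolding e_def by presburger+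
  have "int p dvd y" if "int p dvd x"
  proof -
    have "int p dvd x\<^sup>2" using that by (simp add: dvd_power_iff)
    with assms have "int p dvd y\<^sup>2" by (simp add: dvd_add_right_iff)
    then show ?thesis by (simp add: dvd_power_iff)
  qed
  moreover have "int p dvd x"
  proof (rule ccontr)
    assume x: "\<not> int p dvd x"
    have y: "\<not> int p dvd y"
    proof
      assume "int p dvd y"
      then have "int p dvd y\<^sup>2" by (simp add: dvd_power_iff)
      with assms have "int p dvd x\<^sup>2" by (simp add: dvd_add_left_iff)
      with x show False by (simp add: dvd_power_iff)
    qed
    have "[x\<^sup>2 = - (y\<^sup>2)] (mod int p)"
      using assms by (simp add: cong_iff_dvd_diff)
    then have "[(x\<^sup>2) ^ e = (- (y\<^sup>2)) ^ e] (mod int p)" by (rule cong_pow)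
    then have "[x ^ (p - 1) = - (y ^ (p - 1))] (mod int p)"
      using e by (simp add: power_mult[symmetric] power_minus_odd)
    moreover have "[- (y ^ (p - 1)) = - 1] (mod int p)"
      using fermat_int[OF y] by (simp add: cong_minus_minus_iff)
    ultimately have "[1 = -1] (mod int p)"
      using fermat_int[OF x] by (meson cong_sym cong_trans)
    then have "int p dvd 2" by (simp add: cong_iff_dvd_diff)
    then show False using not_dvd_small[of 2] p_gt_3 by simp
  qed
  ultimately show ?thesis by simp
qed

lemma sum_R1_minus:
  fixes f :: "int \<Rightarrow> 'a :: ab_group_add"
  assumes "residue_periodic p f"
  shows "(\<Sum>x\<in>R1. f (- x)) = (\<Sum>x\<in>R1. f x)"
  using sum_nonzero_residues_mult[OF assms p_pos, of "-1"] by simp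

text \<open>One of u, -u is a fourth power and the other the negative of one, so f u and f (-u) are
  f 1 and f (-1) in some order. The value type is general because both the real weights and the
  complex Gauss sums are of this kind.\<close>

lemma fourth_power_invariant:
  fixes f :: "int \<Rightarrow> 'a :: ab_group_add"
  assumes f: "residue_periodic p f"
    and inv: "\<And>u t. \<not> int p dvd t \<Longrightarrow> f (t ^ 4 * u) = f u"
    and u: "\<not> int p dvd u"
  shows "f u + f (- u) = f 1 + f (- 1)"
proof -
  have f_pm: "f v = f 1 \<and> f (- v) = f (- 1)" if "\<not> int p dvd t" "[v = t ^ 4] (mod int p)" for v t
  proof -
    have "f v = f (t ^ 4 * 1)"
      by (rule residue_periodicD[OF f]) (use that in simp)
    moreover have "f (- v) = f (t ^ 4 * (- 1))"
      by (rule residue_periodicD[OF f]) (use that in \<open>simp add: cong_minus_minus_iff\<close>)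
    ultimately show ?thesis using inv[OF that(1), of 1] inv[OF that(1), of "-1"] by simp
  qed
  obtain t where "\<not> int p dvd t" "[u = t ^ 4] (mod int p) \<or> [- u = t ^ 4] (mod int p)"
    using eq_pm_fourth_power[OF u] by blast
  then show ?thesis using f_pm[of t u] f_pm[of t "- u"] by auto
qed

lemma nat_p_minus_1 [simp]: "nat (int p - 1) = p - 1" by simp

text \<open>Every class modulo \<open>p\<close> is a fourth power up to sign, so a function invariant under fourth
  powers is uncorrelated with every even function.\<close>

lemma fourth_power_decorrelation:
  fixes f g :: "int \<Rightarrow> real"
  assumes f: "residue_periodic p f" and g: "residue_periodic p g"
    and inv: "\<And>u t. \<not> int p dvd t \<Longrightarrow> f (t ^ 4 * u) = f u"
    and even: "\<And>u. g (- u) = g u"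
  shows "real (p - 1) * (\<Sum>u\<in>R1. f u * g u) = (\<Sum>u\<in>R1. f u) * (\<Sum>u\<in>R1. g u)"
proof -
  define c where "c = f 1 + f (- 1)"
  have const: "f u + f (- u) = c" if "u \<in> R1" for u
    unfolding c_def using not_dvd_R1[OF that] inv by (intro fourth_power_invariant[OF f])
  \<comment> \<open>Averaging over u and -u replaces f by the constant c / 2 against any even h. The
    choices h = 1 and h = g share this c, and eliminating it gives the product formula.\<close>
  have key: "2 * (\<Sum>u\<in>R1. f u * h u) = c * (\<Sum>u\<in>R1. h u)"
    if h: "residue_periodic p h" and even: "\<And>u. h (- u) = h u" for h :: "int \<Rightarrow> real"
  proof -
    have "residue_periodic p (\<lambda>u. f u * h u)"
      using f h by (auto simp: residue_periodic_def)
    then have "(\<Sum>u\<in>R1. f (- u) * h (- u)) = (\<Sum>u\<in>R1. f u * h u)"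
      by (rule sum_R1_minus)
    then have "2 * (\<Sum>u\<in>R1. f u * h u) = (\<Sum>u\<in>R1. f u * h u) + (\<Sum>u\<in>R1. f (- u) * h u)"
      by (simp add: even)
    also have "\<dots> = (\<Sum>u\<in>R1. (f u + f (- u)) * h u)"
      by (simp add: sum.distrib ring_distribs)
    also have "\<dots> = (\<Sum>u\<in>R1. c * h u)"
      by (intro sum.cong refl) (simp add: const)
    finally show ?thesis by (simp add: sum_distrib_left)
  qed
  have "2 * (\<Sum>u\<in>R1. f u) = c * real (p - 1)"
    using key[of "\<lambda>_. 1"] by (simp add: residue_periodic_def)
  moreover have "2 * (\<Sum>u\<in>R1. f u * g u) = c * (\<Sum>u\<in>R1. g u)"
    using key[OF g even] .
  ultimately have "2 * (real (p - 1) * (\<Sum>u\<in>R1. f u * g u)) = 2 * ((\<Sum>u\<in>R1. f u) * (\<Sum>u\<in>R1. g u))"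
    by (metis mult.assoc mult.left_commute)
  then show ?thesis by simp
qed

section \<open>The weight |C(m, n, 5, 1; p)|^4 and its scaling symmetry\<close>

definition W :: "int \<Rightarrow> int \<Rightarrow> real" where
  "W m n = cmod (\<Sum>a\<in>R0. add_char p (m * a ^ 5 + n * a)) ^ 4"

lemma W_eq: "W m n = cmod (two_term_sum m n 5 1 p) ^ 4"
  by (simp add: W_def two_term_sum_def add_char_def sum_int_eq_sum_nat)

lemma W_cong:
  assumes "[m = m'] (mod int p)" "[n = n'] (mod int p)"
  shows "W m n = W m' n'"
proof -
  have "(\<Sum>a\<in>R0. add_char p (m * a ^ 5 + n * a)) = (\<Sum>a\<in>R0. add_char p (m' * a ^ 5 + n' * a))"
    by (intro sum.cong refl add_char_cong p_pos cong_add cong_mult assms) auto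
  then show ?thesis by (simp add: W_def)
qed

lemma periodic_add_char_poly5: "residue_periodic p (\<lambda>a. add_char p (m * a ^ 5 + n * a))"
  by (rule residue_periodicI, intro add_char_cong p_pos cong_add cong_mult cong_pow) auto

lemma W_scale:
  assumes "\<not> int p dvd t"
  shows "W (t ^ 5 * m) (t * n) = W m n"
proof -
  have "(\<Sum>a\<in>R0. add_char p (m * (t * a + 0) ^ 5 + n * (t * a + 0))) = (\<Sum>a\<in>R0. add_char p (m * a ^ 5 + n * a))"
    by (rule sum_residues_affine[OF periodic_add_char_poly5 p_pos]) (use assms in \<open>simp add: coprime_iff\<close>)
  then show ?thesis by (simp add: W_def power_mult_distrib mult_ac)
qed

lemma W_decorrelation:
  fixes g :: "int \<Rightarrow> real"
  assumes g: "residue_periodic p g" and even: "\<And>u. g (- u) = g u"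
  shows "real (p - 1) * (\<Sum>m\<in>R1. \<Sum>n\<in>R1. W m n * g (m * modular_inverse (int p) n))
    = (\<Sum>m\<in>R1. \<Sum>n\<in>R1. W m n) * (\<Sum>u\<in>R1. g u)"
proof -
  define f where "f u = (\<Sum>n\<in>R1. W (n * u) n)" for u
  \<comment> \<open>Stated for general h because it is applied twice: to g, and to the constant 1
    for the total mass.\<close>
  have by_ratio: "(\<Sum>m\<in>R1. \<Sum>n\<in>R1. W m n * h (m * modular_inverse (int p) n)) = (\<Sum>u\<in>R1. f u * h u)"
    if h: "residue_periodic p h" for h :: "int \<Rightarrow> real"
  proof -
    have "(\<Sum>m\<in>R1. \<Sum>n\<in>R1. W m n * h (m * modular_inverse (int p) n))
        = (\<Sum>n\<in>R1. \<Sum>m\<in>R1. W m n * h (m * modular_inverse (int p) n))"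
      by (rule sum.swap)
    also have "\<dots> = (\<Sum>n\<in>R1. \<Sum>u\<in>R1. W (n * u) n * h u)"
    proof (rule sum.cong[OF refl])
      fix n assume n: "n \<in> R1"
      have "residue_periodic p (\<lambda>m. W m n * h (m * modular_inverse (int p) n))"
      proof
        fix x y assume "[x = y] (mod int p)"
        then show "W x n * h (x * modular_inverse (int p) n) = W y n * h (y * modular_inverse (int p) n)"
          using W_cong[of x y n n] residue_periodicD[OF h, of "x * modular_inverse (int p) n" "y * modular_inverse (int p) n"]
          by (simp add: cong_scalar_right)
      qed
      from sum_nonzero_residues_mult[OF this p_pos coprime_R1[OF n]]
      have "(\<Sum>m\<in>R1. W m n * h (m * modular_inverse (int p) n))
         = (\<Sum>u\<in>R1. W (n * u) n * h (n * u * modular_inverse (int p) n))" by simp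
      also have "\<dots> = (\<Sum>u\<in>R1. W (n * u) n * h u)"
      proof (rule sum.cong[OF refl])
        fix u
        have "[u * (n * modular_inverse (int p) n) = u * 1] (mod int p)"
          by (intro cong_mult cong_modular_inverse1 coprime_R1 n) auto
        then have "[n * u * modular_inverse (int p) n = u] (mod int p)"
          by (simp add: mult_ac)
        then show "W (n * u) n * h (n * u * modular_inverse (int p) n) = W (n * u) n * h u"
          using residue_periodicD[OF h] by metis
      qed
      finally show "(\<Sum>m\<in>R1. W m n * h (m * modular_inverse (int p) n)) = (\<Sum>u\<in>R1. W (n * u) n * h u)" .
    qed
    also have "\<dots> = (\<Sum>u\<in>R1. \<Sum>n\<in>R1. W (n * u) n * h u)"
      by (rule sum.swap)
    finally show ?thesis by (simp add: f_def sum_distrib_right)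
  qed
  have f: "residue_periodic p f"
    unfolding f_def by (rule residue_periodicI, intro sum.cong W_cong cong_mult) auto
  have inv: "f (t ^ 4 * u) = f u" if t: "\<not> int p dvd t" for t u
  proof -
    have "residue_periodic p (\<lambda>n. W (n * (t ^ 4 * u)) n)"
      by (rule residue_periodicI, intro W_cong cong_mult) auto
    from sum_nonzero_residues_mult[OF this p_pos, of t]
    have "f (t ^ 4 * u) = (\<Sum>n\<in>R1. W (t * n * (t ^ 4 * u)) (t * n))"
      using t by (simp add: f_def coprime_iff)
    \<comment> \<open>Replacing n by t n supplies the fifth factor t in the first argument, which is
      exactly what \<open>W_scale\<close> absorbs; this is why fourth powers occur.\<close>
    also have "\<dots> = (\<Sum>n\<in>R1. W (t ^ 5 * (n * u)) (t * n))"
      by (simp add: eval_nat_numeral mult_ac)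
    also have "\<dots> = f u" by (simp add: W_scale[OF t] f_def)
    finally show ?thesis .
  qed
  have "(\<Sum>m\<in>R1. \<Sum>n\<in>R1. W m n) = (\<Sum>u\<in>R1. f u)"
    using by_ratio[of "\<lambda>_. 1"] by (simp add: residue_periodic_def)
  then show ?thesis
    using fourth_power_decorrelation[OF f g inv even] by (simp add: by_ratio[OF g])
qed

section \<open>Quadratic Gauss sums and the points of the cone\<close>

definition gsum :: "int \<Rightarrow> complex" where
  "gsum t = (\<Sum>x\<in>R0. add_char p (t * x\<^sup>2))"

lemma periodic_add_char_square: "residue_periodic p (\<lambda>x. add_char p (t * x\<^sup>2))"
  by (rule residue_periodicI, intro add_char_cong p_pos cong_mult cong_pow) auto

lemma gsum_periodic: "residue_periodic p gsum"
  unfolding gsum_def by (rule residue_periodicI, intro sum.cong add_char_cong p_pos cong_mult) auto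

lemma gsum_affine:
  assumes "coprime s (int p)"
  shows "(\<Sum>x\<in>R0. add_char p (t * (s * x + c)\<^sup>2)) = gsum t"
  unfolding gsum_def using sum_residues_affine[OF periodic_add_char_square p_pos assms] .

lemma gsum_0 [simp]: "gsum 0 = of_nat p" by (simp add: gsum_def)

text \<open>\<open>gsum\<close> is invariant under fourth powers, so
  \<open>gsum t + gsum (- t)\<close> is a constant on nonzero classes. Summed over all t,
  \<open>gsum\<close> equals p, because only x = 0 contributes; \<open>gsum 0\<close> already
  accounts for this, so the constant vanishes.\<close>

lemma gsum_minus:
  assumes "\<not> int p dvd t"
  shows "gsum (- t) = - gsum t"
proof -
  have inv: "gsum (t ^ 4 * u) = gsum u" if t: "\<not> int p dvd t" for t u
  proof -
    have "\<not> int p dvd t\<^sup>2" using t by (simp add: dvd_power_iff)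
    then have "gsum u = (\<Sum>x\<in>R0. add_char p (u * (t\<^sup>2 * x + 0)\<^sup>2))"
      by (intro gsum_affine[symmetric]) (simp add: coprime_iff)
    then show ?thesis by (simp add: gsum_def power_mult_distrib mult_ac flip: power_mult)
  qed
  have const: "gsum u + gsum (- u) = gsum 1 + gsum (- 1)" if "\<not> int p dvd u" for u
    using inv that by (intro fourth_power_invariant[OF gsum_periodic])
  have "(\<Sum>t\<in>R0. gsum t) = (\<Sum>x\<in>R0. \<Sum>t\<in>R0. add_char p (t * x\<^sup>2))"
    unfolding gsum_def by (rule sum.swap)
  also have "\<dots> = (\<Sum>x\<in>R0. if x = 0 then of_nat p else 0)"
    using not_dvd_R1 by (intro sum.cong refl) (auto simp: sum_add_char_mult[OF p_pos] dvd_power_iff zdvd_not_zless)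
  also have "\<dots> = of_nat p" using p_pos by simp
  finally have s0: "(\<Sum>t\<in>R1. gsum t) = 0"
    by (simp add: sum_residues_split0[OF p_pos])
  have "0 = (\<Sum>t\<in>R1. gsum t) + (\<Sum>t\<in>R1. gsum (- t))"
    using sum_R1_minus[OF gsum_periodic] s0 by simp
  also have "\<dots> = (\<Sum>t\<in>R1. gsum 1 + gsum (- 1))"
    unfolding sum.distrib[symmetric] by (intro sum.cong refl const not_dvd_R1)
  finally have "gsum 1 + gsum (- 1) = 0"
    using p_gt_3 by (auto simp: of_nat_diff)
  with const[OF assms] show ?thesis
    by (simp add: eq_neg_iff_add_eq_0 add.commute)
qed

text \<open>The quadratic factor left from a^5 + b^5 - c^5 - d^5 with d = a + b - c, after removing
  (a + b), (c - a), (c - b) and the constant -5; see \<open>fifth_power_identity\<close>.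
  Multiplication by 4 lets the square be completed over the integers.\<close>

definition Q :: "int \<Rightarrow> int \<Rightarrow> int \<Rightarrow> int" where
  "Q a b c = a\<^sup>2 + a * b + b\<^sup>2 - c * (a + b) + c\<^sup>2"

lemma four_Q: "4 * Q a b c = (2 * c + - (a + b))\<^sup>2 + 2 * (a + b)\<^sup>2 + (a - b)\<^sup>2"
  by (simp add: Q_def power2_eq_square algebra_simps)

lemma coprime_2: "coprime 2 (int p)"
  using not_dvd_small[of 2] p_gt_3 by (simp add: coprime_iff)

text \<open>The variable c occurs in one square only, so its sum is \<open>gsum t\<close>. Shifting
  a by b turns a - b and a + b into a and a + 2b, and summing over b first separates the other two
  squares.\<close>

lemma sum_add_char_Q: "(\<Sum>a\<in>R0. \<Sum>b\<in>R0. \<Sum>c\<in>R0. add_char p (t * (4 * Q a b c))) = gsum t ^ 2 * gsum (2 * t)"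
proof -
  have "(\<Sum>a\<in>R0. \<Sum>b\<in>R0. \<Sum>c\<in>R0. add_char p (t * (4 * Q a b c)))
     = (\<Sum>a\<in>R0. \<Sum>b\<in>R0. (\<Sum>c\<in>R0. add_char p (t * (2 * c + - (a + b))\<^sup>2)) * add_char p (2 * t * (a + b)\<^sup>2 + t * (a - b)\<^sup>2))"
    unfolding four_Q sum_distrib_right
    by (intro sum.cong refl) (simp add: add_char_add[symmetric] algebra_simps)
  also have "\<dots> = (\<Sum>a\<in>R0. \<Sum>b\<in>R0. gsum t * add_char p (2 * t * (a + b)\<^sup>2 + t * (a - b)\<^sup>2))"
    by (simp only: gsum_affine[OF coprime_2])
  also have "\<dots> = gsum t * (\<Sum>b\<in>R0. \<Sum>a\<in>R0. add_char p (2 * t * (a + b)\<^sup>2 + t * (a - b)\<^sup>2))"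
    by (subst sum.swap) (simp add: sum_distrib_left)
  also have "(\<Sum>b\<in>R0. \<Sum>a\<in>R0. add_char p (2 * t * (a + b)\<^sup>2 + t * (a - b)\<^sup>2))
     = (\<Sum>b\<in>R0. \<Sum>a\<in>R0. add_char p (2 * t * ((1 * a + b) + b)\<^sup>2 + t * ((1 * a + b) - b)\<^sup>2))"
  proof (rule sum.cong[OF refl], rule sum_residues_affine[symmetric])
    fix b
    show "residue_periodic p (\<lambda>a. add_char p (2 * t * (a + b)\<^sup>2 + t * (a - b)\<^sup>2))"
      by (rule residue_periodicI, intro add_char_cong p_pos cong_mult cong_pow cong_add cong_diff) auto
  qed (use p_pos in auto)
  also have "\<dots> = (\<Sum>b\<in>R0. \<Sum>a\<in>R0. add_char p (t * a\<^sup>2) * add_char p (2 * t * (2 * b + a)\<^sup>2))"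
    by (intro sum.cong refl) (simp add: add_char_add[symmetric] algebra_simps)
  also have "\<dots> = (\<Sum>a\<in>R0. add_char p (t * a\<^sup>2) * (\<Sum>b\<in>R0. add_char p (2 * t * (2 * b + a)\<^sup>2)))"
    by (subst sum.swap) (simp add: sum_distrib_left)
  also have "\<dots> = gsum t * gsum (2 * t)"
    by (simp only: gsum_affine[OF coprime_2] sum_distrib_right[symmetric]) (simp only: gsum_def)
  finally show ?thesis by (simp add: power2_eq_square mult_ac)
qed

text \<open>For \<open>p \<equiv> 3 (mod 4)\<close> the quadratic Gauss sum is odd in \<open>t\<close>, so the cubic
  expression above cancels on summing over \<open>t \<noteq> 0\<close>.\<close>

lemma card_Q_zeros: "card {(a, b, c). a \<in> R0 \<and> b \<in> R0 \<and> c \<in> R0 \<and> int p dvd Q a b c} = p\<^sup>2"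
  (is "card ?S = _")
proof -
  define V where "V t = gsum t ^ 2 * gsum (2 * t)" for t
  have V: "residue_periodic p V"
    unfolding V_def
  proof
    fix x y assume xy: "[x = y] (mod int p)"
    then have "gsum x = gsum y" "gsum (2 * x) = gsum (2 * y)"
      by (auto intro!: residue_periodicD[OF gsum_periodic] cong_mult)
    then show "gsum x ^ 2 * gsum (2 * x) = gsum y ^ 2 * gsum (2 * y)" by simp
  qed
  have "V (- t) = - V t" if "t \<in> R1" for t
  proof -
    have "\<not> int p dvd t" "\<not> int p dvd 2 * t"
      using not_dvd_R1[OF that] coprime_2 by (auto simp: dvd_mult_iff coprime_iff)
    then show ?thesis
      using gsum_minus[of t] gsum_minus[of "2 * t"] by (simp add: V_def)
  qed
  then have "(\<Sum>t\<in>R1. V (- t)) = - (\<Sum>t\<in>R1. V t)"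
    by (simp add: sum_negf)
  then have "(\<Sum>t\<in>R1. V t) = 0"
    using sum_R1_minus[OF V] by simp
  \<comment> \<open>Only t = 0 survives, with value p * p * p.\<close>
  then have sumV: "(\<Sum>t\<in>R0. V t) = of_nat p ^ 3"
    by (simp add: sum_residues_split0[OF p_pos] V_def eval_nat_numeral)
  have dvd4: "int p dvd 4 * x \<longleftrightarrow> int p dvd x" for x
    using not_dvd_small[of 4] p_gt_3 p_mod_4 by (cases "p = 4") (auto simp: dvd_mult_iff)
  have "of_nat p * of_nat (card ?S) = (\<Sum>(a, b, c)\<in>?S. of_nat p :: complex)"
    by simp
  also have "\<dots> = (\<Sum>(a, b, c)\<in>R0 \<times> R0 \<times> R0. \<Sum>t\<in>R0. add_char p (t * (4 * Q a b c)))"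
    by (rule sum.mono_neutral_cong_left) (auto simp: sum_add_char_mult[OF p_pos] dvd4 split: if_splits)
  also have "\<dots> = (\<Sum>t\<in>R0. \<Sum>(a, b, c)\<in>R0 \<times> R0 \<times> R0. add_char p (t * (4 * Q a b c)))"
    by (subst sum.swap) (simp add: case_prod_unfold)
  also have "\<dots> = (\<Sum>t\<in>R0. V t)"
    by (simp add: V_def sum_add_char_Q[symmetric] sum.cartesian_product)
  finally have "of_nat p * of_nat (card ?S) = (of_nat p ^ 3 :: complex)" using sumV by simp
  then have "of_nat (p * card ?S) = (of_nat (p ^ 3) :: complex)" by simp
  then have "p * card ?S = p * p\<^sup>2"
    by (simp only: of_nat_eq_iff) (simp add: eval_nat_numeral)
  then show ?thesis using p_pos by simp
qed

end

section \<open>The fourth moment\<close>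

context prime_3_mod_4 begin

lemma mod_eq_iff_R0: "x \<in> R0 \<Longrightarrow> y \<in> R0 \<Longrightarrow> int p dvd x - y \<longleftrightarrow> x = y"
  by (auto simp: mod_eq_dvd_iff[symmetric])

lemma dvd_R0: "x \<in> R0 \<Longrightarrow> int p dvd x \<longleftrightarrow> x = 0"
  using mod_eq_iff_R0[of x 0] p_pos by simp

lemma fifth_power_identity:
  "a ^ 5 + b ^ 5 - (c ^ 5 + (a + b - c) ^ 5) = - (5 * ((a + b) * ((c - a) * ((c - b) * Q a b c))))"
  by (simp add: Q_def eval_nat_numeral algebra_simps)

lemma card_triple_image_le:
  assumes "S \<subseteq> f ` R0"
  shows "card S \<le> p"
proof -
  have "card S \<le> card (f ` R0)" using assms by (intro card_mono) auto
  also have "\<dots> \<le> card R0" by (rule card_image_le) simp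
  finally show ?thesis by simp
qed

text \<open>Eliminating d leaves triples on the union of B1, B2, B3, B4, each with p^2 points. Each
  of the six pairwise intersections has at most p points, hence the defect 6p.\<close>

lemma card_quadruples:
  defines "N \<equiv> card {((a, b), (c, d)). (a, b) \<in> R0 \<times> R0 \<and> (c, d) \<in> R0 \<times> R0 \<and>
      [a ^ 5 + b ^ 5 = c ^ 5 + d ^ 5] (mod int p) \<and> [a + b = c + d] (mod int p)}"
  shows "N \<le> 4 * p\<^sup>2" "4 * p\<^sup>2 \<le> N + 6 * p"
proof -
  let ?T = "R0 \<times> R0 \<times> R0"
  define B1 where "B1 = {(a, b, c). (a, b, c) \<in> ?T \<and> int p dvd a + b}"
  define B2 where "B2 = {(a, b, c). (a, b, c) \<in> ?T \<and> c = a}"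
  define B3 where "B3 = {(a, b, c). (a, b, c) \<in> ?T \<and> c = b}"
  define B4 where "B4 = {(a, b, c). (a, b, c) \<in> ?T \<and> int p dvd Q a b c}"
  have finT: "finite ?T" by simp
  have sub: "B1 \<subseteq> ?T" "B2 \<subseteq> ?T" "B3 \<subseteq> ?T" "B4 \<subseteq> ?T"
    by (auto simp: B1_def B2_def B3_def B4_def)
  have fin: "finite B1" "finite B2" "finite B3" "finite B4"
    using sub finT finite_subset by metis+
  have neg_mod: "(- a) mod int p \<in> R0" "int p dvd a + (- a) mod int p" for a
    using p_pos by (auto simp: dvd_eq_mod_eq_0 mod_add_right_eq)
  have neg_unique: "b = (- a) mod int p" if "b \<in> R0" "int p dvd a + b" for a b
  proof -
    have "int p dvd b - (- a) mod int p"
      using dvd_diff[OF that(2) neg_mod(2)[of a]] by simp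
    then show ?thesis using mod_eq_iff_R0[OF that(1) neg_mod(1)] by simp
  qed
  have "bij_betw (\<lambda>(a, c). (a, (- a) mod int p, c)) (R0 \<times> R0) B1"
    by (rule bij_betwI[where g = "\<lambda>(a, b, c). (a, c)"])
      (use neg_mod neg_unique in \<open>auto simp: B1_def\<close>)
  then have c1: "card B1 = p\<^sup>2"
    by (simp add: bij_betw_same_card[symmetric] power2_eq_square)
  have "bij_betw (\<lambda>(a, b). (a, b, a)) (R0 \<times> R0) B2"
    by (rule bij_betwI[where g = "\<lambda>(a, b, c). (a, b)"]) (auto simp: B2_def)
  then have c2: "card B2 = p\<^sup>2"
    by (simp add: bij_betw_same_card[symmetric] power2_eq_square)
  have "bij_betw (\<lambda>(a, b). (a, b, b)) (R0 \<times> R0) B3"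
    by (rule bij_betwI[where g = "\<lambda>(a, b, c). (a, b)"]) (auto simp: B3_def)
  then have c3: "card B3 = p\<^sup>2"
    by (simp add: bij_betw_same_card[symmetric] power2_eq_square)
  have "B4 = {(a, b, c). a \<in> R0 \<and> b \<in> R0 \<and> c \<in> R0 \<and> int p dvd Q a b c}"
    by (auto simp: B4_def)
  then have c4: "card B4 = p\<^sup>2" using card_Q_zeros by simp

  have i12: "card (B1 \<inter> B2) \<le> p"
    by (rule card_triple_image_le[of _ "\<lambda>a. (a, (- a) mod int p, a)"])
      (use neg_unique in \<open>auto simp: B1_def B2_def\<close>)
  have i13: "card (B1 \<inter> B3) \<le> p"
    by (rule card_triple_image_le[of _ "\<lambda>a. (a, (- a) mod int p, (- a) mod int p)"])
      (use neg_unique in \<open>auto simp: B1_def B3_def\<close>)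
  have i23: "card (B2 \<inter> B3) \<le> p"
    by (rule card_triple_image_le[of _ "\<lambda>a. (a, a, a)"]) (auto simp: B2_def B3_def)
  have zero: "x = 0 \<and> y = 0" if "x \<in> R0" "y \<in> R0" "int p dvd x\<^sup>2 + y\<^sup>2" for x y
    using dvd_sum_squares[OF that(3)] that dvd_R0 by blast
  have "(a, b, c) = (0, 0, 0)" if "(a, b, c) \<in> B1 \<inter> B4" for a b c
  proof -
    have abc: "a \<in> R0" "b \<in> R0" "c \<in> R0" and d: "int p dvd a + b" "int p dvd Q a b c"
      using that by (auto simp: B1_def B4_def)
    \<comment> \<open>On each of the three planes \<open>Q\<close> reduces to a sum of two squares,
      so \<open>dvd_sum_squares\<close> leaves only the origin.\<close>
    have "a\<^sup>2 + c\<^sup>2 = Q a b c - (a + b) * (b - c)"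
      by (simp add: Q_def power2_eq_square algebra_simps)
    then have "int p dvd a\<^sup>2 + c\<^sup>2" using d by simp
    then have "a = 0" "c = 0" using zero abc by blast+
    then show ?thesis using d(1) abc dvd_R0 by simp
  qed
  then have i14: "card (B1 \<inter> B4) \<le> p"
    using p_pos by (intro card_triple_image_le[of _ "\<lambda>a. (0, 0, 0)"]) fastforce
  have "(a, b, c) = (0, 0, 0)" if "(a, b, c) \<in> B2 \<inter> B4" for a b c
  proof -
    have abc: "a \<in> R0" "b \<in> R0" "c = a" and d: "int p dvd Q a b c"
      using that by (auto simp: B2_def B4_def)
    have "a\<^sup>2 + b\<^sup>2 = Q a b c"
      using abc by (simp add: Q_def power2_eq_square algebra_simps)
    then show ?thesis using zero abc d by auto
  qed
  then have i24: "card (B2 \<inter> B4) \<le> p"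
    using p_pos by (intro card_triple_image_le[of _ "\<lambda>a. (0, 0, 0)"]) fastforce
  have "(a, b, c) = (0, 0, 0)" if "(a, b, c) \<in> B3 \<inter> B4" for a b c
  proof -
    have abc: "a \<in> R0" "b \<in> R0" "c = b" and d: "int p dvd Q a b c"
      using that by (auto simp: B3_def B4_def)
    have "a\<^sup>2 + b\<^sup>2 = Q a b c"
      using abc by (simp add: Q_def power2_eq_square algebra_simps)
    then show ?thesis using zero abc d by auto
  qed
  then have i34: "card (B3 \<inter> B4) \<le> p"
    using p_pos by (intro card_triple_image_le[of _ "\<lambda>a. (0, 0, 0)"]) fastforce

  define D where "D = {(a, b, c). (a, b, c) \<in> ?T \<and> int p dvd (a + b) * ((c - a) * ((c - b) * Q a b c))}"
  have D: "D = (B1 \<union> B2) \<union> (B3 \<union> B4)"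
    unfolding D_def B1_def B2_def B3_def B4_def
    by (auto simp: dvd_mult_iff mod_eq_iff_R0)
  have dvd5: "int p dvd 5 * x \<longleftrightarrow> int p dvd x" for x
    using not_dvd_small[of 5] p_ge_7 by (auto simp: dvd_mult_iff)
  have key: "[a ^ 5 + b ^ 5 = c ^ 5 + d ^ 5] (mod int p) \<longleftrightarrow> int p dvd (a + b) * ((c - a) * ((c - b) * Q a b c))"
    if "[d = a + b - c] (mod int p)" for a b c d
  proof -
    have "[c ^ 5 + d ^ 5 = c ^ 5 + (a + b - c) ^ 5] (mod int p)"
      by (intro cong_add cong_pow that) auto
    then have "[a ^ 5 + b ^ 5 = c ^ 5 + d ^ 5] (mod int p) \<longleftrightarrow> [a ^ 5 + b ^ 5 = c ^ 5 + (a + b - c) ^ 5] (mod int p)"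
      by (meson cong_sym cong_trans)
    also have "\<dots> \<longleftrightarrow> int p dvd - (5 * ((a + b) * ((c - a) * ((c - b) * Q a b c))))"
      by (simp only: cong_iff_dvd_diff fifth_power_identity)
    finally show ?thesis by (simp only: dvd_minus_iff dvd5)
  qed
  define NS where "NS = {((a, b), (c, d)). (a, b) \<in> R0 \<times> R0 \<and> (c, d) \<in> R0 \<times> R0 \<and>
      [a ^ 5 + b ^ 5 = c ^ 5 + d ^ 5] (mod int p) \<and> [a + b = c + d] (mod int p)}"
  have solve: "[a + b = c + d] (mod int p) \<longleftrightarrow> [d = a + b - c] (mod int p)" for a b c d
    unfolding cong_iff_dvd_diff by (subst dvd_minus_iff[symmetric]) (simp add: algebra_simps)
  have "bij_betw (\<lambda>(a, b, c). ((a, b), (c, (a + b - c) mod int p))) D NS"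
  proof (rule bij_betwI[where g = "\<lambda>x. (fst (fst x), snd (fst x), fst (snd x))"], goal_cases)
    case 1
    show ?case
    proof (rule funcsetI)
      fix x assume "x \<in> D"
      then obtain a b c where x: "x = (a, b, c)" "(a, b, c) \<in> D" by (cases x) auto
      have cg: "[(a + b - c) mod int p = a + b - c] (mod int p)" by simp
      show "(case x of (a, b, c) \<Rightarrow> ((a, b), (c, (a + b - c) mod int p))) \<in> NS"
        using x p_pos key[OF cg] solve[of a b c "(a + b - c) mod int p"] cg by (auto simp: D_def NS_def)
    qed
  next
    case 2
    show ?case
    proof (rule funcsetI)
      fix x assume "x \<in> NS"
      then obtain a b c d where x: "x = ((a, b), (c, d))" "((a, b), (c, d)) \<in> NS" by (cases x) auto
      show "(fst (fst x), snd (fst x), fst (snd x)) \<in> D"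
        using x key[of d a b c] solve[of a b c d] by (auto simp: D_def NS_def)
    qed
  next
    case (3 x)
    then show ?case by (auto simp: D_def)
  next
    case (4 x)
    then obtain a b c d where x: "x = ((a, b), (c, d))" "((a, b), (c, d)) \<in> NS" by (cases x) auto
    then have "[d = a + b - c] (mod int p)" "d \<in> R0"
      using solve[of a b c d] by (auto simp: NS_def)
    then have "(a + b - c) mod int p = d" by (auto simp: cong_def)
    then show ?case using x by simp
  qed
  then have "card D = N"
    unfolding N_def NS_def by (rule bij_betw_same_card)
  moreover have "card D \<le> card B1 + card B2 + (card B3 + card B4)"
    unfolding D by (meson add_mono card_Un_le le_trans)
  ultimately show "N \<le> 4 * p\<^sup>2" using c1 c2 c3 c4 by simp

  have "card (B1 \<union> B2) + card (B1 \<inter> B2) = 2 * p\<^sup>2"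
    using card_Un_Int[OF fin(1,2)] c1 c2 by simp
  moreover have "card (B3 \<union> B4) + card (B3 \<inter> B4) = 2 * p\<^sup>2"
    using card_Un_Int[OF fin(3,4)] c3 c4 by simp
  moreover have "card ((B1 \<union> B2) \<union> (B3 \<union> B4)) + card ((B1 \<union> B2) \<inter> (B3 \<union> B4))
      = card (B1 \<union> B2) + card (B3 \<union> B4)"
    using card_Un_Int[of "B1 \<union> B2" "B3 \<union> B4"] fin by simp
  moreover have "card ((B1 \<union> B2) \<inter> (B3 \<union> B4)) \<le> 4 * p"
  proof -
    have "(B1 \<union> B2) \<inter> (B3 \<union> B4) = ((B1 \<inter> B3) \<union> (B1 \<inter> B4)) \<union> ((B2 \<inter> B3) \<union> (B2 \<inter> B4))" by auto
    then have "card ((B1 \<union> B2) \<inter> (B3 \<union> B4))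
        \<le> card (B1 \<inter> B3) + card (B1 \<inter> B4) + (card (B2 \<inter> B3) + card (B2 \<inter> B4))"
      by (simp only:) (intro order_trans[OF card_Un_le] add_mono card_Un_le)
    then show ?thesis using i13 i14 i23 i24 by simp
  qed
  ultimately show "4 * p\<^sup>2 \<le> N + 6 * p"
    using \<open>card D = N\<close> D i12 i34 by simp
qed

text \<open>The fourth power of the modulus is the squared modulus of the squared sum, and the
  squared sum is one character sum indexed by pairs of residues.\<close>

lemma sum_W_R0:
  "(\<Sum>m\<in>R0. \<Sum>n\<in>R0. W m n) = real p ^ 2 * real (card {((a, b), (c, d)). (a, b) \<in> R0 \<times> R0 \<and> (c, d) \<in> R0 \<times> R0 \<and>
      [a ^ 5 + b ^ 5 = c ^ 5 + d ^ 5] (mod int p) \<and> [a + b = c + d] (mod int p)})"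
proof -
  have W: "W m n = (cmod (\<Sum>x\<in>R0 \<times> R0. add_char p (m * (fst x ^ 5 + snd x ^ 5) + n * (fst x + snd x))))\<^sup>2" for m n
  proof -
    have "(\<Sum>a\<in>R0. add_char p (m * a ^ 5 + n * a))\<^sup>2
        = (\<Sum>a\<in>R0. \<Sum>b\<in>R0. add_char p (m * (a ^ 5 + b ^ 5) + n * (a + b)))"
      by (simp add: power2_eq_square sum_product add_char_add[symmetric] algebra_simps)
    also have "\<dots> = (\<Sum>x\<in>R0 \<times> R0. add_char p (m * (fst x ^ 5 + snd x ^ 5) + n * (fst x + snd x)))"
      by (simp add: sum.cartesian_product case_prod_unfold)
    finally show ?thesis
      by (simp add: W_def norm_power[symmetric] flip: power_mult)
        (metis (no_types, lifting) norm_power power_mult num_double numeral_times_numeral)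
  qed
  show ?thesis
    unfolding W by (subst sum_norm_sq_add_char[OF p_pos]) (auto intro!: arg_cong[of _ _ card])
qed

section \<open>Fifth-power sums: the terms with n = 0\<close>

definition qsum :: "int \<Rightarrow> real" where
  "qsum m = (cmod (\<Sum>a\<in>R0. add_char p (m * a ^ 5)))\<^sup>2"

lemma card_fifth_roots:
  shows "card {t \<in> R0. [t ^ 5 = c] (mod int p)} \<le> 5"
proof -
  have "{t \<in> R0. [t ^ 5 = c] (mod int p)} = int ` {x\<in>{..<p}. [x ^ 5 = nat (c mod int p)] (mod p)}"
    (is "?L = int ` ?S")
  proof -
    have iff: "[int x ^ 5 = c] (mod int p) \<longleftrightarrow> [x ^ 5 = nat (c mod int p)] (mod p)" for x
      using p_pos by (simp add: cong_int_iff[symmetric] cong_def)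
    show ?thesis
    proof (intro equalityI subsetI)
      fix t assume "t \<in> ?L"
      then have "t = int (nat t)" "nat t \<in> ?S" using iff[of "nat t"] by auto
      then show "t \<in> int ` ?S" by blast
    qed (use iff in auto)
  qed
  then show ?thesis
    using roots_mod_prime_bound[OF prime_p, of 5 "nat (c mod int p)"] by (simp add: card_image)
qed

text \<open>By orthogonality the left side is p times the number of pairs with equal fifth powers,
  and each b has at most five partners a.\<close>

lemma sum_qsum_le: "(\<Sum>m\<in>R0. qsum m) \<le> 5 * real p ^ 2"
proof -
  let ?S = "{(a, b). a \<in> R0 \<and> b \<in> R0 \<and> [a ^ 5 = b ^ 5] (mod int p)}"
  have "real p * (\<Sum>m\<in>R0. qsum m) = real p ^ 2 * real (card ?S)"
    using sum_norm_sq_add_char[OF p_pos, of R0 "\<lambda>a. a ^ 5" "\<lambda>_. 0"]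
    by (simp add: qsum_def sum_distrib_left)
  then have eq: "(\<Sum>m\<in>R0. qsum m) = real p * real (card ?S)"
    using p_pos by (simp add: power2_eq_square)
  have "?S = (\<Union>b\<in>R0. (\<lambda>a. (a, b)) ` {t \<in> R0. [t ^ 5 = b ^ 5] (mod int p)})" by auto
  then have "card ?S \<le> (\<Sum>b\<in>R0. card ((\<lambda>a. (a, b)) ` {t \<in> R0. [t ^ 5 = b ^ 5] (mod int p)}))"
    by (simp only:) (rule card_UN_le, simp)
  also have "\<dots> \<le> (\<Sum>b\<in>R0. 5)"
    by (intro sum_mono order_trans[OF card_image_le] card_fifth_roots finite_Collect_conjI disjI1) simp
  finally have "real (card ?S) \<le> 5 * real p" by simp
  then have "real p * real (card ?S) \<le> real p * (5 * real p)" by (intro mult_left_mono) auto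
  then show ?thesis using eq by (simp add: power2_eq_square)
qed

text \<open>A pointwise bound from the mean: \<open>qsum\<close> is unchanged when m is multiplied
  by a fifth power, and t -> m t^5 takes each value at most five times. Thus (p - 1)
  \<open>qsum m\<close> is at most 5 times the total, i.e. 25 p^2; the last factor 2 comes from p
  \<le> 2 (p - 1).\<close>

lemma qsum_le:
  assumes m: "m \<in> R1"
  shows "qsum m \<le> 50 * real p"
proof -
  have scale: "qsum (m * t ^ 5) = qsum m" if "t \<in> R1" for t
  proof -
    have "residue_periodic p (\<lambda>a. add_char p (m * a ^ 5))"
      using periodic_add_char_poly5[of m 0] by simp
    from sum_residues_affine[OF this p_pos coprime_R1[OF that], of 0]
    show ?thesis by (simp add: qsum_def power_mult_distrib mult_ac)
  qed
  have per: "qsum x = qsum y" if "[x = y] (mod int p)" for x y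
    unfolding qsum_def
    by (intro arg_cong[of _ _ "\<lambda>z. (cmod z)\<^sup>2"] sum.cong refl add_char_cong p_pos cong_mult that) auto
  define \<phi> where "\<phi> t = (m * t ^ 5) mod int p" for t
  have nonneg: "qsum x \<ge> 0" for x by (simp add: qsum_def)
  obtain m' where m': "[m * m' = 1] (mod int p)"
    using cong_solve_coprime_int[OF coprime_R1[OF m]] by auto
  have fiber: "card {t \<in> R1. \<phi> t = w} \<le> 5" for w
  proof -
    have "{t \<in> R1. \<phi> t = w} \<subseteq> {t \<in> R0. [t ^ 5 = m' * w] (mod int p)}"
    proof
      fix t assume t: "t \<in> {t \<in> R1. \<phi> t = w}"
      have "[1 * t ^ 5 = (m * m') * t ^ 5] (mod int p)"
        using m' by (intro cong_mult) (auto simp: cong_sym_eq)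
      also have "(m * m') * t ^ 5 = m' * (m * t ^ 5)" by simp
      also have "[m' * (m * t ^ 5) = m' * w] (mod int p)"
        using t by (intro cong_mult) (auto simp: \<phi>_def cong_def)
      finally show "t \<in> {t \<in> R0. [t ^ 5 = m' * w] (mod int p)}" using t by simp
    qed
    then have "card {t \<in> R1. \<phi> t = w} \<le> card {t \<in> R0. [t ^ 5 = m' * w] (mod int p)}"
      by (intro card_mono finite_Collect_conjI disjI1) auto
    also have "\<dots> \<le> 5" by (rule card_fifth_roots)
    finally show ?thesis .
  qed
  have "real (p - 1) * qsum m = (\<Sum>t\<in>R1. qsum (m * t ^ 5))"
    by (simp add: scale)
  also have "\<dots> = (\<Sum>t\<in>R1. qsum (\<phi> t))"
    by (intro sum.cong refl per) (simp add: \<phi>_def cong_def)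
  also have "\<dots> = (\<Sum>w\<in>R0. \<Sum>t\<in>{t \<in> R1. \<phi> t = w}. qsum (\<phi> t))"
    using p_pos by (intro sum.group[symmetric]) (auto simp: \<phi>_def)
  also have "\<dots> = (\<Sum>w\<in>R0. real (card {t \<in> R1. \<phi> t = w}) * qsum w)"
    by (intro sum.cong refl) simp
  also have "\<dots> \<le> (\<Sum>w\<in>R0. 5 * qsum w)"
    using fiber by (intro sum_mono mult_right_mono nonneg) (metis of_nat_le_iff of_nat_numeral)
  also have "\<dots> \<le> 25 * real p ^ 2"
    using sum_qsum_le by (simp add: sum_distrib_left[symmetric])
  finally have *: "real (p - 1) * qsum m \<le> 25 * real p ^ 2" .
  have "real p \<le> 2 * real (p - 1)" using p_gt_3 by (simp add: of_nat_diff)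
  then have "real p * qsum m \<le> 2 * real (p - 1) * qsum m"
    by (intro mult_right_mono nonneg)
  also have "\<dots> \<le> real p * (50 * real p)"
    using * by (simp add: power2_eq_square mult_ac)
  finally show ?thesis using p_pos by simp
qed

text \<open>The axes are removed from the full mass: m = 0 contributes nothing except p^4 at the
  origin, and n = 0 contributes at most (50 p)^2 for each m. The constant 2506 is 2500 plus the 6
  from the intersections.\<close>

lemma sum_W_R1: "\<bar>(\<Sum>m\<in>R1. \<Sum>n\<in>R1. W m n) - 3 * real p ^ 4\<bar> \<le> 2506 * real p ^ 3"
proof -
  define N where "N = card {((a, b), (c, d)). (a, b) \<in> R0 \<times> R0 \<and> (c, d) \<in> R0 \<times> R0 \<and>
      [a ^ 5 + b ^ 5 = c ^ 5 + d ^ 5] (mod int p) \<and> [a + b = c + d] (mod int p)}"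
  have N: "real N \<le> 4 * real p ^ 2" "4 * real p ^ 2 \<le> real N + 6 * real p"
  proof -
    have "N \<le> 4 * p\<^sup>2" "4 * p\<^sup>2 \<le> N + 6 * p" using card_quadruples unfolding N_def by auto
    then have "real N \<le> real (4 * p\<^sup>2)" "real (4 * p\<^sup>2) \<le> real (N + 6 * p)" by (simp_all only: of_nat_le_iff)
    then show "real N \<le> 4 * real p ^ 2" "4 * real p ^ 2 \<le> real N + 6 * real p" by simp_all
  qed
  have "W 0 n = 0" if "n \<in> R1" for n
    using sum_add_char_mult[OF p_pos, of n] not_dvd_R1[OF that] by (simp add: W_def mult.commute)
  then have W0n: "(\<Sum>n\<in>R1. W 0 n) = 0" by simp
  have W00: "W 0 0 = real p ^ 4" by (simp add: W_def)
  have Wm0: "W m 0 = qsum m ^ 2" for m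
    by (simp add: W_def qsum_def flip: power_mult)
  have "(\<Sum>m\<in>R1. W m 0) \<le> (\<Sum>m\<in>R1. (50 * real p) ^ 2)"
    unfolding Wm0 by (intro sum_mono power_mono qsum_le) (auto simp: qsum_def)
  also have "\<dots> = real (p - 1) * (50 * real p) ^ 2" by simp
  also have "\<dots> \<le> real p * (50 * real p) ^ 2" by (intro mult_right_mono) auto
  finally have up: "(\<Sum>m\<in>R1. W m 0) \<le> 2500 * real p ^ 3"
    by (simp add: power_mult_distrib eval_nat_numeral)
  have lo: "(\<Sum>m\<in>R1. W m 0) \<ge> 0" by (intro sum_nonneg) (simp add: W_def)
  have "real p ^ 2 * real N = real p ^ 4 + (\<Sum>m\<in>R1. W m 0) + (\<Sum>m\<in>R1. \<Sum>n\<in>R1. W m n)"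
    using sum_W_R0 unfolding N_def[symmetric]
    by (simp add: sum_residues_split0[OF p_pos] sum.distrib W0n W00)
  moreover have "real p ^ 2 * real N \<le> 4 * real p ^ 4"
    using mult_left_mono[OF N(1), of "real p ^ 2"] by (simp add: eval_nat_numeral)
  moreover have "4 * real p ^ 4 \<le> real p ^ 2 * real N + 6 * real p ^ 3"
    using mult_left_mono[OF N(2), of "real p ^ 2"] by (simp add: eval_nat_numeral algebra_simps)
  moreover have "real p ^ 3 \<ge> 0" by simp
  ultimately show ?thesis using up lo by linarith
qed

end

section \<open>Dedekind sums and cotangents\<close>

lemma sawtooth_add_int: "sawtooth (x + of_int n) = sawtooth x"
  by (auto simp: sawtooth_def)

lemma sawtooth_minus: "sawtooth (- x) = - sawtooth x"
proof (cases "x \<in> \<int>")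
  case False
  then have "\<lceil>x\<rceil> = \<lfloor>x\<rfloor> + 1"
    by (auto simp: ceiling_altdef) (metis Ints_of_int)
  then show ?thesis using False by (simp add: sawtooth_def floor_minus)
qed (simp add: sawtooth_def)

lemma sum_nat_mult_power:
  fixes w :: "'a :: comm_ring_1"
  shows "(w - 1) * (\<Sum>a<n. of_nat a * w ^ a) = of_nat n * w ^ n - w * (\<Sum>a<n. w ^ a)"
  by (induction n) (simp_all add: algebra_simps)

text \<open>The upper bound holds because sin x - x cos x has derivative x sin x \<ge> 0; the lower
  one because cos x + sin x \<ge> 1 and sin x \<le> x.\<close>

lemma cot_bounds:
  fixes x :: real
  assumes "0 < x" "x \<le> pi / 2"
  shows "0 \<le> cot x" "cot x \<le> 1 / x" "1 / x - 1 \<le> cot x"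
proof -
  have s: "sin x > 0" using assms pi_gt_zero by (intro sin_gt_zero) linarith+
  have c: "cos x \<ge> 0" using assms by (intro cos_ge_zero) auto
  show "0 \<le> cot x" using s c by (simp add: cot_def)
  have "sin 0 - 0 * cos 0 \<le> sin x - x * cos x"
  proof (rule DERIV_nonneg_imp_nondecreasing[where f = "\<lambda>y. sin y - y * cos y"])
    fix y assume y: "0 \<le> y" "y \<le> x"
    have "((\<lambda>y. sin y - y * cos y) has_real_derivative y * sin y) (at y)"
      by (auto intro!: derivative_eq_intros)
    moreover have "y * sin y \<ge> 0"
      using y assms pi_gt_zero by (intro mult_nonneg_nonneg sin_ge_zero) linarith+
    ultimately show "\<exists>D. ((\<lambda>y. sin y - y * cos y) has_real_derivative D) (at y) \<and> D \<ge> 0" by blast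
  qed (use assms in auto)
  then show "cot x \<le> 1 / x" using s assms by (simp add: cot_def field_simps)
  have "cos x * 1 + sin x * 1 \<ge> cos x * cos x + sin x * sin x"
    using s c by (intro add_mono mult_left_mono) auto
  then have "cos x + sin x \<ge> 1"
    using sin_cos_squared_add3[of x] by simp
  then have "x * (cos x + sin x) \<ge> x * 1" using assms by (intro mult_left_mono) auto
  moreover have "sin x \<le> x" using assms by (intro sin_x_le_x) auto
  ultimately have "sin x \<le> x * cos x + x * sin x" by (simp add: distrib_left)
  then show "1 / x - 1 \<le> cot x" using s assms by (simp add: cot_def field_simps)
qed

text \<open>For w = cis (2 \<theta>) the left side is (w + 1) / (2 (w - 1)); dividing w + 1 and w -
  1 by cis \<theta> gives 2 cos \<theta> and 2 i sin \<theta>.\<close>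

lemma half_minus_inverse_cis:
  assumes "sin \<theta> \<noteq> 0"
  shows "1 / (cis (2 * \<theta>) - 1) + 1 / 2 = - (\<i> / 2) * complex_of_real (cot \<theta>)"
proof -
  define w where "w = cis (2 * \<theta>)"
  have w: "w = Complex ((cos \<theta>)\<^sup>2 - (sin \<theta>)\<^sup>2) (2 * sin \<theta> * cos \<theta>)"
    by (simp add: w_def complex_eq_iff cos_double sin_double)
  have cs: "(cos \<theta>)\<^sup>2 = 1 - (sin \<theta>)\<^sup>2" by (simp add: cos_squared_eq)
  have cc: "cos \<theta> * cos \<theta> = 1 - sin \<theta> * sin \<theta>"
    using cs by (simp only: power2_eq_square)
  have w1: "w \<noteq> 1"
  proof
    assume "w = 1"
    then have "(cos \<theta>)\<^sup>2 - (sin \<theta>)\<^sup>2 = 1" using w by (simp add: complex_eq_iff)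
    then show False using assms cs by simp
  qed
  have "(w + 1) * complex_of_real (sin \<theta>) = - \<i> * complex_of_real (cos \<theta>) * (w - 1)"
    unfolding w complex_eq_iff 
    by (simp add: power2_eq_square) (intro conjI disjI2, simp only: cc, simp only: cc, simp add: algebra_simps)
  then have w_plus: "w + 1 = - \<i> * complex_of_real (cos \<theta>) * (w - 1) / complex_of_real (sin \<theta>)"
    using assms by (subst eq_divide_eq) simp
  have "1 / (w - 1) + 1 / 2 = (w + 1) / (2 * (w - 1))"
    using w1 by (simp add: field_simps)
  also have "\<dots> = - (\<i> / 2) * complex_of_real (cot \<theta>)"
  proof -
    have "(- \<i> * complex_of_real (cos \<theta>) * v / complex_of_real (sin \<theta>)) / (2 * v)
        = - (\<i> / 2) * complex_of_real (cot \<theta>)" if "v \<noteq> 0" for v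
      using that assms by (simp add: cot_def)
    from this[of "w - 1"] show ?thesis unfolding w_plus using w1 by simp
  qed
  finally show ?thesis by (simp add: w_def)
qed

context prime_3_mod_4 begin

definition saw :: "int \<Rightarrow> real" where "saw a = sawtooth (real_of_int a / real p)"

lemma saw_periodic: "residue_periodic p saw"
proof
  fix x y assume "[x = y] (mod int p)"
  then obtain k where "x - y = int p * k"
    by (auto simp: cong_iff_dvd_diff)
  then have "x = y + int p * k" by simp
  then have "real_of_int x / real p = real_of_int y / real p + of_int k"
    using p_pos by (simp add: add_divide_distrib)
  then show "saw x = saw y" by (simp add: saw_def sawtooth_add_int)
qed

lemma saw_R1:
  assumes "a \<in> R1"
  shows "saw a = real_of_int a / real p - 1/2"
proof -
  define x where "x = real_of_int a / real p"
  have x: "0 < x" "x < 1" using assms by (auto simp: x_def)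
  then have "\<lfloor>x\<rfloor> = 0" by (simp add: floor_eq_iff)
  moreover from this have "x \<notin> \<int>" using x by (metis Ints_cases floor_of_int of_int_0 less_irrefl)
  ultimately show ?thesis by (simp add: saw_def sawtooth_def x_def)
qed

lemma saw_0 [simp]: "saw 0 = 0" by (simp add: saw_def sawtooth_def)

lemma dedekind_sum_saw: "dedekind_sum h p = (\<Sum>a\<in>R0. saw a * saw (a * h))"
  by (simp add: dedekind_sum_def saw_def sum_int_eq_sum_nat)

lemma dedekind_sum_periodic: "residue_periodic p (\<lambda>h. dedekind_sum h p)"
  unfolding dedekind_sum_saw
  by (rule residue_periodicI, intro sum.cong refl arg_cong2[of _ _ _ _ "(*)"] residue_periodicD[OF saw_periodic] cong_mult) auto

lemma dedekind_sum_minus: "dedekind_sum (- h) p = - dedekind_sum h p"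
  by (simp add: dedekind_sum_saw saw_def sawtooth_minus sum_negf)

text \<open>At multiples of p the sine vanishes and division by zero returns 0. This is the value
  that \<open>saw_hat_eq\<close> requires there, so the cotangent formula holds for every integer
  k.\<close>

definition ct :: "int \<Rightarrow> real" where "ct k = cot (pi * real_of_int k / real p)"

lemma ct_minus: "ct (- k) = - ct k" by (simp add: ct_def cot_minus)

text \<open>The finite Fourier transform of the sawtooth modulo p.\<close>

definition saw_hat :: "int \<Rightarrow> complex" where
  "saw_hat k = (\<Sum>a\<in>R0. complex_of_real (saw a) * add_char p (a * k))"

lemma saw_hat_eq: "saw_hat k = - (\<i> / 2) * complex_of_real (ct k)"
proof (cases "int p dvd k")
  case True
  then obtain n where n: "k = int p * n" by blast
  have "pi * real_of_int k / real p = pi * real_of_int n" using n p_pos by simp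
  then have "ct k = 0" by (simp add: ct_def cot_def sin_integer_2pi sin_npi_int mult.commute)
  moreover have "(\<Sum>a\<in>R0. saw a) = 0"
  proof -
    have "(\<Sum>a\<in>R0. saw ((- 1) * a + 0)) = (\<Sum>a\<in>R0. saw a)"
      by (rule sum_residues_affine[OF saw_periodic p_pos]) simp
    then show ?thesis by (simp add: saw_def sawtooth_minus sum_negf)
  qed
  moreover have "add_char p (a * k) = 1" for a
    using True p_pos by (simp add: add_char_eq_1_iff)
  ultimately show ?thesis by (simp add: saw_hat_def flip: of_real_sum)
next
  case False
  define w where "w = add_char p k"
  have w: "w \<noteq> 1" "w ^ p = 1"
    using False p_pos add_char_mult_nat[of p p k] add_char_eq_1_iff[OF p_pos, of "int p * k"]
    by (simp_all add: w_def add_char_eq_1_iff)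
  have geo: "(\<Sum>a<p. w ^ a) = 0" using geometric_sum[OF w(1), of p] w(2) by simp
  have "(w - 1) * (\<Sum>a<p. of_nat a * w ^ a) = of_nat p"
    using sum_nat_mult_power[of w p] geo w(2) by simp
  then have arith: "(\<Sum>a<p. of_nat a * w ^ a) = of_nat p / (w - 1)"
    using w by (simp add: field_simps)
  \<comment> \<open>The added 1/2 corrects a = 0, where the linear formula gives -1/2 but
    \<open>saw\<close> is 0. It is also the 1/2 that \<open>half_minus_inverse_cis\<close>
    expects.\<close>
  have "saw_hat k = (\<Sum>a\<in>R0. (of_int a / of_nat p - 1/2) * add_char p (a * k)) + 1/2"
    by (simp add: saw_hat_def sum_residues_split0[OF p_pos] saw_R1)
  also have "(\<Sum>a\<in>R0. (of_int a / of_nat p - 1/2) * add_char p (a * k))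
      = (\<Sum>a<p. (of_nat a / of_nat p - 1/2) * w ^ a)"
    by (simp add: sum_int_eq_sum_nat add_char_mult_nat w_def)
  also have "\<dots> = (\<Sum>a<p. of_nat a * w ^ a) / of_nat p - 1/2 * (\<Sum>a<p. w ^ a)"
    by (simp add: sum_divide_distrib sum_distrib_left left_diff_distrib sum_subtractf)
  also have "\<dots> = 1 / (w - 1)" using geo arith p_pos by simp
  finally have hat: "saw_hat k = 1 / (w - 1) + 1/2" .
  define \<theta> where "\<theta> = pi * real_of_int k / real p"
  have w\<theta>: "w = cis (2 * \<theta>)" by (simp add: w_def add_char_eq_cis \<theta>_def mult.assoc)
  have "sin \<theta> \<noteq> 0"
  proof
    assume "sin \<theta> = 0"
    then have "w = 1" unfolding w\<theta> complex_eq_iff by (simp add: cos_double_sin sin_double)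
    then show False using w by simp
  qed
  from half_minus_inverse_cis[OF this] show ?thesis
    unfolding hat w\<theta> by (simp add: ct_def \<theta>_def)
qed

lemma ct_periodic: "residue_periodic p ct"
proof
  fix x y assume "[x = y] (mod int p)"
  then have "saw_hat x = saw_hat y"
    unfolding saw_hat_def
    by (intro sum.cong refl arg_cong2[of _ _ _ _ "(*)"] add_char_cong p_pos cong_mult) auto
  then show "ct x = ct y" by (simp add: saw_hat_eq)
qed

lemma saw_inversion: "of_nat p * complex_of_real (saw b) = (\<Sum>k\<in>R0. saw_hat k * add_char p (- (k * b)))"
proof -
  have "(\<Sum>k\<in>R0. saw_hat k * add_char p (- (k * b)))
     = (\<Sum>k\<in>R0. \<Sum>a\<in>R0. complex_of_real (saw a) * add_char p (k * (a - b)))"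
    unfolding saw_hat_def sum_distrib_right
    by (intro sum.cong refl) (simp add: mult.assoc add_char_add[symmetric] algebra_simps)
  also have "\<dots> = (\<Sum>a\<in>R0. complex_of_real (saw a) * (\<Sum>k\<in>R0. add_char p (k * (a - b))))"
    by (subst sum.swap) (simp add: sum_distrib_left)
  also have "\<dots> = (\<Sum>a\<in>R0. if a = b mod int p then of_nat p * complex_of_real (saw a) else 0)"
  proof (intro sum.cong refl)
    fix a assume a: "a \<in> R0"
    have "int p dvd a - b \<longleftrightarrow> a = b mod int p"
      using a by (auto simp: mod_eq_dvd_iff[symmetric])
    then show "complex_of_real (saw a) * (\<Sum>k\<in>R0. add_char p (k * (a - b)))
      = (if a = b mod int p then of_nat p * complex_of_real (saw a) else 0)"
      by (simp add: sum_add_char_mult[OF p_pos])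
  qed
  also have "\<dots> = of_nat p * complex_of_real (saw (b mod int p))"
    using p_pos by simp
  also have "saw (b mod int p) = saw b"
    by (rule residue_periodicD[OF saw_periodic]) simp
  finally show ?thesis by simp
qed

text \<open>Fourier inversion of one of the two sawtooth factors turns the other into its transform.
  The factor 1/4 is (-i/2)^2 times the sign from the oddness of \<open>ct\<close>.\<close>

lemma dedekind_sum_cot: "4 * real p * dedekind_sum h p = (\<Sum>k\<in>R1. ct k * ct (k * h))"
proof -
  have "of_nat p * complex_of_real (dedekind_sum h p)
     = (\<Sum>a\<in>R0. complex_of_real (saw a) * (of_nat p * complex_of_real (saw (a * h))))"
    by (simp add: dedekind_sum_saw sum_distrib_left mult_ac)
  also have "\<dots> = (\<Sum>a\<in>R0. \<Sum>k\<in>R0. saw_hat k * (complex_of_real (saw a) * add_char p (a * - (k * h))))"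
    by (simp add: saw_inversion sum_distrib_left mult_ac)
  also have "\<dots> = (\<Sum>k\<in>R0. saw_hat k * saw_hat (- (k * h)))"
    by (subst sum.swap) (simp add: sum_distrib_left saw_hat_def)
  also have "\<dots> = (\<Sum>k\<in>R0. complex_of_real (ct k * ct (k * h)) / 4)"
    by (simp add: saw_hat_eq ct_minus mult_ac)
  also have "\<dots> = complex_of_real (\<Sum>k\<in>R0. ct k * ct (k * h)) / 4"
    by (simp add: sum_divide_distrib)
  finally have "complex_of_real (4 * real p * dedekind_sum h p) = complex_of_real (\<Sum>k\<in>R0. ct k * ct (k * h))"
    by (simp add: mult_ac)
  then have "4 * real p * dedekind_sum h p = (\<Sum>k\<in>R0. ct k * ct (k * h))"
    using of_real_eq_iff by blast
  also have "\<dots> = (\<Sum>k\<in>R1. ct k * ct (k * h))"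
    by (simp add: sum_residues_split0[OF p_pos] ct_def cot_def)
  finally show ?thesis .
qed

end

section \<open>Quadruples of symmetric residues\<close>

text \<open>The factors are exchanged one at a time; each exchange costs at most 1 and keeps three
  bounded factors.\<close>

lemma abs_prod4_diff_le:
  fixes a b c d a' b' c' d' :: real
  assumes "\<bar>a\<bar> \<le> A" "\<bar>b\<bar> \<le> B" "\<bar>c\<bar> \<le> C" "\<bar>a' \<bar> \<le> A" "\<bar>b'\<bar> \<le> B" "\<bar>c'\<bar> \<le> C" "\<bar>d'\<bar> \<le> D"
    and "\<bar>a - a'\<bar> \<le> 1" "\<bar>b - b'\<bar> \<le> 1" "\<bar>c - c'\<bar> \<le> 1" "\<bar>d - d'\<bar> \<le> 1"
  shows "\<bar>a * b * c * d - a' * b' * c' * d'\<bar> \<le> B * C * D + A * C * D + A * B * D + A * B * C"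
proof -
  have "a * b * c * d - a' * b' * c' * d'
     = (a - a') * b' * c' * d' + a * (b - b') * c' * d' + a * b * (c - c') * d' + a * b * c * (d - d')"
    by (simp add: algebra_simps)
  also have "\<bar>\<dots>\<bar> \<le> \<bar>(a - a') * b' * c' * d'\<bar> + \<bar>a * (b - b') * c' * d'\<bar> + \<bar>a * b * (c - c') * d'\<bar> + \<bar>a * b * c * (d - d')\<bar>"
    by linarith
  also have "\<dots> \<le> 1 * B * C * D + A * 1 * C * D + A * B * 1 * D + A * B * C * 1"
  proof -
    have nn: "0 \<le> A" "0 \<le> B" "0 \<le> C" "0 \<le> D"
      using assms(1,2,3,7) by linarith+
    have prod4: "\<bar>w * x * y * z\<bar> \<le> W * X * Y * Z"
      if "\<bar>w\<bar> \<le> W" "\<bar>x\<bar> \<le> X" "\<bar>y\<bar> \<le> Y" "\<bar>z\<bar> \<le> Z" "0 \<le> W" "0 \<le> X" "0 \<le> Y" "0 \<le> Z"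
      for w x y z W X Y Z :: real
      unfolding abs_mult using that by (intro mult_mono) auto
    show ?thesis
      using prod4[OF assms(8,5,6,7)] prod4[OF assms(1,9,6,7)] prod4[OF assms(1,2,10,7)] prod4[OF assms(1,2,3,11)] nn
      by linarith
  qed
  finally show ?thesis by simp
qed

lemma harm_le_ln: "n > 0 \<Longrightarrow> harm n \<le> 1 + ln (real n)"
  using euler_mascheroni_sequence_decreasing[of 1 n] by (simp add: harm_expand)

lemma card_int_divisors_le:
  fixes n :: int
  assumes "n \<noteq> 0"
  shows "card {l. l dvd n} \<le> 2 * card {d :: nat. d dvd nat \<bar>n\<bar>}" "finite {l. l dvd n}"
proof -
  let ?D = "{d :: nat. d dvd nat \<bar>n\<bar>}"
  have fin: "finite ?D" using assms by (intro finite_divisors_nat) simp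
  have sub: "{l. l dvd n} \<subseteq> int ` ?D \<union> (\<lambda>d. - int d) ` ?D"
  proof
    fix l assume l: "l \<in> {l. l dvd n}"
    then have "nat \<bar>l\<bar> \<in> ?D" by (simp add: nat_dvd_iff)
    moreover have "l = int (nat \<bar>l\<bar>) \<or> l = - int (nat \<bar>l\<bar>)" by linarith
    ultimately show "l \<in> int ` ?D \<union> (\<lambda>d. - int d) ` ?D" by blast
  qed
  then show "finite {l. l dvd n}" using fin by (meson finite_UnI finite_imageI finite_subset)
  have "card {l. l dvd n} \<le> card (int ` ?D \<union> (\<lambda>d. - int d) ` ?D)"
    using sub fin by (intro card_mono) auto
  also have "\<dots> \<le> card (int ` ?D) + card ((\<lambda>d. - int d) ` ?D)" by (rule card_Un_le)
  also have "\<dots> \<le> card ?D + card ?D" using fin by (intro add_mono card_image_le)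
  finally show "card {l. l dvd n} \<le> 2 * card ?D" by simp
qed

text \<open>Representatives of least absolute value are used because cot (pi k / p) stays within 1
  of p / (pi k) when |k| < p/2.\<close>

definition sym_interval :: "nat \<Rightarrow> int set" where
  "sym_interval n = {- int n..int n} - {0}"

lemma finite_sym_interval [simp]: "finite (sym_interval n)" by (simp add: sym_interval_def)

lemma sum_sym_interval:
  fixes f :: "int \<Rightarrow> 'a :: comm_monoid_add"
  shows "(\<Sum>k\<in>sym_interval n. f k) = (\<Sum>k=1..n. f (int k) + f (- int k))"
proof -
  have "sym_interval n = int ` {1..n} \<union> (\<lambda>k. - int k) ` {1..n}"
  proof (intro equalityI subsetI)
    fix k assume k: "k \<in> sym_interval n"
    then have "nat \<bar>k\<bar> \<in> {1..n}" "k = int (nat \<bar>k\<bar>) \<or> k = - int (nat \<bar>k\<bar>)"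
      by (auto simp: sym_interval_def)
    then show "k \<in> int ` {1..n} \<union> (\<lambda>k. - int k) ` {1..n}" by blast
  qed (auto simp: sym_interval_def)
  moreover have "int ` {1..n} \<inter> (\<lambda>k. - int k) ` {1..n} = {}" by auto
  ultimately have "(\<Sum>k\<in>sym_interval n. f k) = (\<Sum>k\<in>int ` {1..n}. f k) + (\<Sum>k\<in>(\<lambda>k. - int k) ` {1..n}. f k)"
    by (simp add: sum.union_disjoint)
  also have "(\<Sum>k\<in>int ` {1..n}. f k) = (\<Sum>k=1..n. f (int k))"
    by (subst sum.reindex) auto
  also have "(\<Sum>k\<in>(\<lambda>k. - int k) ` {1..n}. f k) = (\<Sum>k=1..n. f (- int k))"
    by (subst sum.reindex) (auto simp: inj_on_def)
  finally show ?thesis by (simp add: sum.distrib)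
qed

lemma sum_inverse_sym_interval: "(\<Sum>k\<in>sym_interval n. 1 / \<bar>real_of_int k\<bar>) = 2 * harm n"
  by (simp add: sum_sym_interval harm_def inverse_eq_divide sum_distrib_left)

text \<open>Of the sixteen sign patterns, eight respect k l' = l k'. For these the denominator
  equals (k l')^2 and is positive, so all eight contribute equally.\<close>

lemma sum_diag_sym_interval:
  "(\<Sum>k\<in>sym_interval n. \<Sum>k'\<in>sym_interval n. \<Sum>l\<in>sym_interval n. \<Sum>l'\<in>sym_interval n.
      if k * l' = l * k' then 1 / (real_of_int k * real_of_int l * real_of_int k' * real_of_int l') else 0)
    = 8 * ratio_sum n"
proof -
  define t :: "int \<Rightarrow> int \<Rightarrow> int \<Rightarrow> int \<Rightarrow> real" where
    "t k k' l l' = (if k * l' = l * k' then 1 / (real_of_int k * real_of_int l * real_of_int k' * real_of_int l') else 0)"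
    for k k' l l'
  have 8: "(\<Sum>a\<in>{k, - k}. \<Sum>b\<in>{k', - k'}. \<Sum>c\<in>{l, - l}. \<Sum>d\<in>{l', - l'}. t a b c d) = 8 * t k k' l l'"
    if pos: "k > 0" "k' > 0" "l > 0" "l' > 0" for k k' l l'
  proof -
    have ne: "k \<noteq> - k" "k' \<noteq> - k'" "l \<noteq> - l" "l' \<noteq> - l'" using pos by auto
    have "k * l' > 0" "l * k' > 0" using pos by auto
    then have "- (k * l') \<noteq> l * k'" "k * l' \<noteq> - (l * k')" by linarith+
    then show ?thesis using ne by (simp add: t_def)
  qed
  have "(\<Sum>k\<in>sym_interval n. \<Sum>k'\<in>sym_interval n. \<Sum>l\<in>sym_interval n. \<Sum>l'\<in>sym_interval n. t k k' l l')
    = (\<Sum>k=1..n. \<Sum>k'=1..n. \<Sum>l=1..n. \<Sum>l'=1..n.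
        \<Sum>a\<in>{int k, - int k}. \<Sum>b\<in>{int k', - int k'}. \<Sum>c\<in>{int l, - int l}. \<Sum>d\<in>{int l', - int l'}. t a b c d)"
    by (simp add: sum_sym_interval sum.distrib)
  also have "\<dots> = (\<Sum>k=1..n. \<Sum>k'=1..n. \<Sum>l=1..n. \<Sum>l'=1..n. 8 * t (int k) (int k') (int l) (int l'))"
    by (intro sum.cong refl 8) auto
  also have "\<dots> = 8 * ratio_sum n"
    unfolding ratio_sum_def sum_distrib_left t_def
    by (intro sum.cong refl) (auto simp flip: of_nat_mult)
  finally show ?thesis unfolding t_def .
qed

context prime_3_mod_4 begin

definition P :: nat where "P = (p - 1) div 2"

abbreviation J :: "int set" where "J \<equiv> sym_interval P"

lemma p_eq: "2 * int P + 1 = int p" using p_mod_4 unfolding P_def by presburger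

lemma mem_J: "k \<in> J \<longleftrightarrow> k \<noteq> 0 \<and> 2 * \<bar>k\<bar> < int p"
  using p_eq by (auto simp: sym_interval_def)

lemma J_not_dvd:
  assumes "k \<in> J"
  shows "\<not> int p dvd k"
proof
  assume "int p dvd k"
  then have "int p \<le> \<bar>k\<bar>"
    using assms zdvd_imp_le[of "int p" "\<bar>k\<bar>"] by (simp add: mem_J)
  then show False using assms unfolding mem_J by linarith
qed

lemma J_unique:
  assumes "x \<in> J" "y \<in> J" "int p dvd x - y"
  shows "x = y"
proof (rule ccontr)
  assume "x \<noteq> y"
  then have "int p \<le> \<bar>x - y\<bar>" using zdvd_imp_le[of "int p" "\<bar>x - y\<bar>"] assms by simp
  then show False using assms(1,2) unfolding mem_J by linarith
qed

lemma mod_R1: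
  assumes "\<not> int p dvd z"
  shows "z mod int p \<in> R1"
proof -
  have "z mod int p \<noteq> 0" "z mod int p \<ge> 0" "z mod int p < int p"
    using assms p_pos by (auto simp: dvd_eq_mod_eq_0)
  then show ?thesis by auto
qed

lemma center_R1: "y \<in> R1 \<Longrightarrow> (if y \<le> int P then y else y - int p) \<in> J"
  using p_eq by (auto simp: mem_J)

lemma J_exists:
  assumes "\<not> int p dvd z"
  obtains x where "x \<in> J" "[x = z] (mod int p)"
proof -
  define y where "y = z mod int p"
  have y: "y \<in> R1" using mod_R1[OF assms] by (simp add: y_def)
  have yz: "[y = z] (mod int p)" by (simp add: y_def)
  have "[y - int p = z] (mod int p)" using yz by (simp add: cong_def)
  then show thesis using that[of "if y \<le> int P then y else y - int p"] center_R1[OF y] yz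
    by (simp split: if_splits)
qed

lemma sum_R1_eq_sum_J:
  fixes f :: "int \<Rightarrow> 'a :: comm_monoid_add"
  assumes f: "residue_periodic p f"
  shows "(\<Sum>x\<in>R1. f x) = (\<Sum>x\<in>J. f x)"
proof (rule sum.reindex_bij_witness[of _ "\<lambda>x. x mod int p" "\<lambda>x. if x \<le> int P then x else x - int p"])
  fix x assume x: "x \<in> J"
  have m: "x mod int p \<in> R1"
    using J_not_dvd[OF x] by (rule mod_R1)
  then show "x mod int p \<in> R1" .
  show "(if x mod int p \<le> int P then x mod int p else x mod int p - int p) = x"
    (is "?y = x")
  proof (rule J_unique)
    show "?y \<in> J" by (rule center_R1[OF m])
    have "[x mod int p - int p = x] (mod int p)" by (simp add: cong_def)
    then show "int p dvd ?y - x" by (auto simp: cong_iff_dvd_diff[symmetric])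
  qed (rule x)
next
  fix x assume x: "x \<in> R1"
  show "(if x \<le> int P then x else x - int p) mod int p = x" using x by auto
  show "(if x \<le> int P then x else x - int p) \<in> J" by (rule center_R1[OF x])
  show "f (if x \<le> int P then x else x - int p) = f x"
    by (intro residue_periodicD[OF f]) (auto simp: cong_def)
qed

lemma ct_mult_periodic: "residue_periodic p (\<lambda>k. ct k * ct (k * h))"
  by (rule residue_periodicI, intro arg_cong2[of _ _ _ _ "(*)"] residue_periodicD[OF ct_periodic] cong_mult) auto

text \<open>Squaring \<open>dedekind_sum_cot\<close> leaves the correlation over u of ct (k u) and
  ct (l u). Recording u through k' = k u and l' = l u mod p gives k l' = l k' mod p, and every such
  pair (k', l') comes from exactly one u.\<close>

lemma sum_dedekind_sum_square:
  "16 * real p ^ 2 * (\<Sum>u\<in>R1. (dedekind_sum u p)\<^sup>2) =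
    (\<Sum>k\<in>J. \<Sum>k'\<in>J. \<Sum>l\<in>J. \<Sum>l'\<in>J. if int p dvd k * l' - l * k' then ct k * ct k' * ct l * ct l' else 0)"
proof -
  have last: "(\<Sum>u\<in>R1. ct (k * u) * ct (l * u))
      = (\<Sum>k'\<in>J. \<Sum>l'\<in>J. if int p dvd k * l' - l * k' then ct k' * ct l' else 0)"
    if k: "k \<in> J" and l: "l \<in> J" for k l
  proof -
    obtain m where m: "[k * m = 1] (mod int p)"
      using cong_solve_coprime_int[of k "int p"] J_not_dvd[OF k] coprime_iff by auto
    have cop: "coprime m (int p)"
      using m by (metis coprime_iff_invertible_int mult.commute)
    have mnd: "\<not> int p dvd m" using cop coprime_iff by simp
    have per: "residue_periodic p (\<lambda>u. ct (k * u) * ct (l * u))"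
      by (rule residue_periodicI, intro arg_cong2[of _ _ _ _ "(*)"] residue_periodicD[OF ct_periodic] cong_mult) auto
    have per': "residue_periodic p (\<lambda>u. ct (k * (m * u)) * ct (l * (m * u)))"
      by (rule residue_periodicI, intro arg_cong2[of _ _ _ _ "(*)"] residue_periodicD[OF ct_periodic] cong_mult) auto
    \<comment> \<open>As \<open>m\<close> inverts k, the new summation variable is the residue k u
      itself; it is next moved into \<open>J\<close> and called k'.\<close>
    have "(\<Sum>u\<in>R1. ct (k * u) * ct (l * u)) = (\<Sum>u\<in>R1. ct (k * (m * u)) * ct (l * (m * u)))"
      using sum_nonzero_residues_mult[OF per p_pos cop] by simp
    also have "\<dots> = (\<Sum>k'\<in>J. ct (k * (m * k')) * ct (l * (m * k')))"
      by (rule sum_R1_eq_sum_J[OF per'])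
    also have "\<dots> = (\<Sum>k'\<in>J. \<Sum>l'\<in>J. if int p dvd k * l' - l * k' then ct k' * ct l' else 0)"
    proof (rule sum.cong[OF refl])
      fix k' assume k': "k' \<in> J"
      have "\<not> int p dvd l * (m * k')"
        using J_not_dvd[OF l] J_not_dvd[OF k'] mnd by (simp add: dvd_mult_iff)
      then obtain x where x: "x \<in> J" "[x = l * (m * k')] (mod int p)" by (rule J_exists)
      have "[k * (m * k') = 1 * k'] (mod int p)"
        using m by (simp only: mult.assoc[symmetric]) (intro cong_mult, auto)
      then have ck: "ct (k * (m * k')) = ct k'"
        using residue_periodicD[OF ct_periodic] by simp
      have "[k * x = k * (l * (m * k'))] (mod int p)" using x by (intro cong_mult) auto
      also have "k * (l * (m * k')) = (k * m) * (l * k')" by simp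
      also have "[(k * m) * (l * k') = 1 * (l * k')] (mod int p)" using m by (intro cong_mult) auto
      finally have kx: "int p dvd k * x - l * k'" by (simp add: cong_iff_dvd_diff)
      have iff: "int p dvd k * l' - l * k' \<longleftrightarrow> l' = x" if "l' \<in> J" for l'
      proof
        assume "int p dvd k * l' - l * k'"
        then have "int p dvd (k * l' - l * k') - (k * x - l * k')" using kx by (rule dvd_diff)
        also have "(k * l' - l * k') - (k * x - l * k') = k * (l' - x)" by (simp add: algebra_simps)
        finally show "l' = x" using J_not_dvd[OF k] J_unique[OF that x(1)] by (simp add: dvd_mult_iff)
      qed (use kx in simp)
      have "(\<Sum>l'\<in>J. if int p dvd k * l' - l * k' then ct k' * ct l' else 0)
         = (\<Sum>l'\<in>J. if l' = x then ct k' * ct l' else 0)"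
        by (rule sum.cong[OF refl]) (simp add: iff)
      also have "\<dots> = ct k' * ct x" using x by simp
      also have "ct x = ct (l * (m * k'))" using residue_periodicD[OF ct_periodic x(2)] .
      finally show "ct (k * (m * k')) * ct (l * (m * k'))
         = (\<Sum>l'\<in>J. if int p dvd k * l' - l * k' then ct k' * ct l' else 0)" using ck by simp
    qed
    finally show ?thesis .
  qed
  have "16 * real p ^ 2 * (\<Sum>u\<in>R1. (dedekind_sum u p)\<^sup>2) = (\<Sum>u\<in>R1. (4 * real p * dedekind_sum u p)\<^sup>2)"
    by (simp add: sum_distrib_left power_mult_distrib)
  also have "\<dots> = (\<Sum>u\<in>R1. (\<Sum>k\<in>J. ct k * ct (k * u))\<^sup>2)"
    by (simp add: dedekind_sum_cot sum_R1_eq_sum_J[OF ct_mult_periodic])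
  also have "\<dots> = (\<Sum>u\<in>R1. \<Sum>k\<in>J. \<Sum>l\<in>J. ct k * ct l * (ct (k * u) * ct (l * u)))"
    by (simp add: power2_eq_square sum_product mult_ac)
  also have "\<dots> = (\<Sum>k\<in>J. \<Sum>u\<in>R1. \<Sum>l\<in>J. ct k * ct l * (ct (k * u) * ct (l * u)))"
    by (rule sum.swap)
  also have "\<dots> = (\<Sum>k\<in>J. \<Sum>l\<in>J. \<Sum>u\<in>R1. ct k * ct l * (ct (k * u) * ct (l * u)))"
    by (rule sum.cong[OF refl], rule sum.swap)
  also have "\<dots> = (\<Sum>k\<in>J. \<Sum>l\<in>J. ct k * ct l * (\<Sum>k'\<in>J. \<Sum>l'\<in>J. if int p dvd k * l' - l * k' then ct k' * ct l' else 0))"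
    by (intro sum.cong refl) (simp add: sum_distrib_left[symmetric] last)
  also have "\<dots> = (\<Sum>k\<in>J. \<Sum>l\<in>J. \<Sum>k'\<in>J. \<Sum>l'\<in>J. if int p dvd k * l' - l * k' then ct k * ct k' * ct l * ct l' else 0)"
    unfolding sum_distrib_left by (intro sum.cong refl) simp
  also have "\<dots> = (\<Sum>k\<in>J. \<Sum>k'\<in>J. \<Sum>l\<in>J. \<Sum>l'\<in>J. if int p dvd k * l' - l * k' then ct k * ct k' * ct l * ct l' else 0)"
    by (rule sum.cong[OF refl], rule sum.swap)
  finally show ?thesis .
qed

lemma ct_bounds:
  assumes k: "k \<in> J"
  shows "\<bar>ct k\<bar> \<le> real p / \<bar>real_of_int k\<bar>" "\<bar>real p / (pi * real_of_int k)\<bar> \<le> real p / \<bar>real_of_int k\<bar>"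
    "\<bar>ct k - real p / (pi * real_of_int k)\<bar> \<le> 1"
proof -
  have pos: "\<bar>ct k\<bar> \<le> real p / \<bar>real_of_int k\<bar> \<and> \<bar>real p / (pi * real_of_int k)\<bar> \<le> real p / \<bar>real_of_int k\<bar> \<and>
    \<bar>ct k - real p / (pi * real_of_int k)\<bar> \<le> 1" if k: "0 < k" "k \<le> int P" for k
  proof -
    define x where "x = pi * real_of_int k / real p"
    have x0: "0 < x" using k p_pos by (simp add: x_def)
    have "real_of_int (2 * k) \<le> real_of_int (int p)" using k p_eq by (intro of_int_le_iff[THEN iffD2]) linarith
    then have "2 * real_of_int k \<le> real p" by simp
    then have "x \<le> pi / 2" using p_pos by (simp add: x_def field_simps)
    note b = cot_bounds[OF x0 this]
    have inv: "1 / x = real p / (pi * real_of_int k)" by (simp add: x_def)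
    have "real p / (pi * real_of_int k) \<le> real p / (1 * real_of_int k)"
      using k pi_gt3 p_pos by (intro divide_left_mono mult_right_mono mult_pos_pos) auto
    then show ?thesis using b k unfolding inv[symmetric] ct_def x_def[symmetric] by (auto simp: inv)
  qed
  show "\<bar>ct k\<bar> \<le> real p / \<bar>real_of_int k\<bar>" "\<bar>real p / (pi * real_of_int k)\<bar> \<le> real p / \<bar>real_of_int k\<bar>"
    "\<bar>ct k - real p / (pi * real_of_int k)\<bar> \<le> 1"
  proof -
    have "0 < k \<and> k \<le> int P \<or> 0 < - k \<and> - k \<le> int P"
      using k by (auto simp: sym_interval_def)
    then have "\<bar>ct k\<bar> \<le> real p / \<bar>real_of_int k\<bar> \<and> \<bar>real p / (pi * real_of_int k)\<bar> \<le> real p / \<bar>real_of_int k\<bar> \<and>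
      \<bar>ct k - real p / (pi * real_of_int k)\<bar> \<le> 1"
    proof
      assume "0 < - k \<and> - k \<le> int P"
      then have "\<bar>ct (- k)\<bar> \<le> real p / \<bar>real_of_int (- k)\<bar> \<and>
          \<bar>real p / (pi * real_of_int (- k))\<bar> \<le> real p / \<bar>real_of_int (- k)\<bar> \<and>
          \<bar>ct (- k) - real p / (pi * real_of_int (- k))\<bar> \<le> 1"
        using pos[of "- k"] by blast
      moreover have "\<bar>ct (- k) - real p / (pi * real_of_int (- k))\<bar> = \<bar>ct k - real p / (pi * real_of_int k)\<bar>"
        by (simp add: ct_minus abs_minus_commute)
      ultimately show ?thesis by (simp add: ct_minus)
    qed (use pos in blast)
    then show "\<bar>ct k\<bar> \<le> real p / \<bar>real_of_int k\<bar>" "\<bar>real p / (pi * real_of_int k)\<bar> \<le> real p / \<bar>real_of_int k\<bar>"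
      "\<bar>ct k - real p / (pi * real_of_int k)\<bar> \<le> 1" by blast+
  qed
qed

end

section \<open>Splitting the quadruples: diagonal, cotangent error, off-diagonal\<close>

definition inv_abs :: "int \<Rightarrow> real" where "inv_abs k = 1 / \<bar>real_of_int k\<bar>"

lemma inv_abs_nonneg [simp]: "inv_abs k \<ge> 0" by (simp add: inv_abs_def)

lemma inv_abs_mult: "inv_abs (j * k) = inv_abs j * inv_abs k" by (simp add: inv_abs_def abs_mult)

lemma sum_inv_abs_sym_interval: "(\<Sum>k\<in>sym_interval n. inv_abs k) = 2 * harm n"
  unfolding inv_abs_def by (rule sum_inverse_sym_interval)

text \<open>The triangle inequality |a - b| \<le> |a| + |b| divided by |a b (a - b)|. With a = k l'
  and b = l k' it trades one product for the difference, a nonzero multiple of p off the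
  diagonal.\<close>

lemma inv_abs_mult_le:
  assumes "a \<noteq> 0" "b \<noteq> 0" "a \<noteq> b"
  shows "inv_abs a * inv_abs b \<le> inv_abs a * inv_abs (a - b) + inv_abs b * inv_abs (a - b)"
proof -
  define x y where "x = \<bar>real_of_int a\<bar>" and "y = \<bar>real_of_int b\<bar>"
  define z where "z = \<bar>real_of_int (a - b)\<bar>"
  have pos: "x > 0" "y > 0" "z > 0" using assms by (auto simp: x_def y_def z_def)
  have "z \<le> x + y" unfolding x_def y_def z_def by simp
  then have "z / (x * y * z) \<le> (x + y) / (x * y * z)"
    using pos by (intro divide_right_mono) auto
  then have "1 / x * (1 / y) \<le> 1 / x * (1 / z) + 1 / y * (1 / z)"
    using pos by (simp add: field_simps)
  then show ?thesis by (simp only: inv_abs_def x_def y_def z_def)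
qed

lemma sum_quadruples:
  fixes f :: "'a \<Rightarrow> 'a \<Rightarrow> 'a \<Rightarrow> 'a \<Rightarrow> 'b :: comm_monoid_add"
  assumes "finite A"
  shows "(\<Sum>k\<in>A. \<Sum>k'\<in>A. \<Sum>l\<in>A. \<Sum>l'\<in>A. if R k k' l l' then f k k' l l' else 0)
    = (\<Sum>(k, k', l, l')\<in>{(k, k', l, l'). k \<in> A \<and> k' \<in> A \<and> l \<in> A \<and> l' \<in> A \<and> R k k' l l'}. f k k' l l')"
proof -
  have "(\<Sum>k\<in>A. \<Sum>k'\<in>A. \<Sum>l\<in>A. \<Sum>l'\<in>A. if R k k' l l' then f k k' l l' else 0)
    = (\<Sum>(k, k', l, l')\<in>A \<times> A \<times> A \<times> A. if R k k' l l' then f k k' l l' else 0)"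
    by (simp add: sum.cartesian_product)
  also have "\<dots> = (\<Sum>(k, k', l, l')\<in>{(k, k', l, l'). k \<in> A \<and> k' \<in> A \<and> l \<in> A \<and> l' \<in> A \<and> R k k' l l'}. f k k' l l')"
    using assms by (intro sum.mono_neutral_cong_right) (auto split: if_splits)
  finally show ?thesis .
qed

context prime_3_mod_4 begin

definition Quad :: "(int \<times> int \<times> int \<times> int) set" where
  "Quad = {(k, k', l, l'). k \<in> J \<and> k' \<in> J \<and> l \<in> J \<and> l' \<in> J \<and> int p dvd k * l' - l * k'}"

definition Diag :: "(int \<times> int \<times> int \<times> int) set" where
  "Diag = {(k, k', l, l'). k \<in> J \<and> k' \<in> J \<and> l \<in> J \<and> l' \<in> J \<and> k * l' = l * k'}"

lemma finite_Quad [simp]: "finite Quad"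
  by (rule finite_subset[of _ "J \<times> J \<times> J \<times> J"]) (auto simp: Quad_def)

lemma Diag_subset: "Diag \<subseteq> Quad" by (auto simp: Diag_def Quad_def)

text \<open>Three coordinates of a quadruple determine the fourth, so a weight in three coordinates
  is bounded by a free triple sum, the cube of 2 \<open>harm P\<close>.\<close>

lemma sum_Quad_projection_le:
  assumes inj: "inj_on \<pi> Quad" and im: "\<pi> ` Quad \<subseteq> J \<times> J \<times> J"
  shows "(\<Sum>q\<in>Quad. case \<pi> q of (x, y, z) \<Rightarrow> inv_abs x * inv_abs y * inv_abs z) \<le> 8 * harm P ^ 3"
proof -
  have "(\<Sum>q\<in>Quad. case \<pi> q of (x, y, z) \<Rightarrow> inv_abs x * inv_abs y * inv_abs z) = (\<Sum>(x, y, z)\<in>\<pi> ` Quad. inv_abs x * inv_abs y * inv_abs z)"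
    using inj by (simp add: sum.reindex)
  also have "\<dots> \<le> (\<Sum>(x, y, z)\<in>J \<times> J \<times> J. inv_abs x * inv_abs y * inv_abs z)"
    using im by (intro sum_mono2) auto
  also have "\<dots> = (\<Sum>x\<in>J. inv_abs x) * (\<Sum>y\<in>J. inv_abs y) * (\<Sum>z\<in>J. inv_abs z)"
    by (simp add: sum.cartesian_product[symmetric] sum_product sum_distrib_left sum_distrib_right mult_ac)
  finally show ?thesis by (simp add: sum_inv_abs_sym_interval power3_eq_cube)
qed

text \<open>Two quadruples agreeing in three coordinates have determinants d, e whose difference is
  c times the difference of the remaining coordinates, with c invertible mod p.\<close>

lemma J_cancel:
  assumes "c \<in> J" "x \<in> J" "y \<in> J" "int p dvd d" "int p dvd e" "d - e = c * (x - y)"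
  shows "x = y"
proof -
  have "int p dvd c * (x - y)" using assms by (metis dvd_diff)
  then show ?thesis using assms J_not_dvd J_unique by (auto simp: dvd_mult_iff)
qed

lemma sum_Quad_three_le:
  "(\<Sum>(k, k', l, l')\<in>Quad. inv_abs k' * inv_abs l * inv_abs l' + inv_abs k * inv_abs l * inv_abs l' + inv_abs k * inv_abs k' * inv_abs l' + inv_abs k * inv_abs k' * inv_abs l)
    \<le> 32 * harm P ^ 3"
proof -
  have 1: "(\<Sum>(k, k', l, l')\<in>Quad. inv_abs k' * inv_abs l * inv_abs l') \<le> 8 * harm P ^ 3"
  proof -
    have "inj_on (\<lambda>(k, k', l, l'). (k', l, l')) Quad"
    proof (rule inj_onI)
      fix q r assume qr: "q \<in> Quad" "r \<in> Quad"
        and eq: "(case q of (k, k', l, l') \<Rightarrow> (k', l, l')) = (case r of (k, k', l, l') \<Rightarrow> (k', l, l'))"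
      obtain k k' l l' j where q: "q = (k, k', l, l')" "r = (j, k', l, l')"
        using eq by (cases q; cases r) auto
      have "k = j"
        using qr unfolding q
        by (intro J_cancel[of l' k j "k * l' - l * k'" "j * l' - l * k'"]) (auto simp: Quad_def algebra_simps)
      then show "q = r" using q by simp
    qed
    from sum_Quad_projection_le[OF this] show ?thesis
      by (simp add: case_prod_unfold) (force simp: Quad_def)
  qed
  have 2: "(\<Sum>(k, k', l, l')\<in>Quad. inv_abs k * inv_abs l * inv_abs l') \<le> 8 * harm P ^ 3"
  proof -
    have "inj_on (\<lambda>(k, k', l, l'). (k, l, l')) Quad"
    proof (rule inj_onI)
      fix q r assume qr: "q \<in> Quad" "r \<in> Quad"
        and eq: "(case q of (k, k', l, l') \<Rightarrow> (k, l, l')) = (case r of (k, k', l, l') \<Rightarrow> (k, l, l'))"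
      obtain k k' l l' j where q: "q = (k, k', l, l')" "r = (k, j, l, l')"
        using eq by (cases q; cases r) auto
      have "k' = j"
        using qr unfolding q
        by (intro J_cancel[of l k' j "k * l' - l * j" "k * l' - l * k'"]) (auto simp: Quad_def algebra_simps)
      then show "q = r" using q by simp
    qed
    from sum_Quad_projection_le[OF this] show ?thesis
      by (simp add: case_prod_unfold) (force simp: Quad_def)
  qed
  have 3: "(\<Sum>(k, k', l, l')\<in>Quad. inv_abs k * inv_abs k' * inv_abs l') \<le> 8 * harm P ^ 3"
  proof -
    have "inj_on (\<lambda>(k, k', l, l'). (k, k', l')) Quad"
    proof (rule inj_onI)
      fix q r assume qr: "q \<in> Quad" "r \<in> Quad"
        and eq: "(case q of (k, k', l, l') \<Rightarrow> (k, k', l')) = (case r of (k, k', l, l') \<Rightarrow> (k, k', l'))"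
      obtain k k' l l' j where q: "q = (k, k', l, l')" "r = (k, k', j, l')"
        using eq by (cases q; cases r) auto
      have "l = j"
        using qr unfolding q
        by (intro J_cancel[of k' l j "k * l' - j * k'" "k * l' - l * k'"]) (auto simp: Quad_def algebra_simps)
      then show "q = r" using q by simp
    qed
    from sum_Quad_projection_le[OF this] show ?thesis
      by (simp add: case_prod_unfold) (force simp: Quad_def)
  qed
  have 4: "(\<Sum>(k, k', l, l')\<in>Quad. inv_abs k * inv_abs k' * inv_abs l) \<le> 8 * harm P ^ 3"
  proof -
    have "inj_on (\<lambda>(k, k', l, l'). (k, k', l)) Quad"
    proof (rule inj_onI)
      fix q r assume qr: "q \<in> Quad" "r \<in> Quad"
        and eq: "(case q of (k, k', l, l') \<Rightarrow> (k, k', l)) = (case r of (k, k', l, l') \<Rightarrow> (k, k', l))"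
      obtain k k' l l' j where q: "q = (k, k', l, l')" "r = (k, k', l, j)"
        using eq by (cases q; cases r) auto
      have "l' = j"
        using qr unfolding q
        by (intro J_cancel[of k l' j "k * l' - l * k'" "k * j - l * k'"]) (auto simp: Quad_def algebra_simps)
      then show "q = r" using q by simp
    qed
    from sum_Quad_projection_le[OF this] show ?thesis
      by (simp add: case_prod_unfold) (force simp: Quad_def)
  qed
  show ?thesis using 1 2 3 4 by (simp add: case_prod_unfold sum.distrib)
qed

definition inv4 :: "int \<times> int \<times> int \<times> int \<Rightarrow> real" where
  "inv4 = (\<lambda>(k, k', l, l'). 1 / (real_of_int k * real_of_int l * real_of_int k' * real_of_int l'))"

text \<open>Each cotangent is replaced by p / (pi k) with error at most 1 while the other three
  factors are bounded by p over their arguments; this leaves p^3 times the four sums of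
  \<open>sum_Quad_three_le\<close>.\<close>

lemma sum_Quad_cot_approx:
  "\<bar>16 * real p ^ 2 * (\<Sum>u\<in>R1. (dedekind_sum u p)\<^sup>2) - (real p / pi) ^ 4 * (\<Sum>q\<in>Quad. inv4 q)\<bar>
    \<le> 32 * real p ^ 3 * harm P ^ 3"
proof -
  define g where "g k = real p / (pi * real_of_int k)" for k
  have "16 * real p ^ 2 * (\<Sum>u\<in>R1. (dedekind_sum u p)\<^sup>2)
     = (\<Sum>(k, k', l, l')\<in>Quad. ct k * ct k' * ct l * ct l')"
    unfolding sum_dedekind_sum_square Quad_def by (rule sum_quadruples) simp
  moreover have "(real p / pi) ^ 4 * (\<Sum>q\<in>Quad. inv4 q) = (\<Sum>(k, k', l, l')\<in>Quad. g k * g k' * g l * g l')"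
    unfolding sum_distrib_left
    by (intro sum.cong refl) (auto simp: inv4_def g_def eval_nat_numeral mult_ac)
  ultimately have "\<bar>16 * real p ^ 2 * (\<Sum>u\<in>R1. (dedekind_sum u p)\<^sup>2) - (real p / pi) ^ 4 * (\<Sum>q\<in>Quad. inv4 q)\<bar>
     = \<bar>\<Sum>(k, k', l, l')\<in>Quad. ct k * ct k' * ct l * ct l' - g k * g k' * g l * g l'\<bar>"
    by (simp add: case_prod_unfold sum_subtractf)
  also have "\<dots> \<le> (\<Sum>(k, k', l, l')\<in>Quad. \<bar>ct k * ct k' * ct l * ct l' - g k * g k' * g l * g l'\<bar>)"
    by (simp only: case_prod_unfold sum_abs)
  also have "\<dots> \<le> (\<Sum>(k, k', l, l')\<in>Quad. real p ^ 3 *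
      (inv_abs k' * inv_abs l * inv_abs l' + inv_abs k * inv_abs l * inv_abs l' + inv_abs k * inv_abs k' * inv_abs l' + inv_abs k * inv_abs k' * inv_abs l))"
  proof (intro sum_mono, clarify)
    fix k k' l l' assume q: "(k, k', l, l') \<in> Quad"
    have b: "\<bar>ct x\<bar> \<le> real p * inv_abs x" "\<bar>g x\<bar> \<le> real p * inv_abs x" "\<bar>ct x - g x\<bar> \<le> 1" if "x \<in> J" for x
      using ct_bounds[OF that] by (simp_all add: inv_abs_def g_def)
    have J: "k \<in> J" "k' \<in> J" "l \<in> J" "l' \<in> J" using q by (auto simp: Quad_def)
    have "\<bar>ct k * ct k' * ct l * ct l' - g k * g k' * g l * g l'\<bar> \<le>
       (real p * inv_abs k') * (real p * inv_abs l) * (real p * inv_abs l') + (real p * inv_abs k) * (real p * inv_abs l) * (real p * inv_abs l')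
       + (real p * inv_abs k) * (real p * inv_abs k') * (real p * inv_abs l') + (real p * inv_abs k) * (real p * inv_abs k') * (real p * inv_abs l)"
      by (intro abs_prod4_diff_le b J)
    also have "\<dots> = real p ^ 3 *
      (inv_abs k' * inv_abs l * inv_abs l' + inv_abs k * inv_abs l * inv_abs l' + inv_abs k * inv_abs k' * inv_abs l' + inv_abs k * inv_abs k' * inv_abs l)"
      by (simp add: power3_eq_cube algebra_simps)
    finally show "\<bar>ct k * ct k' * ct l * ct l' - g k * g k' * g l * g l'\<bar> \<le> \<dots>" .
  qed
  also have "\<dots> = real p ^ 3 * (\<Sum>(k, k', l, l')\<in>Quad.
      inv_abs k' * inv_abs l * inv_abs l' + inv_abs k * inv_abs l * inv_abs l' + inv_abs k * inv_abs k' * inv_abs l' + inv_abs k * inv_abs k' * inv_abs l)"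
    by (simp add: sum_distrib_left case_prod_unfold)
  also have "\<dots> \<le> real p ^ 3 * (32 * harm P ^ 3)"
    by (intro mult_left_mono sum_Quad_three_le) auto
  finally show ?thesis by simp
qed

lemma J_prod_bound:
  assumes "x \<in> J" "y \<in> J"
  shows "4 * \<bar>x * y\<bar> \<le> (int p)\<^sup>2" "x * y \<noteq> 0"
proof -
  have "(2 * \<bar>x\<bar>) * (2 * \<bar>y\<bar>) \<le> int p * int p"
    using assms by (intro mult_mono) (auto simp: mem_J)
  then show "4 * \<bar>x * y\<bar> \<le> (int p)\<^sup>2" by (simp add: abs_mult power2_eq_square)
  show "x * y \<noteq> 0" using assms by (auto simp: mem_J)
qed

text \<open>Write k l' - l k' = p j with j nonzero. The weight depends only on (k, l', j) and
  carries the gain 1/p, while this triple fixes the product n = l k'. Hence l is a signed divisor of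
  n, with at most 2 D choices. The constant 16 is this 2 times the 2 from each of the three
  symmetric harmonic sums.\<close>

lemma sum_off_diagonal_half:
  assumes d: "\<And>n :: nat. 0 < n \<Longrightarrow> n \<le> p\<^sup>2 \<Longrightarrow> real (card {d. d dvd n}) \<le> D"
  shows "(\<Sum>(k, k', l, l')\<in>Quad - Diag. inv_abs (k * l') * inv_abs (k * l' - l * k')) \<le> 16 * D * harm P ^ 2 * harm p / real p"
proof -
  let ?T = "J \<times> J \<times> sym_interval p"
  define \<phi> where "\<phi> = (\<lambda>(k, k', l, l'). (k, l', (k * l' - l * k') div int p))"
  define F where "F = (\<lambda>(k, l', j). inv_abs k * inv_abs l' * inv_abs j / real p)"
  have D0: "D \<ge> 0" using d[of 1] p_pos by simp
  have div: "int p * ((k * l' - l * k') div int p) = k * l' - l * k'" if "(k, k', l, l') \<in> Quad" for k k' l l'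
    using that by (auto simp: Quad_def)
  have img: "\<phi> ` (Quad - Diag) \<subseteq> ?T"
  proof (rule image_subsetI)
    fix q assume "q \<in> Quad - Diag"
    then obtain k k' l l' where q_eq: "q = (k, k', l, l')"
      and q: "(k, k', l, l') \<in> Quad" "(k, k', l, l') \<notin> Diag"
      by (cases q) auto
    define j where "j = (k * l' - l * k') div int p"
    have J: "k \<in> J" "k' \<in> J" "l \<in> J" "l' \<in> J" using q by (auto simp: Quad_def)
    have ne: "k * l' - l * k' \<noteq> 0" using q J by (auto simp: Diag_def)
    have e: "int p * j = k * l' - l * k'" using div[OF q(1)] by (simp add: j_def)
    have "4 * \<bar>k * l' - l * k'\<bar> \<le> 2 * (int p)\<^sup>2"
    proof -
      have "4 * \<bar>a - b\<bar> \<le> 2 * c" if "4 * \<bar>a\<bar> \<le> c" "4 * \<bar>b\<bar> \<le> c" for a b c :: int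
        using that abs_triangle_ineq4[of a b] by simp
      then show ?thesis using J_prod_bound(1)[OF J(1,4)] J_prod_bound(1)[OF J(3,2)] by blast
    qed
    then have "4 * (int p * \<bar>j\<bar>) \<le> 2 * (int p * int p)"
      unfolding e[symmetric] by (simp add: abs_mult power2_eq_square)
    then have "4 * \<bar>j\<bar> \<le> 2 * int p" using p_pos by simp
    moreover have "j \<noteq> 0" using ne e by auto
    ultimately have "j \<in> sym_interval p" by (auto simp: sym_interval_def)
    then show "\<phi> q \<in> ?T" using J by (simp add: \<phi>_def j_def q_eq)
  qed
  have fiber: "real (card {q \<in> Quad - Diag. \<phi> q = y}) \<le> 2 * D" for y
  proof -
    obtain k l' j where y: "y = (k, l', j)" by (cases y)
    define n where "n = k * l' - int p * j"
    let ?S = "{q \<in> Quad - Diag. \<phi> q = y}"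
    have mem: "\<exists>k' l. q = (k, k', l, l') \<and> l * k' = n \<and> l \<in> J \<and> k' \<in> J" if "q \<in> ?S" for q
    proof -
      obtain k1 k' l l1 where q: "q = (k1, k', l, l1)" by (cases q)
      have "k1 = k" "l1 = l'" "(k1 * l1 - l * k') div int p = j"
        using that by (auto simp: q y \<phi>_def)
      moreover have "(k1, k', l, l1) \<in> Quad" using that q by simp
      ultimately show ?thesis using div[of k1 k' l l1] q by (auto simp: n_def Quad_def algebra_simps)
    qed
    show ?thesis
    proof (cases "?S = {}")
      case True
      then show ?thesis using D0 by (simp only: card.empty)
    next
      case False
      then obtain q0 where "q0 \<in> ?S" by blast
      then obtain k0 l0 where n: "l0 * k0 = n" "l0 \<in> J" "k0 \<in> J" using mem by blast
      have n0: "n \<noteq> 0" "4 * \<bar>n\<bar> \<le> (int p)\<^sup>2" using J_prod_bound[OF n(2,3)] n(1) by auto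
      \<comment> \<open>Within a fibre l alone identifies the quadruple, because l k' = n is nonzero
        and so k' = n / l.\<close>
      have "inj_on (\<lambda>q. fst (snd (snd q))) ?S"
      proof (rule inj_onI)
        fix q r assume "q \<in> ?S" "r \<in> ?S" and eq: "fst (snd (snd q)) = fst (snd (snd r))"
        then obtain k1 l1 k2 l2 where q: "q = (k, k1, l1, l')" "l1 * k1 = n" and r: "r = (k, k2, l2, l')" "l2 * k2 = n"
          using mem by meson
        then have "l1 * k1 = l1 * k2" using eq by simp
        then show "q = r" using q r eq n0 by auto
      qed
      moreover have "(\<lambda>q. fst (snd (snd q))) ` ?S \<subseteq> {l. l dvd n}"
      proof
        fix x assume "x \<in> (\<lambda>q. fst (snd (snd q))) ` ?S"
        then obtain q where "q \<in> ?S" "x = fst (snd (snd q))" by blast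
        then show "x \<in> {l. l dvd n}" using mem[of q] by auto
      qed
      ultimately have "card ?S \<le> card {l. l dvd n}"
        using card_inj_on_le card_int_divisors_le(2)[OF n0(1)] by blast
      also have "\<dots> \<le> 2 * card {d. d dvd nat \<bar>n\<bar>}" by (rule card_int_divisors_le(1)[OF n0(1)])
      finally have "real (card ?S) \<le> 2 * real (card {d. d dvd nat \<bar>n\<bar>})" by linarith
      moreover have "nat \<bar>n\<bar> \<le> p\<^sup>2"
      proof -
        have "\<bar>n\<bar> \<le> int (p\<^sup>2)" using n0(2) by simp
        then show ?thesis by (simp only: nat_le_iff)
      qed
      ultimately show ?thesis using d[of "nat \<bar>n\<bar>"] n0(1) by linarith
    qed
  qed
  have "(\<Sum>(k, k', l, l')\<in>Quad - Diag. inv_abs (k * l') * inv_abs (k * l' - l * k')) = (\<Sum>q\<in>Quad - Diag. F (\<phi> q))"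
  proof (intro sum.cong refl, clarify)
    fix k k' l l' assume "(k, k', l, l') \<in> Quad"
    then have "inv_abs (k * l' - l * k') = inv_abs ((k * l' - l * k') div int p) / real p"
      using inv_abs_mult[of "int p" "(k * l' - l * k') div int p"] div[of k k' l l'] by (simp add: inv_abs_def)
    then show "inv_abs (k * l') * inv_abs (k * l' - l * k') = F (\<phi> (k, k', l, l'))"
      by (simp add: F_def \<phi>_def inv_abs_mult)
  qed
  also have "\<dots> = (\<Sum>y\<in>?T. \<Sum>q\<in>{q \<in> Quad - Diag. \<phi> q = y}. F (\<phi> q))"
    using img by (intro sum.group[symmetric]) auto
  also have "\<dots> = (\<Sum>y\<in>?T. real (card {q \<in> Quad - Diag. \<phi> q = y}) * F y)"
    by (intro sum.cong refl) simp
  also have "\<dots> \<le> (\<Sum>y\<in>?T. 2 * D * F y)"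
    by (intro sum_mono mult_right_mono fiber) (auto simp: F_def)
  also have "\<dots> = 2 * D * (\<Sum>(k, l', j)\<in>?T. inv_abs k * inv_abs l' * inv_abs j) / real p"
    by (simp add: F_def sum_distrib_left sum_divide_distrib case_prod_unfold)
  also have "(\<Sum>(k, l', j)\<in>?T. inv_abs k * inv_abs l' * inv_abs j) = (\<Sum>k\<in>J. inv_abs k) * (\<Sum>k\<in>J. inv_abs k) * (\<Sum>j\<in>sym_interval p. inv_abs j)"
    by (simp add: sum.cartesian_product[symmetric] sum_product sum_distrib_left sum_distrib_right mult_ac)
  finally show ?thesis by (simp add: sum_inv_abs_sym_interval power2_eq_square mult_ac)
qed

text \<open>The two terms of \<open>inv_abs_mult_le\<close> are exchanged by swapping (k, k') with
  (l, l'), which preserves the domain; hence twice the half estimate.\<close>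

lemma sum_off_diagonal:
  assumes d: "\<And>n :: nat. 0 < n \<Longrightarrow> n \<le> p\<^sup>2 \<Longrightarrow> real (card {d. d dvd n}) \<le> D"
  shows "\<bar>\<Sum>q\<in>Quad - Diag. inv4 q\<bar> \<le> 32 * D * harm P ^ 2 * harm p / real p"
proof -
  have "\<bar>\<Sum>q\<in>Quad - Diag. inv4 q\<bar> \<le> (\<Sum>q\<in>Quad - Diag. \<bar>inv4 q\<bar>)" by (rule sum_abs)
  also have "\<dots> \<le> (\<Sum>(k, k', l, l')\<in>Quad - Diag. inv_abs (k * l') * inv_abs (k * l' - l * k') + inv_abs (l * k') * inv_abs (k * l' - l * k'))"
  proof (intro sum_mono, clarify)
    fix k k' l l' assume q: "(k, k', l, l') \<in> Quad" "(k, k', l, l') \<notin> Diag"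
    have J: "k \<in> J" "k' \<in> J" "l \<in> J" "l' \<in> J" using q by (auto simp: Quad_def)
    have "\<bar>inv4 (k, k', l, l')\<bar> = inv_abs (k * l') * inv_abs (l * k')"
      by (simp add: inv4_def inv_abs_def abs_mult mult_ac)
    also have "\<dots> \<le> inv_abs (k * l') * inv_abs (k * l' - l * k') + inv_abs (l * k') * inv_abs (k * l' - l * k')"
      by (rule inv_abs_mult_le) (use q J J_prod_bound(2) in \<open>auto simp: Diag_def mem_J\<close>)
    finally show "\<bar>inv4 (k, k', l, l')\<bar> \<le> \<dots>" .
  qed
  also have "\<dots> = (\<Sum>(k, k', l, l')\<in>Quad - Diag. inv_abs (k * l') * inv_abs (k * l' - l * k'))
      + (\<Sum>(k, k', l, l')\<in>Quad - Diag. inv_abs (l * k') * inv_abs (k * l' - l * k'))"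
    by (simp add: case_prod_unfold sum.distrib)
  also have "(\<Sum>(k, k', l, l')\<in>Quad - Diag. inv_abs (l * k') * inv_abs (k * l' - l * k'))
      = (\<Sum>(k, k', l, l')\<in>Quad - Diag. inv_abs (k * l') * inv_abs (k * l' - l * k'))"
  proof (rule sum.reindex_bij_witness[of _ "\<lambda>(k, k', l, l'). (l, l', k, k')" "\<lambda>(k, k', l, l'). (l, l', k, k')"], goal_cases)
    case (5 q)
    obtain k k' l l' where q: "q = (k, k', l, l')" by (cases q)
    have "inv_abs (l * k' - k * l') = inv_abs (k * l' - l * k')" by (simp add: inv_abs_def abs_minus_commute)
    then show ?case by (simp add: q)
  qed (auto simp: Quad_def Diag_def dvd_diff_commute)
  finally show ?thesis using sum_off_diagonal_half[OF d] by simp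
qed

lemma sum_Diag: "(\<Sum>q\<in>Diag. inv4 q) = 8 * ratio_sum P"
  unfolding sum_diag_sym_interval[symmetric] Diag_def inv4_def
  by (subst sum_quadruples) (simp_all add: case_prod_unfold)

text \<open>The diagonal gives (p/pi)^4 * 8 * 5 pi^4/72 = 5/9 p^4, and division by 16 p^2 leaves
  5/144 p^2. The error constants are 32 for the cotangents, 32 off the diagonal, and 1632 = 8 * 34 *
  2 * 3 for truncation at \<open>P\<close>, which is at least p/3; together 1696 = 16 * 106.\<close>

lemma sum_dedekind_sum_square_asymp:
  assumes d: "\<And>n :: nat. 0 < n \<Longrightarrow> n \<le> p\<^sup>2 \<Longrightarrow> real (card {d. d dvd n}) \<le> D"
  shows "\<bar>(\<Sum>u\<in>R1. (dedekind_sum u p)\<^sup>2) - 5/144 * real p ^ 2\<bar> \<le> 106 * real p * D * harm p ^ 3"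
proof -
  define H :: real where "H = harm p"
  define S where "S = (\<Sum>u\<in>R1. (dedekind_sum u p)\<^sup>2)"
  define c where "c = (real p / pi) ^ 4"
  have p0: "real p > 0" using p_pos by simp
  have P: "P > 0" "P \<le> p" using p_eq p_gt_3 by linarith+
  have H1: "H \<ge> 1" using harm_mono[of 1 p, where ?'a = real] p_pos by (simp add: H_def harm_expand)
  have HP: "harm P \<le> H" "harm P \<ge> (0 :: real)" using P harm_mono harm_nonneg by (auto simp: H_def)
  have D1: "D \<ge> 1"
  proof -
    have "{d :: nat. d dvd 1} = {1}" by auto
    then show ?thesis using d[of 1] p_pos by simp
  qed
  have pi4: "pi ^ 4 \<ge> 1" using pi_gt3 by (intro one_le_power) linarith
  have c: "0 \<le> c" "c \<le> real p ^ 4"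
    using pi4 by (auto simp: c_def power_divide divide_le_eq mult_le_cancel_left1)
  have split: "(\<Sum>q\<in>Quad. inv4 q) = 8 * ratio_sum P + (\<Sum>q\<in>Quad - Diag. inv4 q)"
    using sum.subset_diff[OF Diag_subset, of inv4] sum_Diag by simp
  have e1: "\<bar>16 * real p ^ 2 * S - c * (\<Sum>q\<in>Quad. inv4 q)\<bar> \<le> 32 * real p ^ 3 * H ^ 3"
  proof -
    have "32 * real p ^ 3 * harm P ^ 3 \<le> 32 * real p ^ 3 * H ^ 3"
      using HP by (intro mult_left_mono power_mono) auto
    then show ?thesis using sum_Quad_cot_approx unfolding S_def c_def by linarith
  qed
  have e2: "\<bar>c * (\<Sum>q\<in>Quad - Diag. inv4 q)\<bar> \<le> 32 * real p ^ 3 * D * H ^ 3"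
  proof -
    have "\<bar>\<Sum>q\<in>Quad - Diag. inv4 q\<bar> \<le> 32 * D * harm P ^ 2 * harm p / real p"
      by (rule sum_off_diagonal[OF d])
    also have "\<dots> \<le> 32 * D * H ^ 2 * H / real p"
      unfolding H_def[symmetric] using HP D1 H1 p0
      by (intro divide_right_mono mult_right_mono mult_left_mono power_mono) auto
    finally have "\<bar>c\<bar> * \<bar>\<Sum>q\<in>Quad - Diag. inv4 q\<bar> \<le> real p ^ 4 * (32 * D * H ^ 2 * H / real p)"
      using c by (intro mult_mono) auto
    also have "\<dots> = 32 * real p ^ 3 * D * H ^ 3"
      using p0 by (simp add: eval_nat_numeral)
    finally show ?thesis by (simp add: abs_mult)
  qed
  have e3: "\<bar>c * (8 * ratio_sum P) - 5/9 * real p ^ 4\<bar> \<le> 1632 * real p ^ 3 * H"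
  proof -
    have "5/9 * real p ^ 4 = c * (8 * (5 * pi ^ 4 / 72))"
      by (simp add: c_def power_divide)
    then have "c * (8 * ratio_sum P) - 5/9 * real p ^ 4 = c * (8 * (ratio_sum P - 5 * pi ^ 4 / 72))"
      by (simp only: right_diff_distrib)
    then have "\<bar>c * (8 * ratio_sum P) - 5/9 * real p ^ 4\<bar> = c * (8 * \<bar>ratio_sum P - 5 * pi ^ 4 / 72\<bar>)"
      using c by (simp only: abs_mult abs_numeral abs_of_nonneg)
    also have "\<dots> \<le> real p ^ 4 * (8 * (34 * (1 + harm P) / real P))"
      using c ratio_sum_asymp[OF P(1)] by (intro mult_mono) auto
    also have "\<dots> \<le> real p ^ 4 * (8 * (34 * (H + H) / (real p / 3)))"
    proof -
      have "real_of_int (int p) \<le> real_of_int (3 * int P)"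
        using p_eq P by (intro of_int_le_iff[THEN iffD2]) linarith
      then have "real p / 3 \<le> real P" by simp
      then show ?thesis
        using HP H1 p0 by (intro mult_left_mono frac_le) auto
    qed
    also have "\<dots> = 1632 * real p ^ 3 * H"
      using p0 by (simp add: eval_nat_numeral field_simps)
    finally show ?thesis .
  qed
  have H3: "H \<le> D * H ^ 3" "H ^ 3 \<le> D * H ^ 3"
  proof -
    have "H ^ 1 \<le> H ^ 3" using H1 by (intro power_increasing) auto
    moreover have "1 * H ^ 3 \<le> D * H ^ 3" using D1 H1 by (intro mult_right_mono) auto
    ultimately show "H \<le> D * H ^ 3" "H ^ 3 \<le> D * H ^ 3" by simp_all
  qed
  have "\<bar>16 * real p ^ 2 * S - 5/9 * real p ^ 4\<bar>
     \<le> 32 * real p ^ 3 * H ^ 3 + 32 * real p ^ 3 * D * H ^ 3 + 1632 * real p ^ 3 * H"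
    using e1 e2 e3 unfolding split distrib_left by linarith
  also have "\<dots> = real p ^ 3 * (32 * H ^ 3 + 32 * (D * H ^ 3) + 1632 * H)"
    by (simp add: algebra_simps)
  also have "\<dots> \<le> real p ^ 3 * (1696 * (D * H ^ 3))"
    using H3 by (intro mult_left_mono) auto
  finally have "16 * real p ^ 2 * \<bar>S - 5/144 * real p ^ 2\<bar> \<le> 16 * real p ^ 2 * (106 * real p * D * H ^ 3)"
  proof -
    assume *: "\<bar>16 * real p ^ 2 * S - 5/9 * real p ^ 4\<bar> \<le> real p ^ 3 * (1696 * (D * H ^ 3))"
    have "16 * real p ^ 2 * S - 5/9 * real p ^ 4 = 16 * real p ^ 2 * (S - 5/144 * real p ^ 2)"
      by (simp add: algebra_simps eval_nat_numeral)
    then have "\<bar>16 * real p ^ 2 * S - 5/9 * real p ^ 4\<bar> = 16 * real p ^ 2 * \<bar>S - 5/144 * real p ^ 2\<bar>"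
      by (simp add: abs_mult)
    moreover have "real p ^ 3 * (1696 * (D * H ^ 3)) = 16 * real p ^ 2 * (106 * real p * D * H ^ 3)"
      by (simp add: eval_nat_numeral)
    ultimately show ?thesis using * by (simp only:)
  qed
  then show ?thesis using p0 unfolding S_def H_def by (simp add: mult_ac del: power_Suc)
qed

text \<open>The errors in the two factors of the exact product formula add up to 2506 * 107 + 3 *
  106 + 1 = 268461. The round constant also absorbs the quotient x / (x - 1) left by dividing by p -
  1.\<close>

lemma main_estimate:
  assumes d: "\<And>n :: nat. 0 < n \<Longrightarrow> n \<le> p\<^sup>2 \<Longrightarrow> real (card {d. d dvd n}) \<le> D"
  shows "\<bar>(\<Sum>m\<in>R1. \<Sum>n\<in>R1. W m n * (dedekind_sum (m * modular_inverse (int p) n) p)\<^sup>2) - 5/48 * real p ^ 5\<bar>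
     \<le> 1000000 * real p ^ 4 * (D * harm p ^ 3)"
proof -
  define X where "X = (\<Sum>m\<in>R1. \<Sum>n\<in>R1. W m n * (dedekind_sum (m * modular_inverse (int p) n) p)\<^sup>2)"
  define M where "M = (\<Sum>m\<in>R1. \<Sum>n\<in>R1. W m n)"
  define S where "S = (\<Sum>u\<in>R1. (dedekind_sum u p)\<^sup>2)"
  define E where "E = D * harm p ^ 3"
  define x where "x = real p"
  have x: "x \<ge> 7" using p_ge_7 by (simp add: x_def)
  have px: "real (p - 1) = x - 1" using p_pos by (simp add: x_def of_nat_diff)
  have E1: "E \<ge> 1"
  proof -
    have "{d :: nat. d dvd 1} = {1}" by auto
    then have "D \<ge> 1" using d[of 1] p_pos by simp
    moreover have "harm p \<ge> (1 :: real)" using harm_mono[of 1 p, where ?'a = real] p_pos by (simp add: harm_expand)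
    ultimately have "1 * 1 ^ 3 \<le> D * harm p ^ 3" by (intro mult_mono power_mono) auto
    then show ?thesis by (simp add: E_def)
  qed
  have prod: "(x - 1) * X = M * S"
  proof -
    have "residue_periodic p (\<lambda>u. (dedekind_sum u p)\<^sup>2)"
      using residue_periodicD[OF dedekind_sum_periodic] by (intro residue_periodicI) simp
    from W_decorrelation[OF this] show ?thesis
      by (simp add: dedekind_sum_minus X_def M_def S_def px[symmetric])
  qed
  have M: "\<bar>M - 3 * x ^ 4\<bar> \<le> 2506 * x ^ 3" using sum_W_R1 by (simp add: M_def x_def)
  have S: "\<bar>S - 5/144 * x ^ 2\<bar> \<le> 106 * x * E"
    using sum_dedekind_sum_square_asymp[OF d] by (simp add: S_def x_def E_def mult_ac)
  \<comment> \<open>The last term compensates for the factor x - 1 standing where the main term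
    would want x.\<close>
  have "(x - 1) * (X - 5/48 * x ^ 5) = (M - 3 * x ^ 4) * S + 3 * x ^ 4 * (S - 5/144 * x ^ 2) + 5/48 * x ^ 5"
  proof -
    have "(x - 1) * (X - 5/48 * x ^ 5) = (x - 1) * X - 5/48 * x ^ 6 + 5/48 * x ^ 5"
      by (simp add: field_simps eval_nat_numeral)
    moreover have "(M - 3 * x ^ 4) * S + 3 * x ^ 4 * (S - 5/144 * x ^ 2) = M * S - 5/48 * x ^ 6"
      by (simp add: field_simps eval_nat_numeral)
    ultimately show ?thesis using prod by simp
  qed
  also have "\<bar>\<dots>\<bar> \<le> \<bar>M - 3 * x ^ 4\<bar> * \<bar>S\<bar> + 3 * x ^ 4 * \<bar>S - 5/144 * x ^ 2\<bar> + 5/48 * x ^ 5"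
    using x by (intro order_trans[OF abs_triangle_ineq] add_mono) (auto simp: abs_mult)
  also have "\<dots> \<le> 2506 * x ^ 3 * (107 * x ^ 2 * E) + 3 * x ^ 4 * (106 * x * E) + x ^ 5 * E"
  proof -
    have "x * E * 1 \<le> x * E * x" using x E1 by (intro mult_left_mono) auto
    then have "106 * x * E \<le> 106 * x ^ 2 * E" by (simp add: power2_eq_square mult_ac)
    moreover have "x ^ 2 * 1 \<le> x ^ 2 * E" using E1 by (intro mult_left_mono) auto
    moreover have "x ^ 2 \<ge> 0" by simp
    ultimately have "\<bar>S\<bar> \<le> 107 * x ^ 2 * E" using S by linarith
    then have "\<bar>M - 3 * x ^ 4\<bar> * \<bar>S\<bar> \<le> 2506 * x ^ 3 * (107 * x ^ 2 * E)"
      using M x by (intro mult_mono) auto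
    moreover have "3 * x ^ 4 * \<bar>S - 5/144 * x ^ 2\<bar> \<le> 3 * x ^ 4 * (106 * x * E)"
      using S x by (intro mult_left_mono) auto
    moreover have "5/48 * x ^ 5 \<le> x ^ 5 * E"
    proof -
      have "5/48 * x ^ 5 \<le> x ^ 5 * 1" using x by simp
      also have "\<dots> \<le> x ^ 5 * E" using x E1 by (intro mult_left_mono) auto
      finally show ?thesis .
    qed
    ultimately show ?thesis by linarith
  qed
  also have "\<dots> = 268461 * (x ^ 5 * E)"
    by (simp add: eval_nat_numeral)
  also have "\<dots> \<le> (x - 1) * (1000000 * x ^ 4 * E)"
  proof -
    have "268461 * x \<le> (x - 1) * 1000000" using x by simp
    then have "268461 * x * (x ^ 4 * E) \<le> (x - 1) * 1000000 * (x ^ 4 * E)"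
      using x E1 by (intro mult_right_mono) auto
    then show ?thesis by (simp add: eval_nat_numeral mult_ac)
  qed
  finally have "(x - 1) * \<bar>X - 5/48 * x ^ 5\<bar> \<le> (x - 1) * (1000000 * x ^ 4 * E)"
    using x by (simp add: abs_mult)
  then show ?thesis using x by (simp add: X_def x_def E_def)
qed

end

theorem theorem1p2:
  shows "\<exists>K::real. \<forall>p::nat. prime p \<and> p > 3 \<and> p mod 4 = 3 \<longrightarrow>
    \<bar>(\<Sum>m=1..p-1. \<Sum>n=1..p-1.
        (cmod (two_term_sum (int m) (int n) 5 1 p)) ^ 4
        * (dedekind_sum (int m * modular_inverse (int p) (int n)) p) ^ 2)
      - 5/48 * real p ^ 5\<bar>
    \<le> K * real p ^ 4 * exp (3 * ln (real p) / ln (ln (real p)))"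
proof -
  obtain K where K: "\<And>p n :: nat. p \<ge> 7 \<Longrightarrow> 0 < n \<Longrightarrow> n \<le> p\<^sup>2 \<Longrightarrow>
     real (card {d. d dvd n}) * (1 + ln (real p)) ^ 3 \<le> K * exp (3 * ln (real p) / ln (ln (real p)))"
    using divisor_bound by blast
  show ?thesis
  proof (intro exI[of _ "1000000 * K"] allI impI, elim conjE)
    fix p :: nat assume p: "prime p" "p > 3" "p mod 4 = 3"
    interpret prime_3_mod_4 p by unfold_locales (use p in auto)
    define E where "E = exp (3 * ln (real p) / ln (ln (real p)))"
    define L where "L = 1 + ln (real p)"
    have L: "L \<ge> 1" using p by (simp add: L_def)
    have reindex: "(\<Sum>m\<in>R1. f m) = (\<Sum>m=1..p-1. f (int m))" for f :: "int \<Rightarrow> real"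
      by (rule sum.reindex_bij_witness[of _ int nat]) (use p in auto)
    \<comment> \<open>The cube of \<open>L\<close> is divided out of the divisor bound here so that
      it cancels against \<open>harm p ^ 3\<close> below.\<close>
    have "real (card {d. d dvd n}) \<le> K * E / L ^ 3" if "0 < n" "n \<le> p\<^sup>2" for n
      using K[OF p_ge_7 that] L by (simp add: E_def L_def[symmetric] pos_le_divide_eq)
    from main_estimate[OF this]
    have "\<bar>(\<Sum>m\<in>R1. \<Sum>n\<in>R1. W m n * (dedekind_sum (m * modular_inverse (int p) n) p)\<^sup>2) - 5/48 * real p ^ 5\<bar>
       \<le> 1000000 * real p ^ 4 * (K * E / L ^ 3 * harm p ^ 3)" .
    also have "\<dots> \<le> 1000000 * real p ^ 4 * (K * E / L ^ 3 * L ^ 3)"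
    proof (intro mult_left_mono power_mono)
      show "harm p \<le> L" using harm_le_ln p_pos by (simp add: L_def)
      \<comment> \<open>The sign of \<open>K\<close> is not recorded in
        \<open>divisor_bound\<close>; its instance n = 1 yields \<open>K * E\<close> \<ge>
        0.\<close>
      have "0 \<le> real (card {d :: nat. d dvd 1}) * L ^ 3" using L by simp
      also have "\<dots> \<le> K * E" using K[OF p_ge_7, of 1] p_pos by (simp add: E_def L_def)
      finally show "0 \<le> K * E / L ^ 3" using L by simp
    qed (auto simp: harm_nonneg)
    also have "\<dots> = 1000000 * K * real p ^ 4 * E" using L by simp
    finally show "\<bar>(\<Sum>m=1..p-1. \<Sum>n=1..p-1. (cmod (two_term_sum (int m) (int n) 5 1 p)) ^ 4
        * (dedekind_sum (int m * modular_inverse (int p) (int n)) p) ^ 2) - 5/48 * real p ^ 5\<bar>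
        \<le> 1000000 * K * real p ^ 4 * exp (3 * ln (real p) / ln (ln (real p)))"
      unfolding reindex W_eq E_def .
  qed
qed

end
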